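(* Let $G$ be a group, let $\mathbb{F}$ be an infinite field, let $n\ge 1$, let $\Gamma$ be a $G$-grading on the algebra $\mathrm{UT}_n$ of $n\times n$ upper triangular matrices over $\mathbb{F}$, and let $\ast$ be a homogeneous involution on $(\mathrm{UT}_n,\Gamma)$. Then, as $m\to\infty$, $$c_m(\mathrm{UT}_n,\Gamma,\ast)\sim\frac{2^{\lfloor\frac{n-1}{2}\rfloor}}{n^{n-1}}\,m^{n-1}n^m.$$ In particular, $\exp(\mathrm{UT}_n,\Gamma,\ast)=n$.
   Context: All algebras are over the field $\mathbb{F}$; $\mathrm{UT}_n$ is the associative algebra of $n\times n$ upper triangular matrices over $\mathbb{F}$. $G$ is an arbitrary group, written multiplicatively. A $G$-grading $\Gamma$ on an algebra $\mathcal{A}$ is a vector space decomposition $\mathcal{A}=\bigoplus_{g\in G}\mathcal{A}_g$ with $\mathcal{A}_g\mathcal{A}_h\subseteq\mathcal{A}_{gh}$ for all $g,h\in G$. An involution on $\mathcal{A}$ is an $\mathbb{F}$-linear map $\ast:\mathcal{A}\to\mathcal{A}$ with $(ab)^\ast=b^\ast a^\ast$ and $(a^\ast)^\ast=a$. It is a homogeneous involution on $(\mathcal{A},\Gamma)$ (with respect to $\psi$) if there is a map $\psi:G\to G$ such that $\mathcal{A}_g^\ast\subseteq\mathcal{A}_{\psi(g)}$ for all $g\in G$. For each $g\in G$ take variables $x_1^{(g)},x_2^{(g)},\ldots$ of degree $g$. In the free $G$-graded associative algebra with involution $\ast$ on these variables (that is, the free associative algebra in the symbols $x_i^{(g)}$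 and $(x_i^{(g)})^\ast$, with $\ast$ extended as an involution), let $$P^{(\ast)}_m=\mathrm{Span}\left\{\left(x_{\sigma(1)}^{(g_1)}\right)^{\delta_1}\cdots\left(x_{\sigma(m)}^{(g_m)}\right)^{\delta_m}\ \middle|\ \sigma\in\mathcal{S}_m,\ g_1,\ldots,g_m\in G,\ \delta_\ell\in\{\emptyset,\ast\}\right\},$$ where $\mathcal{S}_m$ is the symmetric group on $m$ elements, $x^{\emptyset}=x$ and $x^{\ast}$ is the image of $x$ under $\ast$. Let $\mathrm{Id}(\mathcal{A},\Gamma,\ast)$ be the set of graded polynomial identities with involution of $(\mathcal{A},\Gamma,\ast)$, i.e. the elements of this free algebra that vanish under every substitution of each $x_i^{(g)}$ by an element $a_i^{(g)}$ of $\mathcal{A}_g$ and of $(x_i^{(g)})^\ast$ by $(a_i^{(g)})^\ast$. The graded-star-codimension sequence is $$c_m(\mathcal{A},\Gamma,\ast)=\dim P_m^{(\ast)}/\bigl(P_m^{(\ast)}\cap\mathrm{Id}(\mathcal{A},\Gamma,\ast)\bigr).$$ For $f,g:\mathbb{N}\to\mathbb{N}$ (or real-valued), $f\sim g$ means $\lim_{m\to\infty}f(m)/g(m)=1$. The exponent is $\exp(\mathcal{A},\Gamma,\ast)=\lim_{m\to\infty}\sqrt[m]{c_m(\mathcal{A},\Gamma,\ast)}$. *)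

theory Defs
  imports
    Complex_Main
    "HOL-Library.Poly_Mapping"
    "HOL-Library.Landau_Symbols"
    "HOL-Combinatorics.Permutations"
    "HOL-Algebra.Group"
    "Jordan_Normal_Form.Matrix"
begin

definition UT :: "nat \<Rightarrow> 'f::field mat set" where
  "UT n = {M \<in> carrier_mat n n. upper_triangular M}"

text \<open>The last conjunct says that \<open>UT n\<close> is the (internal) direct sum of the \<open>A g\<close>, for \<open>g\<close> in the
  possibly infinite group; a family \<open>a\<close> is forced to vanish outside the carrier of \<open>G\<close> only
  to make it unique as a function on the whole type.\<close>
definition UT_grading ::
    "('g, 'x) monoid_scheme \<Rightarrow> nat \<Rightarrow> ('g \<Rightarrow> 'f::field mat set) \<Rightarrow> bool" where
  "UT_grading G n A \<longleftrightarrow>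
     (\<forall>g\<in>carrier G. A g \<subseteq> UT n \<and> 0\<^sub>m n n \<in> A g \<and>
        (\<forall>M\<in>A g. \<forall>N\<in>A g. M + N \<in> A g) \<and> (\<forall>c. \<forall>M\<in>A g. c \<cdot>\<^sub>m M \<in> A g)) \<and>
     (\<forall>g\<in>carrier G. \<forall>h\<in>carrier G. \<forall>M\<in>A g. \<forall>N\<in>A h. M * N \<in> A (g \<otimes>\<^bsub>G\<^esub> h)) \<and>
     (\<forall>M\<in>UT n. \<exists>!a. (\<forall>g\<in>carrier G. a g \<in> A g) \<and> (\<forall>g. g \<notin> carrier G \<longrightarrow> a g = 0\<^sub>m n n) \<and>
        finite {g. a g \<noteq> 0\<^sub>m n n} \<and>
        M = (\<Oplus>\<^bsub>module_mat TYPE('f) n n\<^esub> g\<in>{g. a g \<noteq> 0\<^sub>m n n}. a g))"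

definition UT_involution :: "nat \<Rightarrow> ('f::field mat \<Rightarrow> 'f mat) \<Rightarrow> bool" where
  "UT_involution n star \<longleftrightarrow>
     (\<forall>M\<in>UT n. star M \<in> UT n) \<and>
     (\<forall>M\<in>UT n. \<forall>N\<in>UT n. star (M + N) = star M + star N) \<and>
     (\<forall>c. \<forall>M\<in>UT n. star (c \<cdot>\<^sub>m M) = c \<cdot>\<^sub>m star M) \<and>
     (\<forall>M\<in>UT n. \<forall>N\<in>UT n. star (M * N) = star N * star M) \<and>
     (\<forall>M\<in>UT n. star (star M) = M)"

definition homogeneous_involution ::
    "('g, 'x) monoid_scheme \<Rightarrow> nat \<Rightarrow> ('g \<Rightarrow> 'f::field mat set) \<Rightarrow> ('f mat \<Rightarrow> 'f mat) \<Rightarrow> bool" where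
  "homogeneous_involution G n A star \<longleftrightarrow>
     UT_involution n star \<and>
     (\<exists>\<psi>. \<forall>g\<in>carrier G. \<psi> g \<in> carrier G \<and> star ` A g \<subseteq> A (\<psi> g))"


text \<open>The free graded algebra with involution.  \<open>Var i g\<close> stands for $x_i^{(g)}$ and \<open>VarStar i g\<close>
  for its image under the involution.  Elements of the free algebra are finitely supported functions
  on words in these letters, i.e. linear combinations of noncommutative monomials; only
  the vector space structure and the evaluations are used here.\<close>

datatype 'g letter = Var nat 'g | VarStar nat 'g

type_synonym ('g, 'f) free_poly = "'g letter list \<Rightarrow>\<^sub>0 'f"

definition letters :: "('g, 'x) monoid_scheme \<Rightarrow> 'g letter set" where
  "letters G = {Var i g | i g. 1 \<le> i \<and> g \<in> carrier G} \<union> {VarStar i g | i g. 1 \<le> i \<and> g \<in> carrier G}"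

definition free_algebra :: "('g, 'x) monoid_scheme \<Rightarrow> ('g, 'f::field) free_poly set" where
  "free_algebra G = {p. \<forall>w\<in>Poly_Mapping.keys p. set w \<subseteq> letters G}"

definition scale :: "'f::field \<Rightarrow> ('g, 'f) free_poly \<Rightarrow> ('g, 'f) free_poly" where
  "scale c p = Poly_Mapping.map ((*) c) p"

lemma lookup_scale: "Poly_Mapping.lookup (scale c p) w = c * Poly_Mapping.lookup p w"
  unfolding scale_def by (simp add: Poly_Mapping.map.rep_eq when_def)

lemma vector_space_scale: "vector_space (scale :: 'f::field \<Rightarrow> ('g, 'f) free_poly \<Rightarrow> _)"
  by unfold_locales
    (auto intro!: poly_mapping_eqI simp: lookup_scale lookup_add algebra_simps)

fun eval_letter :: "('f mat \<Rightarrow> 'f mat) \<Rightarrow> (nat \<Rightarrow> 'g \<Rightarrow> 'f mat) \<Rightarrow> 'g letter \<Rightarrow> 'f::field mat" where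
  "eval_letter star a (Var i g) = a i g"
| "eval_letter star a (VarStar i g) = star (a i g)"

definition eval_word ::
    "nat \<Rightarrow> ('f mat \<Rightarrow> 'f mat) \<Rightarrow> (nat \<Rightarrow> 'g \<Rightarrow> 'f mat) \<Rightarrow> 'g letter list \<Rightarrow> 'f::field mat" where
  "eval_word n star a w = foldr (\<lambda>l M. eval_letter star a l * M) w (1\<^sub>m n)"

definition eval_poly ::
    "nat \<Rightarrow> ('f mat \<Rightarrow> 'f mat) \<Rightarrow> (nat \<Rightarrow> 'g \<Rightarrow> 'f mat) \<Rightarrow> ('g, 'f) free_poly \<Rightarrow> 'f::field mat" where
  "eval_poly n star a p =
     (\<Oplus>\<^bsub>module_mat TYPE('f) n n\<^esub> w\<in>Poly_Mapping.keys p. Poly_Mapping.lookup p w \<cdot>\<^sub>m eval_word n star a w)"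

definition star_identities :: "('g, 'x) monoid_scheme \<Rightarrow> nat \<Rightarrow> ('g \<Rightarrow> 'f::field mat set) \<Rightarrow>
    ('f mat \<Rightarrow> 'f mat) \<Rightarrow> ('g, 'f) free_poly set" where
  "star_identities G n A star =
     {p \<in> free_algebra G.
        \<forall>a. (\<forall>i\<ge>1. \<forall>g\<in>carrier G. a i g \<in> A g) \<longrightarrow> eval_poly n star a p = 0\<^sub>m n n}"

definition multilinear_monomials :: "('g, 'x) monoid_scheme \<Rightarrow> nat \<Rightarrow> ('g, 'f::field) free_poly set" where
  "multilinear_monomials G m =
     {Poly_Mapping.single
        (map (\<lambda>k. if \<delta> k then VarStar (\<sigma> k) (g k) else Var (\<sigma> k) (g k)) [1..<Suc m]) 1 | \<sigma> g \<delta>.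
        \<sigma> permutes {1..m} \<and> (\<forall>k\<in>{1..m}. g k \<in> carrier G)}"

definition multilinear_space :: "('g, 'x) monoid_scheme \<Rightarrow> nat \<Rightarrow> ('g, 'f::field) free_poly set" where
  "multilinear_space G m = module.span scale (multilinear_monomials G m)"


text \<open>Dimension of a quotient \<open>V / W\<close> of subspaces \<open>W \<subseteq> V\<close>, for a scalar multiplication \<open>s\<close>.  A basis of \<open>V / W\<close> is given by a set
  \<open>B\<close> of representatives: the classes of the elements of \<open>B\<close> are pairwise distinct, linearly
  independent and generate \<open>V / W\<close>.  As with the library constant \<open>dim\<close>, the value is \<open>0\<close> if the
  quotient is infinite-dimensional.\<close>

definition quotient_basis ::
    "('f::field \<Rightarrow> 'v::ab_group_add \<Rightarrow> 'v) \<Rightarrow> 'v set \<Rightarrow> 'v set \<Rightarrow> 'v set \<Rightarrow> bool" where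
  "quotient_basis s V W B \<longleftrightarrow>
     B \<subseteq> V \<and>
     (\<forall>t c. finite t \<and> t \<subseteq> B \<and> (\<Sum>b\<in>t. s (c b) b) \<in> W \<longrightarrow> (\<forall>b\<in>t. c b = 0)) \<and>
     (\<forall>v\<in>V. \<exists>u\<in>module.span s B. v - u \<in> W)"

definition quotient_dim ::
    "('f::field \<Rightarrow> 'v::ab_group_add \<Rightarrow> 'v) \<Rightarrow> 'v set \<Rightarrow> 'v set \<Rightarrow> nat" where
  "quotient_dim s V W = card (SOME B. quotient_basis s V W B)"

definition star_codim :: "('g, 'x) monoid_scheme \<Rightarrow> nat \<Rightarrow> ('g \<Rightarrow> 'f::field mat set) \<Rightarrow>
    ('f mat \<Rightarrow> 'f mat) \<Rightarrow> nat \<Rightarrow> nat" where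
  "star_codim G n A star m =
     quotient_dim scale (multilinear_space G m)
       (multilinear_space G m \<inter> star_identities G n A star)"

end

theory Submission
  imports Defs "HOL-Real_Asymp.Real_Asymp"
begin

text \<open>Only the values of multilinear polynomials matter. A graded substitution is the same
  thing as one matrix \<open>X k\<close> in \<open>UT n\<close> for each index \<open>k\<close>: the variable of index \<open>k\<close> and degree \<open>g\<close> takes
  the component of \<open>X k\<close> of degree \<open>g\<close>. So the codimension is the dimension of the space of functions of
  \<open>X 1, \<dots>, X m\<close> spanned by the multilinear words, and a function in that space is determined
  by its values at tuples of unit matrices, that is, by its entries at the label maps that
  send each index to a pair \<open>(p, q)\<close> with \<open>p \<le> q < n\<close>.

  Upper bound. The product of the letters has a nonzero entry only if at most \<open>n - 1\<close> of them lie
  in the radical. The label maps with fewer than \<open>n - 1\<close> pairs off the diagonal contribute a lower order term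
  (\<open>card_degenerate\<close>). If there are exactly \<open>n - 1\<close> such pairs, the entry is the one at \<open>(0, n - 1)\<close>, and the letters in
  question have to contribute the entries at the simple roots \<open>(0, 1), (1, 2), \<dots>, (n - 2, n - 1)\<close> in this order. The letter
  that supplies the entry \<open>(i, i + 1)\<close> is a component of a unit matrix or the image of one under the
  involution, and this entry vanishes unless the label is \<open>(i, i + 1)\<close> or its mirror
  image \<open>(n - 2 - i, n - 1 - i)\<close>. Here the grading and the involution enter: the components respect the
  radical and its powers, the diagonal is of trivial degree (\<open>proj_radical\<close>, \<open>diag_degree\<close>), and an involution reverses
  the diagonal and, on the radical, the first superdiagonal up to nonzero scalars (\<open>star_diag\<close>,
  \<open>star_superdiag\<close>). The label maps that remain are
  the balanced ones, and there are \<open>2 ^ ((n - 1) div 2)\<close> times \<open>m (m - 1) \<dots> (m - n + 2)\<close> times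
  \<open>n ^ (m - n + 1)\<close> of them (\<open>card_balanced\<close>): in each of the \<open>(n - 1) div 2\<close> mirror pairs of roots, two positions receive
  one of four pairs of labels, and the order of the two positions does not matter.

  Lower bound. By adding up components, the ungraded variables and their images under the involution
  are available. For a balanced label map \<open>f\<close> consider \<open>Q 0 * K 0 * Q 1 * \<dots> * K (n - 2) * Q (n - 1)\<close>, where \<open>Q j\<close> is
  the product of the variables labelled \<open>(j, j)\<close> that are not pivots, and \<open>K i\<close> is the commutator of the variable that carries
  the root at step \<open>i\<close> with a pivot: a variable of smaller index whose label is the diagonal pair in the row of
  this root. All commutators are in the radical, so the entry at \<open>(0, n - 1)\<close> is the product of the diagonal entries
  of the \<open>Q j\<close> and of the first superdiagonal entries of the \<open>K i\<close>. The
  commutator at step \<open>i\<close> is formed with both variables starred or with neither, so it involves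
  one root only, and up to sign its two terms differ by an exchange of the two variables. Hence \<open>f\<close> is the
  leading label map of this function in a suitable order (\<open>pivot_chain_support\<close>), and distinct \<open>f\<close>
  give independent functions (\<open>star_codim_lower\<close>). Pivots exist as soon as every label \<open>(j, j)\<close> occurs in each of \<open>n - 1\<close>
  fixed segments of indices in front of the roots; for segments of length \<open>s\<close> this costs a factor that tends
  to one as \<open>s\<close> grows. The two bounds have the same leading term.\<close>

section \<open>Powers of the radical of \<open>UT n\<close>\<close>

text \<open>The power with exponent \<open>d\<close> of the Jacobson radical of \<open>UT n\<close>; the exponent \<open>0\<close> gives \<open>UT n\<close> itself.\<close>

definition rad_power :: "nat \<Rightarrow> nat \<Rightarrow> 'f::field mat set" where
  "rad_power n d = {M \<in> carrier_mat n n. \<forall>i<n. \<forall>j<n. j < i + d \<longrightarrow> M $$ (i, j) = 0}"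

lemma UT_eq_rad_power_0: "UT n = rad_power n 0"
  unfolding UT_def rad_power_def upper_triangular_def by auto

lemma rad_powerD:
  assumes "M \<in> rad_power n d"
  shows "M \<in> carrier_mat n n" "\<And>i j. i < n \<Longrightarrow> j < n \<Longrightarrow> j < i + d \<Longrightarrow> M $$ (i, j) = 0"
  using assms unfolding rad_power_def by auto

lemma rad_power_mono: "d \<le> e \<Longrightarrow> rad_power n e \<subseteq> rad_power n d"
  unfolding rad_power_def by auto

lemma rad_power_carrier: "M \<in> rad_power n d \<Longrightarrow> M \<in> carrier_mat n n"
  by (rule rad_powerD(1))

lemma rad_power_dim:
  "M \<in> rad_power n d \<Longrightarrow> dim_row M = n" "M \<in> rad_power n d \<Longrightarrow> dim_col M = n"
  by (auto simp: rad_power_def)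

lemma rad_power_zero [simp]: "0\<^sub>m n n \<in> rad_power n d"
  unfolding rad_power_def by auto

lemma rad_power_one [simp]: "1\<^sub>m n \<in> rad_power n 0"
  unfolding rad_power_def by auto

lemma rad_power_add: "M \<in> rad_power n d \<Longrightarrow> N \<in> rad_power n d \<Longrightarrow> M + N \<in> rad_power n d"
  unfolding rad_power_def by auto

lemma rad_power_minus: "M \<in> rad_power n d \<Longrightarrow> N \<in> rad_power n d \<Longrightarrow> M - N \<in> rad_power n d"
  unfolding rad_power_def by auto

lemma rad_power_smult: "M \<in> rad_power n d \<Longrightarrow> c \<cdot>\<^sub>m M \<in> rad_power n d"
  unfolding rad_power_def by auto

lemma mult_mat_entry:
  assumes "M \<in> carrier_mat n n" "N \<in> carrier_mat n n" "i < n" "j < n"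
  shows "(M * N) $$ (i, j) = (\<Sum>k<n. M $$ (i, k) * N $$ (k, j))"
  using assms by (auto simp: scalar_prod_def lessThan_atLeast0)

text \<open>The diagonal number \<open>d + e\<close> of a product only sees the diagonals \<open>d\<close> and \<open>e\<close> of the factors.
  All smaller diagonals of the factors vanish.\<close>

lemma rad_power_mult:
  assumes "M \<in> rad_power n d" "N \<in> rad_power n e"
  shows "M * N \<in> rad_power n (d + e)"
    and "i + d + e < n \<Longrightarrow> (M * N) $$ (i, i + d + e) = M $$ (i, i + d) * N $$ (i + d, i + d + e)"
proof -
  have c: "M \<in> carrier_mat n n" "N \<in> carrier_mat n n" using assms rad_power_carrier by auto
  show "M * N \<in> rad_power n (d + e)"
    unfolding rad_power_def
  proof (intro CollectI conjI allI impI)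
    show "M * N \<in> carrier_mat n n" using c by auto
    fix i j assume ij: "i < n" "j < n" "j < i + (d + e)"
    have "M $$ (i, k) * N $$ (k, j) = 0" if "k < n" for k
      using rad_powerD(2)[OF assms(1) ij(1) that] rad_powerD(2)[OF assms(2) that ij(2)] ij(3)
      by (cases "k < i + d") auto
    then show "(M * N) $$ (i, j) = 0" by (auto simp: mult_mat_entry[OF c ij(1,2)] intro!: sum.neutral)
  qed
  assume i: "i + d + e < n"
  have "M $$ (i, k) * N $$ (k, i + d + e) = 0" if "k < n" "k \<noteq> i + d" for k
    using rad_powerD(2)[OF assms(1) _ that(1), of i] rad_powerD(2)[OF assms(2) that(1) i] i that(2)
    by (cases "k < i + d") auto
  then have "(\<Sum>k<n. M $$ (i, k) * N $$ (k, i + d + e))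
      = (\<Sum>k\<in>{i + d}. M $$ (i, k) * N $$ (k, i + d + e))"
    using i by (intro sum.mono_neutral_right) auto
  then show "(M * N) $$ (i, i + d + e) = M $$ (i, i + d) * N $$ (i + d, i + d + e)"
    using i by (subst mult_mat_entry[OF c]) auto
qed

definition unit_mat :: "nat \<Rightarrow> nat \<times> nat \<Rightarrow> 'f::field mat" where
  "unit_mat n pq = mat n n (\<lambda>ij. if ij = pq then 1 else 0)"

lemma unit_mat_entry [simp]:
  "i < n \<Longrightarrow> j < n \<Longrightarrow> unit_mat n pq $$ (i, j) = (if (i, j) = pq then 1 else 0)"
  unfolding unit_mat_def by auto

lemma unit_mat_carrier [simp]: "unit_mat n pq \<in> carrier_mat n n"
  "dim_row (unit_mat n pq) = n" "dim_col (unit_mat n pq) = n"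
  unfolding unit_mat_def by auto

lemma unit_mat_rad_power: "p + d \<le> q \<Longrightarrow> unit_mat n (p, q) \<in> rad_power n d"
  unfolding rad_power_def by auto

lemma diag_unit_left:
  assumes "M \<in> carrier_mat n n" "p < n" "i < n" "j < n"
  shows "(unit_mat n (p, p) * M) $$ (i, j) = (if i = p then M $$ (i, j) else 0)"
proof -
  have "(\<Sum>k<n. unit_mat n (p, p) $$ (i, k) * M $$ (k, j))
      = (\<Sum>k<n. if k = i then (if i = p then M $$ (i, j) else 0) else 0)"
    using assms by (intro sum.cong) auto
  then show ?thesis using assms by (subst mult_mat_entry[of _ n]) auto
qed

lemma diag_unit_right:
  assumes "M \<in> carrier_mat n n" "q < n" "i < n" "j < n"
  shows "(M * unit_mat n (q, q)) $$ (i, j) = (if j = q then M $$ (i, j) else 0)"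
proof -
  have "(\<Sum>k<n. M $$ (i, k) * unit_mat n (q, q) $$ (k, j))
      = (\<Sum>k<n. if k = j then (if j = q then M $$ (i, j) else 0) else 0)"
    using assms by (intro sum.cong) auto
  then show ?thesis using assms by (subst mult_mat_entry[of _ n]) auto
qed

text \<open>Over an infinite field a diagonal matrix \<open>D\<close> with distinct entries exists, and \<open>[D, -]\<close> is
  then bijective on the radical.\<close>

lemma radical_commutator:
  fixes M :: "'f::field mat"
  assumes "infinite (UNIV :: 'f set)" "M \<in> rad_power n 1"
  obtains D Z where "D \<in> UT n" "Z \<in> UT n" "M = D * Z - Z * D"
proof -
  obtain d :: "nat \<Rightarrow> 'f" where d: "inj d"
    using infinite_countable_subset[OF assms(1)] by auto
  define D where "D = mat n n (\<lambda>(i, j). if i = j then d i else 0)"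
  define Z where "Z = mat n n (\<lambda>(i, j). M $$ (i, j) / (d i - d j))"
  have c: "D \<in> carrier_mat n n" "Z \<in> carrier_mat n n" unfolding D_def Z_def by auto
  have ut: "D \<in> UT n" "Z \<in> UT n"
    unfolding UT_eq_rad_power_0 rad_power_def D_def Z_def using rad_powerD[OF assms(2)] by auto
  have "(D * Z - Z * D) $$ (i, j) = M $$ (i, j)" if ij: "i < n" "j < n" for i j
  proof -
    have "(\<Sum>k<n. D $$ (i, k) * Z $$ (k, j)) = (\<Sum>k<n. if k = i then d i * Z $$ (i, j) else 0)"
      using ij by (intro sum.cong) (auto simp: D_def)
    then have 1: "(D * Z) $$ (i, j) = d i * Z $$ (i, j)"
      using ij by (simp add: mult_mat_entry[OF c(1,2) ij])
    have "(\<Sum>k<n. Z $$ (i, k) * D $$ (k, j)) = (\<Sum>k<n. if k = j then d j * Z $$ (i, j) else 0)"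
      using ij by (intro sum.cong) (auto simp: D_def)
    then have 2: "(Z * D) $$ (i, j) = d j * Z $$ (i, j)"
      using ij by (simp add: mult_mat_entry[OF c(2,1) ij])
    have "d i = d j \<Longrightarrow> M $$ (i, j) = 0"
      using injD[OF d, of i j] rad_powerD(2)[OF assms(2) ij] by auto
    moreover have "Z $$ (i, j) = M $$ (i, j) / (d i - d j)" using ij by (simp add: Z_def)
    moreover have "(D * Z - Z * D) $$ (i, j) = (d i - d j) * Z $$ (i, j)"
      using 1 2 c ij by (simp add: algebra_simps)
    ultimately show ?thesis by (cases "d i = d j") auto
  qed
  then have "M = D * Z - Z * D"
    using c rad_powerD(1)[OF assms(2)] by (intro eq_matI) auto
  with ut show thesis by (rule that)
qed

text \<open>This carries statements about the radical over to its powers: \<open>U\<close> is \<open>M\<close> with its columns moved one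
  step to the left, and \<open>N\<close> is the shift to the right.\<close>

lemma rad_power_Suc_factor:
  assumes "M \<in> rad_power n (Suc d)"
  obtains U N where "U \<in> rad_power n d" "N \<in> rad_power n 1" "M = U * N"
proof -
  define U where "U = mat n n (\<lambda>(i, j). if Suc j < n then M $$ (i, Suc j) else 0)"
  define N :: "'a mat" where "N = mat n n (\<lambda>(i, j). if j = Suc i then 1 else 0)"
  have c: "U \<in> carrier_mat n n" "N \<in> carrier_mat n n" unfolding U_def N_def by auto
  have 1: "U \<in> rad_power n d" "N \<in> rad_power n 1"
    unfolding rad_power_def U_def N_def using rad_powerD[OF assms] by auto
  have "(U * N) $$ (i, j) = M $$ (i, j)" if ij: "i < n" "j < n" for i j
  proof -
    have "(\<Sum>k<n. U $$ (i, k) * N $$ (k, j)) = (\<Sum>k<n. if Suc k = j then M $$ (i, j) else 0)"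
      using ij by (intro sum.cong) (auto simp: U_def N_def)
    also have "\<dots> = M $$ (i, j)"
    proof (cases j)
      case 0 then show ?thesis using rad_powerD(2)[OF assms ij] by simp
    next
      case (Suc j')
      then show ?thesis using ij by simp
    qed
    finally show ?thesis by (simp add: mult_mat_entry[OF c ij])
  qed
  then have "M = U * N"
    using c rad_powerD(1)[OF assms] by (intro eq_matI) auto
  with 1 show thesis by (rule that)
qed

lemma UT_induct [consumes 1, case_names zero add smult unit]:
  assumes M: "(M :: 'f::field mat) \<in> UT n"
    and zero: "P (0\<^sub>m n n)"
    and add: "\<And>M N. M \<in> UT n \<Longrightarrow> N \<in> UT n \<Longrightarrow> P M \<Longrightarrow> P N \<Longrightarrow> P (M + N)"
    and smult: "\<And>c M. M \<in> UT n \<Longrightarrow> P M \<Longrightarrow> P (c \<cdot>\<^sub>m M)"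
    and unit: "\<And>p q. p \<le> q \<Longrightarrow> q < n \<Longrightarrow> P (unit_mat n (p, q))"
  shows "P M"
proof -
  define part where "part S = mat n n (\<lambda>ij. if ij \<in> S then M $$ ij else 0)" for S
  have M0: "M \<in> rad_power n 0" using M by (simp add: UT_eq_rad_power_0)
  have UTp: "part S \<in> UT n" for S
    unfolding UT_eq_rad_power_0 rad_power_def part_def using rad_powerD[OF M0] by auto
  have "finite S \<Longrightarrow> S \<subseteq> {(p, q). p \<le> q \<and> q < n} \<Longrightarrow> P (part S)" for S
  proof (induction S rule: finite_induct)
    case empty
    have "part {} = 0\<^sub>m n n" unfolding part_def by (intro eq_matI) auto
    then show ?case using zero by simp
  next
    case (insert pq S)
    obtain p q where pq: "pq = (p, q)" "p \<le> q" "q < n" using insert.prems by auto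
    have "part (insert pq S) = M $$ pq \<cdot>\<^sub>m unit_mat n pq + part S"
      unfolding part_def using insert.hyps by (intro eq_matI) auto
    moreover have u: "(unit_mat n (p, q) :: 'f mat) \<in> UT n"
      unfolding UT_eq_rad_power_0 by (rule unit_mat_rad_power) (use pq in simp)
    moreover have "P (part S)" using insert by simp
    moreover have "P (M $$ pq \<cdot>\<^sub>m unit_mat n pq)"
      using smult[OF u unit[OF pq(2,3)]] pq(1) by simp
    moreover have "M $$ pq \<cdot>\<^sub>m unit_mat n pq \<in> UT n"
      using u pq(1) unfolding UT_eq_rad_power_0 by (simp add: rad_power_smult)
    ultimately show ?case using add UTp by simp
  qed
  moreover have "finite {(p, q). p \<le> q \<and> q < n}"
    by (rule finite_subset[of _ "{..<n} \<times> {..<n}"]) auto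
  ultimately have "P (part {(p, q). p \<le> q \<and> q < n})" by blast
  moreover have "part {(p, q). p \<le> q \<and> q < n} = M"
    unfolding part_def using rad_powerD[OF M0] by (intro eq_matI) auto
  ultimately show ?thesis by simp
qed

section \<open>Gradings on upper triangular matrices\<close>

lemma finsum_mat_entry:
  assumes "finite S" "\<And>g. g \<in> S \<Longrightarrow> f g \<in> carrier_mat n n" "i < n" "j < n"
  shows "(\<Oplus>\<^bsub>module_mat TYPE('f::field) n n\<^esub> g\<in>S. f g) $$ (i, j) = (\<Sum>g\<in>S. f g $$ (i, j))"
    and "(\<Oplus>\<^bsub>module_mat TYPE('f::field) n n\<^esub> g\<in>S. f g) \<in> carrier_mat n n"
proof -
  interpret abelian_group "module_mat TYPE('f) n n" by (rule abelian_group_mat)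
  have "(\<Oplus>\<^bsub>module_mat TYPE('f) n n\<^esub> g\<in>S. f g) $$ (i, j) = (\<Sum>g\<in>S. f g $$ (i, j))
      \<and> (\<Oplus>\<^bsub>module_mat TYPE('f) n n\<^esub> g\<in>S. f g) \<in> carrier_mat n n"
    using assms(1,2)
  proof (induction S rule: finite_induct)
    case empty
    then show ?case using assms(3,4) by (simp add: module_mat_simps)
  next
    case (insert g S)
    have "(\<Oplus>\<^bsub>module_mat TYPE('f) n n\<^esub> g\<in>insert g S. f g)
        = f g + (\<Oplus>\<^bsub>module_mat TYPE('f) n n\<^esub> g\<in>S. f g)"
      using insert by (subst finsum_insert) (auto simp: module_mat_simps)
    then show ?case using insert assms(3,4) by auto
  qed
  then show "(\<Oplus>\<^bsub>module_mat TYPE('f::field) n n\<^esub> g\<in>S. f g) $$ (i, j) = (\<Sum>g\<in>S. f g $$ (i, j))"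
    and "(\<Oplus>\<^bsub>module_mat TYPE('f::field) n n\<^esub> g\<in>S. f g) \<in> carrier_mat n n" by auto
qed

locale graded_UT = group G
  for G :: "('g, 'x) monoid_scheme" (structure) +
  fixes n :: nat and A :: "'g \<Rightarrow> 'f::field mat set"
  assumes inf: "infinite (UNIV :: 'f set)"
    and n_pos: "n \<ge> 1"
    and grading: "UT_grading G n A"
begin

lemma component_UT: "g \<in> carrier G \<Longrightarrow> M \<in> A g \<Longrightarrow> M \<in> UT n"
  and component_zero: "g \<in> carrier G \<Longrightarrow> 0\<^sub>m n n \<in> A g"
  and component_add: "g \<in> carrier G \<Longrightarrow> M \<in> A g \<Longrightarrow> N \<in> A g \<Longrightarrow> M + N \<in> A g"
  and component_smult: "g \<in> carrier G \<Longrightarrow> M \<in> A g \<Longrightarrow> c \<cdot>\<^sub>m M \<in> A g"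
  and component_mult: "g \<in> carrier G \<Longrightarrow> h \<in> carrier G \<Longrightarrow> M \<in> A g \<Longrightarrow> N \<in> A h \<Longrightarrow> M * N \<in> A (g \<otimes> h)"
  using grading unfolding UT_grading_def by auto

lemma UT_carrier: "M \<in> UT n \<Longrightarrow> M \<in> carrier_mat n n"
  unfolding UT_def by simp

lemma UT_entry:
  "N \<in> UT n \<Longrightarrow> i < n \<Longrightarrow> j < n \<Longrightarrow> (M + N) $$ (i, j) = M $$ (i, j) + N $$ (i, j)"
  "N \<in> UT n \<Longrightarrow> i < n \<Longrightarrow> j < n \<Longrightarrow> (M - N) $$ (i, j) = M $$ (i, j) - N $$ (i, j)"
  "N \<in> UT n \<Longrightarrow> i < n \<Longrightarrow> j < n \<Longrightarrow> (c \<cdot>\<^sub>m N) $$ (i, j) = c * N $$ (i, j)"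
  unfolding UT_def by auto

lemma UT_closed:
  "0\<^sub>m n n \<in> UT n" "1\<^sub>m n \<in> UT n"
  "M \<in> UT n \<Longrightarrow> N \<in> UT n \<Longrightarrow> M + N \<in> UT n"
  "M \<in> UT n \<Longrightarrow> N \<in> UT n \<Longrightarrow> M - N \<in> UT n"
  "M \<in> UT n \<Longrightarrow> c \<cdot>\<^sub>m M \<in> UT n"
  "M \<in> UT n \<Longrightarrow> N \<in> UT n \<Longrightarrow> M * N \<in> UT n"
  unfolding UT_eq_rad_power_0
  using rad_power_add rad_power_minus rad_power_smult rad_power_mult(1)[of M n 0 N 0] by auto

lemma rad_power_UT: "M \<in> rad_power n d \<Longrightarrow> M \<in> UT n"
  unfolding UT_eq_rad_power_0 using rad_power_mono[of 0 d n] by auto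

definition decomposition :: "'f mat \<Rightarrow> ('g \<Rightarrow> 'f mat) \<Rightarrow> bool" where
  "decomposition M a \<longleftrightarrow> (\<forall>g\<in>carrier G. a g \<in> A g) \<and> (\<forall>g. g \<notin> carrier G \<longrightarrow> a g = 0\<^sub>m n n) \<and>
     finite {g. a g \<noteq> 0\<^sub>m n n} \<and>
     M = (\<Oplus>\<^bsub>module_mat TYPE('f) n n\<^esub> g\<in>{g. a g \<noteq> 0\<^sub>m n n}. a g)"

definition proj :: "'g \<Rightarrow> 'f mat \<Rightarrow> 'f mat" where
  "proj g M = (THE a. decomposition M a) g"

lemma decomposition_unique: "M \<in> UT n \<Longrightarrow> \<exists>!a. decomposition M a"
  using grading unfolding UT_grading_def decomposition_def by blast

lemma decomposition_proj: "M \<in> UT n \<Longrightarrow> decomposition M (\<lambda>g. proj g M)"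
  unfolding proj_def using theI'[OF decomposition_unique] by simp

lemma proj_in: "M \<in> UT n \<Longrightarrow> g \<in> carrier G \<Longrightarrow> proj g M \<in> A g"
  using decomposition_proj unfolding decomposition_def by auto

lemma proj_outside: "M \<in> UT n \<Longrightarrow> g \<notin> carrier G \<Longrightarrow> proj g M = 0\<^sub>m n n"
  using decomposition_proj unfolding decomposition_def by auto

lemma proj_UT: "M \<in> UT n \<Longrightarrow> proj g M \<in> UT n"
  using proj_in proj_outside component_UT UT_closed(1) by (cases "g \<in> carrier G") auto

lemma proj_carrier: "M \<in> UT n \<Longrightarrow> proj g M \<in> carrier_mat n n"
  by (intro UT_carrier proj_UT)

lemma proj_finite: "M \<in> UT n \<Longrightarrow> finite {g. proj g M \<noteq> 0\<^sub>m n n}"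
  using decomposition_proj unfolding decomposition_def by auto

lemma sum_proj:
  assumes "M \<in> UT n" "finite S" "{g. proj g M \<noteq> 0\<^sub>m n n} \<subseteq> S" "i < n" "j < n"
  shows "M $$ (i, j) = (\<Sum>g\<in>S. proj g M $$ (i, j))"
proof -
  let ?S = "{g. proj g M \<noteq> 0\<^sub>m n n}"
  have "M = (\<Oplus>\<^bsub>module_mat TYPE('f) n n\<^esub> g\<in>?S. proj g M)"
    using decomposition_proj[OF assms(1)] unfolding decomposition_def by simp
  then have "M $$ (i, j) = (\<Oplus>\<^bsub>module_mat TYPE('f) n n\<^esub> g\<in>?S. proj g M) $$ (i, j)" by simp
  also have "\<dots> = (\<Sum>g\<in>?S. proj g M $$ (i, j))"
    using proj_finite[OF assms(1)] proj_carrier[OF assms(1)] assms(4,5)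
    by (intro finsum_mat_entry) auto
  also have "\<dots> = (\<Sum>g\<in>S. proj g M $$ (i, j))"
    using assms by (intro sum.mono_neutral_left) auto
  finally show ?thesis .
qed

lemma proj_eqI:
  assumes "M \<in> UT n" "finite S" "\<And>g. g \<in> carrier G \<Longrightarrow> a g \<in> A g"
    and out: "\<And>g. g \<notin> carrier G \<Longrightarrow> a g = 0\<^sub>m n n"
    and S: "{g. a g \<noteq> 0\<^sub>m n n} \<subseteq> S"
    and sum: "\<And>i j. i < n \<Longrightarrow> j < n \<Longrightarrow> M $$ (i, j) = (\<Sum>g\<in>S. a g $$ (i, j))"
  shows "proj g M = a g"
proof -
  let ?S = "{g. a g \<noteq> 0\<^sub>m n n}"
  have fin: "finite ?S" using S assms(2) finite_subset by blast
  have car: "a g \<in> carrier_mat n n" for g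
    using assms(3)[of g] out[of g] component_UT[of g "a g"] UT_carrier by (cases "g \<in> carrier G") auto
  have "M = (\<Oplus>\<^bsub>module_mat TYPE('f) n n\<^esub> g\<in>?S. a g)" (is "_ = ?R")
  proof (rule eq_matI)
    have R: "?R \<in> carrier_mat n n" using n_pos fin car by (intro finsum_mat_entry(2)[of _ _ n 0 0]) auto
    then show "dim_row M = dim_row ?R" "dim_col M = dim_col ?R"
      using UT_carrier[OF assms(1)] by auto
    fix i j assume "i < dim_row ?R" "j < dim_col ?R"
    then have ij: "i < n" "j < n" using R by auto
    have "(\<Sum>g\<in>S. a g $$ (i, j)) = (\<Sum>g\<in>?S. a g $$ (i, j))"
      using assms(2) S ij by (intro sum.mono_neutral_right) auto
    then show "M $$ (i, j) = ?R $$ (i, j)"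
      using sum[OF ij] fin car ij by (subst finsum_mat_entry) auto
  qed
  then have "decomposition M a" using fin assms(3) out unfolding decomposition_def by auto
  then have "(THE a. decomposition M a) = a"
    using decomposition_unique[OF assms(1)] by (intro the1_equality) auto
  then show ?thesis unfolding proj_def by simp
qed

lemma proj_add: "M \<in> UT n \<Longrightarrow> N \<in> UT n \<Longrightarrow> proj g (M + N) = proj g M + proj g N"
proof (rule proj_eqI[where S = "{g. proj g M \<noteq> 0\<^sub>m n n} \<union> {g. proj g N \<noteq> 0\<^sub>m n n}"])
  assume MN: "M \<in> UT n" "N \<in> UT n"
  then show "M + N \<in> UT n" by (rule UT_closed)
  show fin: "finite ({g. proj g M \<noteq> 0\<^sub>m n n} \<union> {g. proj g N \<noteq> 0\<^sub>m n n})"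
    using proj_finite MN by auto
  show "proj g M + proj g N \<in> A g" if "g \<in> carrier G" for g
    using MN that proj_in component_add by auto
  show "proj g M + proj g N = 0\<^sub>m n n" if "g \<notin> carrier G" for g
    using MN that proj_outside by auto
  show "{g. proj g M + proj g N \<noteq> 0\<^sub>m n n} \<subseteq> {g. proj g M \<noteq> 0\<^sub>m n n} \<union> {g. proj g N \<noteq> 0\<^sub>m n n}"
    by auto
  show "(M + N) $$ (i, j) = (\<Sum>g\<in>{g. proj g M \<noteq> 0\<^sub>m n n} \<union> {g. proj g N \<noteq> 0\<^sub>m n n}.
      (proj g M + proj g N) $$ (i, j))" if ij: "i < n" "j < n" for i j
  proof -
    have c: "M \<in> carrier_mat n n" "N \<in> carrier_mat n n" using MN UT_carrier by auto
    have "(M + N) $$ (i, j) = M $$ (i, j) + N $$ (i, j)" using c ij by auto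
    also have "\<dots> = (\<Sum>g\<in>{g. proj g M \<noteq> 0\<^sub>m n n} \<union> {g. proj g N \<noteq> 0\<^sub>m n n}.
      proj g M $$ (i, j) + proj g N $$ (i, j))"
      unfolding sum.distrib using sum_proj[OF MN(1) fin _ ij] sum_proj[OF MN(2) fin _ ij] by auto
    also have "\<dots> = (\<Sum>g\<in>{g. proj g M \<noteq> 0\<^sub>m n n} \<union> {g. proj g N \<noteq> 0\<^sub>m n n}.
      (proj g M + proj g N) $$ (i, j))"
      using MN ij by (intro sum.cong) (auto simp: UT_entry proj_UT)
    finally show ?thesis .
  qed
qed

lemma proj_smult: "M \<in> UT n \<Longrightarrow> proj g (c \<cdot>\<^sub>m M) = c \<cdot>\<^sub>m proj g M"
proof (rule proj_eqI[where S = "{g. proj g M \<noteq> 0\<^sub>m n n}"])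
  assume M: "M \<in> UT n"
  then show "c \<cdot>\<^sub>m M \<in> UT n" by (rule UT_closed)
  show fin: "finite {g. proj g M \<noteq> 0\<^sub>m n n}" using proj_finite M by auto
  show "c \<cdot>\<^sub>m proj g M \<in> A g" if "g \<in> carrier G" for g
    using M that proj_in component_smult by auto
  show "c \<cdot>\<^sub>m proj g M = 0\<^sub>m n n" if "g \<notin> carrier G" for g
    using M that proj_outside by auto
  show "{g. c \<cdot>\<^sub>m proj g M \<noteq> 0\<^sub>m n n} \<subseteq> {g. proj g M \<noteq> 0\<^sub>m n n}"
    by auto
  show "(c \<cdot>\<^sub>m M) $$ (i, j) = (\<Sum>g\<in>{g. proj g M \<noteq> 0\<^sub>m n n}. (c \<cdot>\<^sub>m proj g M) $$ (i, j))"
    if ij: "i < n" "j < n" for i j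
  proof -
    have "(\<Sum>g\<in>{g. proj g M \<noteq> 0\<^sub>m n n}. (c \<cdot>\<^sub>m proj g M) $$ (i, j))
        = (\<Sum>g\<in>{g. proj g M \<noteq> 0\<^sub>m n n}. c * proj g M $$ (i, j))"
      using M ij by (intro sum.cong) (auto simp: UT_entry proj_UT)
    then show ?thesis
      using sum_proj[OF M fin _ ij] UT_carrier[OF M] ij by (simp add: sum_distrib_left)
  qed
qed

lemma proj_homogeneous:
  assumes "h \<in> carrier G" "M \<in> A h"
  shows "proj g M = (if g = h then M else 0\<^sub>m n n)"
proof (rule proj_eqI[where S = "{h}"])
  show "M \<in> UT n" using assms component_UT by auto
  show "(if g = h then M else 0\<^sub>m n n) \<in> A g" if "g \<in> carrier G" for g
    using assms that component_zero by auto
qed (use assms in auto)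

lemma proj_zero: "proj g (0\<^sub>m n n) = 0\<^sub>m n n"
  using proj_homogeneous[OF one_closed component_zero[OF one_closed], of g] by simp

lemma proj_minus:
  assumes "M \<in> UT n" "N \<in> UT n"
  shows "proj g (M - N) = proj g M - proj g N"
proof -
  have c: "M \<in> carrier_mat n n" "N \<in> carrier_mat n n" "proj g M \<in> carrier_mat n n"
    "proj g N \<in> carrier_mat n n" using assms UT_carrier proj_carrier by auto
  have "M - N = M + (-1) \<cdot>\<^sub>m N" using c by (intro eq_matI) auto
  then have "proj g (M - N) = proj g M + (-1) \<cdot>\<^sub>m proj g N"
    using assms by (simp add: proj_add proj_smult UT_closed)
  also have "\<dots> = proj g M - proj g N" using c by (intro eq_matI) auto
  finally show ?thesis .
qed

lemma graded_induct [consumes 1, case_names zero add proj]: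
  assumes M: "M \<in> UT n"
    and zero: "P (0\<^sub>m n n)"
    and add: "\<And>M N. M \<in> UT n \<Longrightarrow> N \<in> UT n \<Longrightarrow> P M \<Longrightarrow> P N \<Longrightarrow> P (M + N)"
    and hom: "\<And>g. g \<in> carrier G \<Longrightarrow> P (proj g M)"
  shows "P M"
proof -
  define part where "part S = mat n n (\<lambda>ij. \<Sum>g\<in>S. proj g M $$ ij)" for S
  let ?S = "{g. proj g M \<noteq> 0\<^sub>m n n}"
  have "finite S \<Longrightarrow> S \<subseteq> carrier G \<Longrightarrow> part S \<in> UT n \<and> P (part S)" for S
  proof (induction S rule: finite_induct)
    case empty
    have "part {} = 0\<^sub>m n n" unfolding part_def by (intro eq_matI) auto
    then show ?case using zero UT_closed by simp
  next
    case (insert g S)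
    have "part (insert g S) = proj g M + part S"
      unfolding part_def using insert.hyps proj_carrier[OF M, of g] by (intro eq_matI) auto
    then show ?case using insert hom[of g] add proj_UT[OF M, of g] UT_closed(3) by auto
  qed
  moreover have "?S \<subseteq> carrier G" using proj_outside[OF M] by auto
  moreover have "finite ?S" by (rule proj_finite[OF M])
  moreover have "part ?S = M"
    unfolding part_def using sum_proj[OF M proj_finite[OF M] order.refl] UT_carrier[OF M]
    by (intro eq_matI) auto
  ultimately show ?thesis by metis
qed

lemma UT_mult_distrib:
  assumes "M \<in> UT n" "N \<in> UT n" "K \<in> UT n"
  shows "(M + N) * K = M * K + N * K" "K * (M + N) = K * M + K * N"
  using assms UT_carrier by (auto intro!: add_mult_distrib_mat[of _ n n] mult_add_distrib_mat[of _ n n _ n])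

lemma UT_assoc: "M \<in> UT n \<Longrightarrow> N \<in> UT n \<Longrightarrow> K \<in> UT n \<Longrightarrow> M * N * K = M * (N * K)"
  by (rule assoc_mult_mat[of _ n n _ n _ n]) (auto dest: UT_carrier)

lemma UT_mult_zero: "M \<in> UT n \<Longrightarrow> M * 0\<^sub>m n n = 0\<^sub>m n n" "M \<in> UT n \<Longrightarrow> 0\<^sub>m n n * M = 0\<^sub>m n n"
  by (auto dest: UT_carrier)

lemma proj_mult_right:
  assumes "x \<in> UT n" "h \<in> carrier G" "y \<in> A h" "g \<in> carrier G"
  shows "proj (g \<otimes> h) (x * y) = proj g x * y"
proof -
  have y: "y \<in> UT n" using assms component_UT by auto
  show ?thesis using assms(1)
  proof (induction x rule: graded_induct)
    case (add M N)
    then show ?case using y by (simp add: UT_mult_distrib proj_add UT_closed proj_UT)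
  next
    case (proj k)
    have "proj k x * y \<in> A (k \<otimes> h)"
      using proj assms proj_in by (intro component_mult) auto
    then show ?case
      using proj_homogeneous[of "k \<otimes> h" "proj k x * y"] proj_homogeneous[OF proj proj_in[OF assms(1) proj]]
        proj assms y by (auto simp: UT_mult_zero)
  qed (use y in \<open>auto simp: UT_mult_zero proj_zero\<close>)
qed

lemma proj_mult_left:
  assumes "x \<in> UT n" "h \<in> carrier G" "y \<in> A h" "g \<in> carrier G"
  shows "proj (h \<otimes> g) (y * x) = y * proj g x"
proof -
  have y: "y \<in> UT n" using assms component_UT by auto
  show ?thesis using assms(1)
  proof (induction x rule: graded_induct)
    case (add M N)
    then show ?case using y by (simp add: UT_mult_distrib proj_add UT_closed proj_UT)
  next
    case (proj k)
    have "y * proj k x \<in> A (h \<otimes> k)"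
      using proj assms proj_in by (intro component_mult) auto
    then show ?case
      using proj_homogeneous[of "h \<otimes> k" "y * proj k x"] proj_homogeneous[OF proj proj_in[OF assms(1) proj]]
        proj assms y by (auto simp: UT_mult_zero)
  qed (use y in \<open>auto simp: UT_mult_zero proj_zero\<close>)
qed

lemma diag_mult:
  assumes "M \<in> UT n" "N \<in> UT n" "i < n"
  shows "(M * N) $$ (i, i) = M $$ (i, i) * N $$ (i, i)"
  using rad_power_mult(2)[of M n 0 N 0 i] assms by (simp add: UT_eq_rad_power_0)

text \<open>A diagonal entry of the component of degree \<open>\<one>\<close> is a trace: on homogeneous elements
  of degrees \<open>g\<close> and \<open>h\<close> both sides vanish unless \<open>g \<otimes> h = \<one>\<close>, which is the same condition as \<open>h \<otimes> g = \<one>\<close>.\<close>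

lemma degree_one_diag_commute:
  assumes "x \<in> UT n" "y \<in> UT n" "i < n"
  shows "proj \<one> (x * y) $$ (i, i) = proj \<one> (y * x) $$ (i, i)"
  using assms(1)
proof (induction x rule: graded_induct)
  case (add M N)
  then show ?case
    using assms by (simp add: UT_mult_distrib proj_add UT_closed UT_entry proj_UT)
next
  case (proj g)
  define x' where "x' = proj g x"
  have x': "x' \<in> A g" "x' \<in> UT n" using proj assms(1) proj_in proj_UT unfolding x'_def by auto
  have "proj \<one> (x' * y) $$ (i, i) = proj \<one> (y * x') $$ (i, i)"
    using assms(2)
  proof (induction y rule: graded_induct)
    case (add M N)
    then show ?case
      using assms x' by (simp add: UT_mult_distrib proj_add UT_closed UT_entry proj_UT)
  next
    case (proj h)
    have y: "proj h y \<in> A h" "proj h y \<in> UT n" using proj assms(2) proj_in proj_UT by auto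
    have "proj \<one> (x' * proj h y) = (if \<one> = g \<otimes> h then x' * proj h y else 0\<^sub>m n n)"
      using y x' proj \<open>g \<in> carrier G\<close> by (intro proj_homogeneous component_mult) auto
    moreover have "proj \<one> (proj h y * x') = (if \<one> = h \<otimes> g then proj h y * x' else 0\<^sub>m n n)"
      using y x' proj \<open>g \<in> carrier G\<close> by (intro proj_homogeneous component_mult) auto
    moreover have "\<one> = g \<otimes> h \<longleftrightarrow> \<one> = h \<otimes> g"
      using proj \<open>g \<in> carrier G\<close> by (metis inv_equality l_inv r_inv)
    moreover have "(x' * proj h y) $$ (i, i) = (proj h y * x') $$ (i, i)"
      using x' y assms(3) by (simp add: diag_mult)
    ultimately show ?case using assms(3) by simp
  qed (use x' in \<open>auto simp: UT_mult_zero\<close>)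
  then show ?case unfolding x'_def .
qed (use assms in \<open>auto simp: UT_mult_zero\<close>)

end

lemma rad_power_1_iff: "M \<in> rad_power n 1 \<longleftrightarrow> M \<in> UT n \<and> (\<forall>i<n. M $$ (i, i) = 0)"
  unfolding UT_eq_rad_power_0 rad_power_def by (auto simp: less_Suc_eq)

lemma unit_mat_absorb:
  assumes "p < n" "q < n"
  shows "unit_mat n (p, p) * unit_mat n (p, q) = (unit_mat n (p, q) :: 'f::field mat)"
proof -
  have "(unit_mat n (p, p) * unit_mat n (p, q)) $$ (i, j) = (unit_mat n (p, q) :: 'f mat) $$ (i, j)"
    if "i < n" "j < n" for i j
    using that assms by (auto simp: diag_unit_left simp del: index_mult_mat(1))
  then show ?thesis by (auto simp del: index_mult_mat(1))
qed

context graded_UT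
begin

lemma unit_mat_UT: "p \<le> q \<Longrightarrow> (unit_mat n (p, q) :: 'f mat) \<in> UT n"
  unfolding UT_eq_rad_power_0 by (rule unit_mat_rad_power) simp

definition support :: "'g set" where
  "support = {g \<in> carrier G. \<exists>M\<in>A g. M \<noteq> 0\<^sub>m n n}"

text \<open>A degree that occurs at all occurs as the degree of a component of some unit matrix.\<close>

lemma finite_support: "finite support"
  unfolding support_def
proof (rule finite_subset)
  let ?U = "{(p, q). p \<le> q \<and> q < n}"
  let ?S = "\<Union>pq\<in>?U. {g. proj g (unit_mat n pq) \<noteq> 0\<^sub>m n n}"
  have "finite ?U" by (rule finite_subset[of _ "{..<n} \<times> {..<n}"]) auto
  then show "finite ?S" using proj_finite unit_mat_UT by auto
  show "{g \<in> carrier G. \<exists>M\<in>A g. M \<noteq> 0\<^sub>m n n} \<subseteq> ?S"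
  proof (intro subsetI, elim CollectE conjE bexE, rule ccontr)
    fix g M assume g: "g \<in> carrier G" "M \<in> A g" "M \<noteq> 0\<^sub>m n n" "g \<notin> ?S"
    have "proj g M = 0\<^sub>m n n"
      using component_UT[OF g(1,2)]
    proof (induction M rule: UT_induct)
      case (unit p q)
      then show ?case using g(4) by auto
    qed (auto simp: proj_zero proj_add proj_smult)
    then show False using proj_homogeneous[OF g(1,2), of g] g(3) by simp
  qed
qed

text \<open>A trace vanishes on commutators, hence on the radical.\<close>

lemma radical_trace_zero:
  assumes "x \<in> rad_power n 1" "z \<in> UT n" "i < n"
  shows "proj \<one> (x * z) $$ (i, i) = 0"
proof -
  have "x * z \<in> rad_power n 1"
    using rad_power_mult(1)[of x n 1 z 0] assms by (simp add: UT_eq_rad_power_0)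
  from radical_commutator[OF inf this] obtain D Z where
    DZ: "D \<in> UT n" "Z \<in> UT n" "x * z = D * Z - Z * D" by blast
  then show ?thesis
    using degree_one_diag_commute[OF DZ(1,2) assms(3)] assms(3)
    by (simp add: proj_minus UT_closed UT_entry proj_UT)
qed

text \<open>If the component \<open>y\<close> of \<open>x\<close> of degree \<open>g\<close> had a nonzero diagonal entry, so would all of its powers. Their degrees are
  powers of \<open>g\<close>, so \<open>g\<close> has finite order and some power \<open>y ^ k\<close> has degree \<open>inv g\<close>. The component
  of \<open>x * y ^ k\<close> of degree \<open>\<one>\<close> is \<open>y ^ (k + 1)\<close>, which contradicts the vanishing of the trace on the radical.\<close>

lemma proj_radical:
  assumes x: "x \<in> rad_power n 1"
  shows "proj g x \<in> rad_power n 1"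
proof (rule ccontr)
  have xUT: "x \<in> UT n" using x rad_power_UT by blast
  define y where "y = proj g x"
  assume "proj g x \<notin> rad_power n 1"
  then obtain i where i: "i < n" "y $$ (i, i) \<noteq> 0"
    using proj_UT[OF xUT] unfolding rad_power_1_iff y_def by auto
  have g: "g \<in> carrier G" using i proj_outside[OF xUT] unfolding y_def by fastforce
  have y: "y \<in> A g" "y \<in> UT n" using xUT g proj_in proj_UT unfolding y_def by auto
  define pw where "pw k = ((\<lambda>M. M * y) ^^ k) y" for k
  have pw: "pw k \<in> A (g [^] Suc k) \<and> pw k \<in> UT n \<and> pw k $$ (i, i) = (y $$ (i, i)) ^ Suc k" for k
  proof (induction k)
    case 0
    then show ?case using y g unfolding pw_def by simp
  next
    case (Suc k)
    have "pw (Suc k) = pw k * y" unfolding pw_def by simp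
    then show ?case
      using Suc y g i(1) component_mult[of "g [^] Suc k" g "pw k" y]
      by (auto simp: diag_mult UT_closed)
  qed
  have "range (\<lambda>k. g [^] Suc k) \<subseteq> support"
    unfolding support_def
  proof (intro image_subsetI CollectI conjI bexI)
    fix k
    show "pw k \<noteq> 0\<^sub>m n n" using pw[of k] i by auto
    show "pw k \<in> A (g [^] Suc k)" using pw by blast
    show "g [^] Suc k \<in> carrier G" using g by blast
  qed
  then have "finite (range (\<lambda>k. g [^] Suc k))" using finite_support finite_subset by blast
  then have "\<not> inj (\<lambda>k::nat. g [^] Suc k)" using finite_imageD infinite_UNIV_nat by blast
  then obtain a b :: nat where ab: "a < b" "g [^] Suc a = g [^] Suc b"
    unfolding inj_on_def by (metis linorder_neq_iff)
  define d where "d = b - a"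
  have "d > 0" "Suc a + d = Suc b" using ab unfolding d_def by auto
  then have "g [^] Suc a \<otimes> g [^] d = g [^] Suc a" using ab g by (metis nat_pow_mult)
  then have "g [^] d = \<one>" using g by (metis l_cancel_one' nat_pow_closed)
  \<comment> \<open>the exponent is doubled because \<open>g [^] (d - 1)\<close> could be the zeroth power\<close>
  then have "g [^] (d + d) = \<one>" using g by (metis nat_pow_mult l_one one_closed)
  moreover obtain k where "d + d = Suc (Suc k)" using \<open>d > 0\<close> by (cases d) auto
  ultimately have gk: "g \<otimes> g [^] Suc k = \<one>" using g by (metis nat_pow_Suc2)
  have "proj \<one> (x * pw k) = y * pw k"
    using proj_mult_right[OF xUT _ _ g, of "g [^] Suc k" "pw k"] pw g gk unfolding y_def by auto
  then have "(y * pw k) $$ (i, i) = 0" using radical_trace_zero[OF x _ i(1)] pw by metis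
  then show False using pw[of k] y i by (simp add: diag_mult)
qed

lemma proj_rad_power: "x \<in> rad_power n d \<Longrightarrow> proj g x \<in> rad_power n d"
proof (induction d arbitrary: x g)
  case 0
  then show ?case using proj_UT by (simp add: UT_eq_rad_power_0)
next
  case (Suc d)
  from rad_power_Suc_factor[OF Suc.prems] obtain U N where
    UN: "U \<in> rad_power n d" "N \<in> rad_power n 1" "x = U * N" by blast
  have ut: "U \<in> UT n" "N \<in> UT n" using UN rad_power_UT by auto
  show ?case
  proof (cases "g \<in> carrier G")
    case False
    then show ?thesis using proj_outside[OF rad_power_UT[OF Suc.prems]] by simp
  next
    case g: True
    have "proj g (U * N) \<in> rad_power n (Suc d)" using ut(2)
    proof (induction N rule: graded_induct)
      case zero
      then show ?case using ut by (simp add: UT_mult_zero proj_zero)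
    next
      case (add M N)
      then show ?case using ut by (simp add: UT_mult_distrib proj_add UT_closed rad_power_add)
    next
      case (proj h)
      have "proj ((g \<otimes> inv h) \<otimes> h) (U * proj h N) = proj (g \<otimes> inv h) U * proj h N"
        using ut proj g proj_in by (intro proj_mult_right) auto
      moreover have "(g \<otimes> inv h) \<otimes> h = g" using g proj by (simp add: m_assoc)
      moreover have "proj (g \<otimes> inv h) U * proj h N \<in> rad_power n (d + 1)"
        using Suc.IH[OF UN(1)] proj_radical[OF UN(2)] by (rule rad_power_mult)
      ultimately show ?case by simp
    qed
    then show ?thesis using UN by simp
  qed
qed

text \<open>If the diagonal entry at \<open>i\<close> is zero in all degrees but \<open>\<one>\<close>, then on row \<open>i\<close> of the leading diagonal left multiplication by
  \<open>a\<close> is a scalar of trivial degree, and so it commutes with the projections.\<close>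

lemma proj_mult_entry_left:
  assumes triv: "\<And>h b. h \<in> carrier G \<Longrightarrow> h \<noteq> \<one> \<Longrightarrow> b \<in> A h \<Longrightarrow> b $$ (i, i) = 0"
    and "a \<in> UT n" "x \<in> rad_power n d" "i + d < n"
  shows "proj g (a * x) $$ (i, i + d) = a $$ (i, i) * proj g x $$ (i, i + d)"
proof (cases "g \<in> carrier G")
  case False
  then show ?thesis using assms(2,4) rad_power_UT[OF assms(3)] by (simp add: proj_outside UT_closed)
next
  case g: True
  have x: "x \<in> UT n" using assms(3) rad_power_UT by blast
  show ?thesis using assms(2)
  proof (induction a rule: graded_induct)
    case zero
    then show ?case using x assms(4) by (simp add: UT_mult_zero proj_zero)
  next
    case (add M N)
    then show ?case using x assms(4)
      by (simp add: UT_mult_distrib proj_add UT_closed proj_UT UT_entry algebra_simps)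
  next
    case (proj h)
    have a: "proj h a \<in> A h" "proj h a \<in> UT n" using assms(2) proj proj_in proj_UT by auto
    have "proj (h \<otimes> (inv h \<otimes> g)) (proj h a * x) = proj h a * proj (inv h \<otimes> g) x"
      using x g proj a by (intro proj_mult_left) auto
    moreover have "h \<otimes> (inv h \<otimes> g) = g" using g proj by (simp add: m_assoc[symmetric])
    ultimately have "proj g (proj h a * x) $$ (i, i + d)
        = proj h a $$ (i, i) * proj (inv h \<otimes> g) x $$ (i, i + d)"
      using rad_power_mult(2)[of "proj h a" n 0 "proj (inv h \<otimes> g) x" d i] a(2) assms(4)
        proj_rad_power[OF assms(3)] by (simp add: UT_eq_rad_power_0)
    then show ?case using triv[OF proj _ a(1)] g by (cases "h = \<one>") auto
  qed
qed

lemma proj_entry_nonzero: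
  assumes "M \<in> UT n" "i < n" "j < n" "M $$ (i, j) \<noteq> 0"
  obtains k where "k \<in> carrier G" "proj k M $$ (i, j) \<noteq> 0"
proof -
  have "(\<Sum>g\<in>{g. proj g M \<noteq> 0\<^sub>m n n}. proj g M $$ (i, j)) \<noteq> 0"
    using sum_proj[OF assms(1) proj_finite[OF assms(1)] order.refl assms(2,3)] assms(4) by simp
  then obtain k where "proj k M $$ (i, j) \<noteq> 0" by (meson sum.not_neutral_contains_not_neutral)
  moreover from this have "k \<in> carrier G" using proj_outside[OF assms(1), of k] assms(2,3) by fastforce
  ultimately show thesis using that by blast
qed

text \<open>The last nonzero power of the radical is a line stable under all projections, so it is spanned by a homogeneous
  element, and \<open>a\<close> acts on it by the scalar \<open>a $$ (0, 0)\<close>. A nonzero scalar does not change the degree.\<close>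

lemma corner_diag_degree:
  assumes "h \<in> carrier G" "h \<noteq> \<one>" "a \<in> A h"
  shows "a $$ (0, 0) = 0"
proof (rule ccontr)
  assume a0: "a $$ (0, 0) \<noteq> 0"
  let ?E = "unit_mat n (0, n - 1) :: 'f mat"
  have E: "?E \<in> rad_power n (n - 1)" by (rule unit_mat_rad_power) simp
  obtain k where k: "k \<in> carrier G" "proj k ?E $$ (0, n - 1) \<noteq> 0"
    using proj_entry_nonzero[of ?E 0 "n - 1"] E n_pos rad_power_UT by auto
  define y where "y = proj k ?E"
  have y: "y \<in> A k" "y \<in> rad_power n (n - 1)" "y \<in> UT n"
    using proj_in[OF rad_power_UT[OF E] k(1)] proj_rad_power[OF E] proj_UT[OF rad_power_UT[OF E]]
    unfolding y_def by auto
  have a: "a \<in> UT n" using assms component_UT by auto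
  have ay: "a * y \<in> A (h \<otimes> k)" using assms y k by (intro component_mult)
  have ay': "a * y \<in> rad_power n (n - 1)" "(a * y) $$ (0, n - 1) = a $$ (0, 0) * y $$ (0, n - 1)"
    using rad_power_mult(1)[of a n 0 y "n - 1"] rad_power_mult(2)[of a n 0 y "n - 1" 0] a y n_pos by (auto simp: UT_eq_rad_power_0)
  have "a * y = a $$ (0, 0) \<cdot>\<^sub>m y"
  proof (rule eq_matI)
    fix i j assume "i < dim_row (a $$ (0, 0) \<cdot>\<^sub>m y)" "j < dim_col (a $$ (0, 0) \<cdot>\<^sub>m y)"
    then have ij: "i < n" "j < n" using y(3) UT_carrier by auto
    show "(a * y) $$ (i, j) = (a $$ (0, 0) \<cdot>\<^sub>m y) $$ (i, j)"
    proof (cases "j < i + (n - 1)")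
      case True
      then show ?thesis using rad_powerD(2)[OF ay'(1) ij True] rad_powerD(2)[OF y(2) ij True] y(3) ij
        by (simp add: UT_entry)
    next
      case False
      then have "i = 0" "j = n - 1" using ij by auto
      then show ?thesis using ay'(2) y(3) ij by (simp add: UT_entry)
    qed
  qed (use a y UT_carrier in auto)
  moreover have "h \<otimes> k \<noteq> k" using assms k by (metis r_cancel_one')
  ultimately have "a * y = 0\<^sub>m n n"
    using proj_homogeneous[OF _ ay, of "h \<otimes> k"] proj_homogeneous[OF k(1) y(1), of "h \<otimes> k"] y k assms
    by (auto simp: proj_smult)
  then show False using ay'(2) a0 k n_pos unfolding y_def by auto
qed

text \<open>This is the argument of \<open>corner_diag_degree\<close> for a homogeneous \<open>y\<close> in the power with exponent \<open>i\<close> of the radical that has \<open>y $$ (0, i) \<noteq> 0\<close>: multiplication on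
  the right by \<open>a\<close> multiplies this entry by \<open>a $$ (i, i)\<close>. The entry at \<open>(0, i)\<close> depends on one
  degree only because its kernel in this power of the radical is stable under the projections.\<close>

lemma diag_degree:
  assumes "h \<in> carrier G" "h \<noteq> \<one>" "a \<in> A h" "i < n"
  shows "a $$ (i, i) = 0"
proof (rule ccontr)
  assume ai: "a $$ (i, i) \<noteq> 0"
  let ?E = "unit_mat n (0, i) :: 'f mat" and ?e = "unit_mat n (0, 0) :: 'f mat"
  have vanish: "proj g x $$ (0, i) = 0" if x: "x \<in> rad_power n i" "x $$ (0, i) = 0" for x g
  proof -
    have "?e * x \<in> rad_power n (Suc i)"
      unfolding rad_power_def
    proof (intro CollectI conjI allI impI)
      show "?e * x \<in> carrier_mat n n"
        using rad_powerD(1)[OF x(1)] by (rule mult_carrier_mat[OF unit_mat_carrier(1)])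
      fix p q assume pq: "p < n" "q < n" "q < p + Suc i"
      then show "(?e * x) $$ (p, q) = 0"
        using diag_unit_left[OF rad_powerD(1)[OF x(1)], of 0 p q] rad_powerD(2)[OF x(1), of 0 q] x(2)
        by (cases "q = i") auto
    qed
    then have "proj g (?e * x) $$ (0, i) = 0"
      using rad_powerD(2)[OF proj_rad_power, of "?e * x" "Suc i" 0 i g] assms(4) by auto
    then show ?thesis
      using proj_mult_entry_left[of 0 ?e x i g] corner_diag_degree x(1) assms(4) unit_mat_UT by auto
  qed
  have E: "?E \<in> rad_power n i" by (rule unit_mat_rad_power) simp
  obtain k where k: "k \<in> carrier G" "proj k ?E $$ (0, i) \<noteq> 0"
    using proj_entry_nonzero[of ?E 0 i] E assms(4) rad_power_UT by auto
  define y where "y = proj k ?E"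
  have y: "y \<in> A k" "y \<in> rad_power n i" "y \<in> UT n"
    using proj_in[OF rad_power_UT[OF E] k(1)] proj_rad_power[OF E] proj_UT[OF rad_power_UT[OF E]]
    unfolding y_def by auto
  have a: "a \<in> UT n" using assms component_UT by auto
  have ya: "y * a \<in> A (k \<otimes> h)" using assms y k by (intro component_mult)
  have ya': "y * a \<in> rad_power n i" "(y * a) $$ (0, i) = y $$ (0, i) * a $$ (i, i)"
    using rad_power_mult(1)[of y n i a 0] rad_power_mult(2)[of y n i a 0 0] a y assms(4) by (auto simp: UT_eq_rad_power_0)
  let ?w = "y * a - a $$ (i, i) \<cdot>\<^sub>m y"
  have "?w \<in> rad_power n i" using ya' y by (intro rad_power_minus rad_power_smult)
  moreover have "?w $$ (0, i) = 0" using ya' y assms(4) by (simp add: UT_entry UT_closed)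
  ultimately have "proj k ?w $$ (0, i) = 0" by (rule vanish)
  moreover have "k \<noteq> k \<otimes> h" using assms k by (metis l_cancel_one)
  then have "proj k (y * a) = 0\<^sub>m n n" using proj_homogeneous[OF _ ya, of k] assms k by auto
  moreover have "proj k y = y" using proj_homogeneous[OF k(1) y(1)] by simp
  ultimately have "a $$ (i, i) * y $$ (0, i) = 0"
    using y a assms(4) by (simp add: proj_minus UT_closed proj_smult UT_entry)
  then show False using k ai unfolding y_def by simp
qed

text \<open>If \<open>q > p + 1\<close>, the unit matrix lies in the square of the radical, and so do its components. If \<open>p \<noteq> i\<close>, it is
  fixed by left multiplication with a diagonal unit matrix whose entry at \<open>(i, i)\<close> is zero.\<close>

lemma proj_unit_superdiag:
  assumes "p < q" "q < n" "Suc i < n" "proj g (unit_mat n (p, q)) $$ (i, Suc i) \<noteq> 0"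
  shows "p = i \<and> q = Suc i"
proof -
  let ?E = "unit_mat n (p, q) :: 'f mat"
  have E: "?E \<in> rad_power n 1" using assms by (intro unit_mat_rad_power) auto
  have "proj g ?E $$ (i, i + 1) = unit_mat n (p, p) $$ (i, i) * proj g ?E $$ (i, i + 1)"
    using proj_mult_entry_left[of i "unit_mat n (p, p)" ?E 1 g] assms E diag_degree
    by (auto simp: unit_mat_absorb unit_mat_UT)
  then have "p = i" using assms by (auto split: if_splits)
  moreover have "q = Suc p"
  proof (rule ccontr)
    assume "q \<noteq> Suc p"
    then have "?E \<in> rad_power n 2" using assms by (intro unit_mat_rad_power) auto
    then have "proj g ?E \<in> rad_power n 2" by (rule proj_rad_power)
    then show False using rad_powerD(2)[of _ n 2 i "Suc i"] assms by auto
  qed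
  ultimately show ?thesis by simp
qed

end

section \<open>Involutions on upper triangular matrices\<close>

locale graded_star_UT = graded_UT G n A
  for G :: "('g, 'x) monoid_scheme" (structure) and n :: nat and A :: "'g \<Rightarrow> 'f::field mat set" +
  fixes star :: "'f mat \<Rightarrow> 'f mat"
  assumes involution: "UT_involution n star"
begin

lemma star_UT: "M \<in> UT n \<Longrightarrow> star M \<in> UT n"
  and star_add: "M \<in> UT n \<Longrightarrow> N \<in> UT n \<Longrightarrow> star (M + N) = star M + star N"
  and star_smult: "M \<in> UT n \<Longrightarrow> star (c \<cdot>\<^sub>m M) = c \<cdot>\<^sub>m star M"
  and star_mult: "M \<in> UT n \<Longrightarrow> N \<in> UT n \<Longrightarrow> star (M * N) = star N * star M"
  and star_star: "M \<in> UT n \<Longrightarrow> star (star M) = M"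
  using involution unfolding UT_involution_def by auto

lemma star_zero: "star (0\<^sub>m n n) = 0\<^sub>m n n"
proof -
  have "star (0\<^sub>m n n) = 0 \<cdot>\<^sub>m star (0\<^sub>m n n)"
    using star_smult[of "0\<^sub>m n n" 0] UT_closed(1) by simp
  also have "\<dots> = 0\<^sub>m n n" using UT_carrier[OF star_UT[OF UT_closed(1)]] by (intro eq_matI) auto
  finally show ?thesis .
qed

lemma star_minus:
  assumes "M \<in> UT n" "N \<in> UT n"
  shows "star (M - N) = star M - star N"
proof -
  have c: "M \<in> carrier_mat n n" "N \<in> carrier_mat n n" "star M \<in> carrier_mat n n"
    "star N \<in> carrier_mat n n" using assms UT_carrier star_UT by auto
  have "M - N = M + (-1) \<cdot>\<^sub>m N" using c by (intro eq_matI) auto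
  then have "star (M - N) = star M + (-1) \<cdot>\<^sub>m star N"
    using assms by (simp add: star_add star_smult UT_closed)
  also have "\<dots> = star M - star N" using c by (intro eq_matI) auto
  finally show ?thesis .
qed

text \<open>A diagonal entry of \<open>star x\<close> depends on \<open>x\<close> through a homomorphism from \<open>UT n\<close> to a commutative ring, which kills commutators.\<close>

lemma star_radical:
  assumes "x \<in> rad_power n 1" shows "star x \<in> rad_power n 1"
proof -
  from radical_commutator[OF inf assms] obtain D Z where
    DZ: "D \<in> UT n" "Z \<in> UT n" "x = D * Z - Z * D" by blast
  then have "star x = star Z * star D - star D * star Z"
    by (simp add: star_minus UT_closed star_mult)
  then show ?thesis
    unfolding rad_power_1_iff using DZ star_UT by (auto simp: UT_closed UT_entry diag_mult)
qed

lemma star_rad_power: "x \<in> rad_power n d \<Longrightarrow> star x \<in> rad_power n d"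
proof (induction d arbitrary: x)
  case 0
  then show ?case using star_UT by (simp add: UT_eq_rad_power_0)
next
  case (Suc d)
  from rad_power_Suc_factor[OF Suc.prems] obtain U N where
    UN: "U \<in> rad_power n d" "N \<in> rad_power n 1" "x = U * N" by blast
  then have "star x = star N * star U" using star_mult[OF UN(1,2)[THEN rad_power_UT]] by simp
  moreover have "star N * star U \<in> rad_power n (1 + d)"
    using star_radical[OF UN(2)] Suc.IH[OF UN(1)] by (rule rad_power_mult)
  ultimately show ?case by simp
qed

text \<open>The involution acts by a nonzero scalar on the line spanned by the unit matrix at \<open>(0, n - 1)\<close>; on this line
  right multiplication by \<open>a\<close> is the scalar \<open>a $$ (n - 1, n - 1)\<close> and left multiplication by \<open>star a\<close> is the scalar \<open>star a $$ (0, 0)\<close>.\<close>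

lemma star_corner:
  assumes "a \<in> UT n" shows "star a $$ (0, 0) = a $$ (n - 1, n - 1)"
proof -
  let ?E = "unit_mat n (0, n - 1) :: 'f mat"
  have E: "?E \<in> rad_power n (n - 1)" "?E \<in> UT n"
    by (auto intro!: unit_mat_rad_power unit_mat_UT)
  have sE: "star ?E \<in> rad_power n (n - 1)" using E star_rad_power by auto
  have top: "M = M $$ (0, n - 1) \<cdot>\<^sub>m ?E" if M: "M \<in> rad_power n (n - 1)" for M
  proof (rule eq_matI)
    fix i j assume "i < dim_row (M $$ (0, n - 1) \<cdot>\<^sub>m ?E)" "j < dim_col (M $$ (0, n - 1) \<cdot>\<^sub>m ?E)"
    then have ij: "i < n" "j < n" by auto
    show "M $$ (i, j) = (M $$ (0, n - 1) \<cdot>\<^sub>m ?E) $$ (i, j)"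
      using rad_powerD(2)[OF M ij] ij by (cases "j < i + (n - 1)") auto
  qed (use M in \<open>auto simp: rad_power_dim\<close>)
  define c where "c = star ?E $$ (0, n - 1)"
  have c: "c \<noteq> 0"
  proof
    assume "c = 0"
    then have "star ?E = 0 \<cdot>\<^sub>m ?E" by (subst top[OF sE]) (simp add: c_def)
    also have "\<dots> = 0\<^sub>m n n" by (intro eq_matI) auto
    finally have "?E = 0\<^sub>m n n" using star_star[OF E(2)] star_zero by simp
    then have "?E $$ (0, n - 1) = 0" using n_pos by simp
    then show False using n_pos by simp
  qed
  have "?E * a = a $$ (n - 1, n - 1) \<cdot>\<^sub>m ?E"
  proof -
    have "?E * a \<in> rad_power n (n - 1)" "(?E * a) $$ (0, n - 1) = a $$ (n - 1, n - 1)"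
      using rad_power_mult(1)[of ?E n "n - 1" a 0] rad_power_mult(2)[of ?E n "n - 1" a 0 0] E assms n_pos by (auto simp: UT_eq_rad_power_0)
    then show ?thesis using top[of "?E * a"] by argo
  qed
  then have "star a * star ?E = a $$ (n - 1, n - 1) \<cdot>\<^sub>m star ?E"
    using star_mult[OF E(2) assms] star_smult[OF E(2)] by metis
  then have "(star a * star ?E) $$ (0, n - 1) = a $$ (n - 1, n - 1) * c"
    using star_UT[OF E(2)] n_pos unfolding c_def by (simp add: UT_entry)
  moreover have "(star a * star ?E) $$ (0, n - 1) = star a $$ (0, 0) * c"
    using rad_power_mult(2)[of "star a" n 0 "star ?E" "n - 1" 0] star_UT[OF assms] sE n_pos
    unfolding c_def by (simp add: UT_eq_rad_power_0)
  ultimately show ?thesis using c by simp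
qed

text \<open>Choose \<open>y\<close> in the power with exponent \<open>i\<close> of the radical, supported in the last column and with \<open>star y $$ (0, i) = 1\<close>. Modulo
  the next power, \<open>a * y\<close> is the multiple of \<open>y\<close> by the diagonal entry of \<open>a\<close> in row \<open>n - 1 - i\<close>; applying the involution turns
  this entry into \<open>star a $$ (i, i)\<close>.\<close>

lemma star_diag:
  assumes "a \<in> UT n" "i < n"
  shows "star a $$ (i, i) = a $$ (n - 1 - i, n - 1 - i)"
proof -
  let ?E = "unit_mat n (0, i) :: 'f mat" and ?e = "unit_mat n (n - 1, n - 1) :: 'f mat"
  define z where "z = star ?E"
  have E: "?E \<in> rad_power n i" "?E \<in> UT n" by (auto intro!: unit_mat_rad_power unit_mat_UT)
  have z: "z \<in> rad_power n i" "z \<in> UT n" using E star_rad_power star_UT unfolding z_def by auto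
  have sz: "star z = ?E" using E star_star unfolding z_def by simp
  have e: "?e \<in> UT n" using unit_mat_UT by auto
  define y where "y = z * ?e"
  have y: "y \<in> rad_power n i" "y \<in> UT n"
    using rad_power_mult(1)[of z n i ?e 0] z e UT_closed(6) unfolding y_def by (auto simp: UT_eq_rad_power_0)
  have sy: "star y \<in> rad_power n i" using y star_rad_power by auto
  have "star y = star ?e * ?E" using z e sz unfolding y_def by (simp add: star_mult)
  then have sy0: "star y $$ (0, i) = 1"
    using rad_power_mult(2)[of "star ?e" n 0 ?E i 0] star_corner[OF e] star_UT[OF e] E assms n_pos
    by (simp add: UT_eq_rad_power_0)
  let ?w = "a * y - a $$ (n - 1 - i, n - 1 - i) \<cdot>\<^sub>m y"
  have ay: "a * y \<in> rad_power n i" "(a * y) $$ (n - 1 - i, n - 1) = a $$ (n - 1 - i, n - 1 - i) * y $$ (n - 1 - i, n - 1)"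
    using rad_power_mult(1)[of a n 0 y i] rad_power_mult(2)[of a n 0 y i "n - 1 - i"] assms y by (auto simp: UT_eq_rad_power_0)
  have w: "?w \<in> rad_power n i" using ay y by (intro rad_power_minus rad_power_smult)
  have "?w \<in> rad_power n (Suc i)"
    unfolding rad_power_def
  proof (intro CollectI conjI allI impI)
    show "?w \<in> carrier_mat n n" using rad_powerD(1)[OF w] .
    fix p q assume pq: "p < n" "q < n" "q < p + Suc i"
    show "?w $$ (p, q) = 0"
    proof (cases "q = p + i")
      case False
      then show ?thesis using rad_powerD(2)[OF w pq(1,2)] pq by auto
    next
      case qp: True
      show ?thesis
      proof (cases "q = n - 1")
        case True
        then have "p = n - 1 - i" using qp by auto
        then show ?thesis using ay(2) True pq y(2) assms by (simp add: UT_entry UT_closed)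
      next
        case False
        have "a * y = (a * z) * ?e" unfolding y_def using assms z e by (simp add: UT_assoc)
        then have "(a * y) $$ (p, q) = 0"
          using False pq UT_carrier[OF UT_closed(6)[OF assms(1) z(2)]] by (simp add: diag_unit_right del: index_mult_mat(1))
        moreover have "y $$ (p, q) = 0"
          unfolding y_def using False pq UT_carrier[OF z(2)] by (simp add: diag_unit_right del: index_mult_mat(1))
        ultimately show ?thesis using y(2) pq by (simp add: UT_entry UT_closed)
      qed
    qed
  qed
  then have "star ?w $$ (0, i) = 0"
    using rad_powerD(2)[OF star_rad_power, of ?w "Suc i" 0 i] assms by auto
  moreover have "star ?w = star y * star a - a $$ (n - 1 - i, n - 1 - i) \<cdot>\<^sub>m star y"
    using assms y by (simp add: star_minus star_mult star_smult UT_closed)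
  moreover have "(star y * star a) $$ (0, i) = star y $$ (0, i) * star a $$ (i, i)"
    using rad_power_mult(2)[of "star y" n i "star a" 0 0] sy star_UT[OF assms(1)] assms(2)
    by (simp add: UT_eq_rad_power_0)
  ultimately show ?thesis using sy0 star_UT[OF y(2)] star_UT[OF assms(1)] assms(2)
    by (simp add: UT_entry UT_closed)
qed

text \<open>By \<open>star_diag\<close> the involution carries the mirror image of the root \<open>(i, i + 1)\<close> to this root.\<close>

lemma star_superdiag:
  assumes "Suc i < n"
  obtains c where "c \<noteq> 0"
    "\<And>y. y \<in> rad_power n 1 \<Longrightarrow> star y $$ (i, Suc i) = c * y $$ (n - 2 - i, n - 1 - i)"
proof -
  define p where "p = n - 2 - i"
  have p: "n - 1 - i = Suc p" "Suc p < n" "n - 1 - Suc i = p" using assms unfolding p_def by auto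
  let ?E = "unit_mat n (p, Suc p) :: 'f mat" and ?l = "unit_mat n (p, p) :: 'f mat"
    and ?r = "unit_mat n (Suc p, Suc p) :: 'f mat"
  define c where "c = star ?E $$ (i, Suc i)"
  have ut: "?E \<in> UT n" "?l \<in> UT n" "?r \<in> UT n" using unit_mat_UT by auto
  have form: "star y $$ (i, Suc i) = c * y $$ (p, Suc p)" if y: "y \<in> rad_power n 1" for y
  proof -
    have yU: "y \<in> UT n" using y rad_power_UT by auto
    have sy: "star y \<in> rad_power n 1" using y star_rad_power by auto
    have "?l * y * ?r = y $$ (p, Suc p) \<cdot>\<^sub>m ?E"
      using UT_carrier[OF UT_closed(6)[OF ut(2) yU]] UT_carrier[OF yU] p
      by (intro eq_matI) (auto simp: diag_unit_right[of _ n] diag_unit_left[of _ n] simp del: index_mult_mat(1))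
    then have "y $$ (p, Suc p) * c = star (?l * y * ?r) $$ (i, Suc i)"
      using ut star_UT[OF ut(1)] assms unfolding c_def by (simp add: star_smult UT_entry)
    also have "star (?l * y * ?r) = star ?r * (star y * star ?l)"
      using ut yU by (simp add: star_mult UT_closed)
    also have "\<dots> $$ (i, Suc i) = star ?r $$ (i, i) * (star y * star ?l) $$ (i, Suc i)"
      using rad_power_mult(2)[of "star ?r" n 0 "star y * star ?l" 1 i] star_UT[OF ut(3)]
        rad_power_mult(1)[OF sy, of "star ?l" 0] star_UT[OF ut(2)] assms
      by (simp add: UT_eq_rad_power_0)
    also have "(star y * star ?l) $$ (i, Suc i) = star y $$ (i, Suc i) * star ?l $$ (Suc i, Suc i)"
      using rad_power_mult(2)[OF sy, of "star ?l" 0 i] star_UT[OF ut(2)] assms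
      by (simp add: UT_eq_rad_power_0)
    finally show ?thesis
      using star_diag[OF ut(3), of i] star_diag[OF ut(2), of "Suc i"] p assms by (simp add: mult.commute)
  qed
  have "c \<noteq> 0"
  proof
    assume c: "c = 0"
    let ?u = "unit_mat n (i, Suc i) :: 'f mat"
    have "?u \<in> rad_power n 1" by (intro unit_mat_rad_power) simp
    then have "star (star ?u) $$ (i, Suc i) = c * star ?u $$ (p, Suc p)"
      using form star_radical by blast
    then show False using c assms star_star[OF unit_mat_UT[of i "Suc i"]] by simp
  qed
  with form show thesis using that p unfolding p_def by metis
qed

end

section \<open>Bases of quotient spaces\<close>

lemma more_unknowns_than_equations:
  fixes \<Phi> :: "'b \<Rightarrow> 'i \<Rightarrow> 'f::field"
  assumes "finite I" "finite T" "card T > card I"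
  shows "\<exists>c. (\<exists>b\<in>T. c b \<noteq> 0) \<and> (\<forall>i\<in>I. (\<Sum>b\<in>T. c b * \<Phi> b i) = 0)"
  using assms
proof (induction I arbitrary: T \<Phi> rule: finite_induct)
  case empty
  then obtain b where "b \<in> T" by fastforce
  then show ?case by (intro exI[of _ "\<lambda>_. 1"]) auto
next
  case (insert i I)
  show ?case
  proof (cases "\<forall>b\<in>T. \<Phi> b i = 0")
    case True
    have "card I < card T" using insert by simp
    then obtain c where c: "\<exists>b\<in>T. c b \<noteq> 0" "\<forall>i\<in>I. (\<Sum>b\<in>T. c b * \<Phi> b i) = 0"
      using insert.IH[OF insert.prems(1)] by blast
    then show ?thesis using True by (intro exI[of _ c]) auto
  next
    case False
    then obtain b0 where b0: "b0 \<in> T" "\<Phi> b0 i \<noteq> 0" by blast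
    define T' where "T' = T - {b0}"
    have T': "finite T'" "b0 \<notin> T'" "T = insert b0 T'" "card I < card T'"
      using b0 insert unfolding T'_def by auto
    define \<Psi> where "\<Psi> b j = \<Phi> b j - \<Phi> b i / \<Phi> b0 i * \<Phi> b0 j" for b j
    obtain c where c: "\<exists>b\<in>T'. c b \<noteq> 0" "\<forall>j\<in>I. (\<Sum>b\<in>T'. c b * \<Psi> b j) = 0"
      using insert.IH[OF T'(1,4), of \<Psi>] by blast
    define d where "d b = (if b = b0 then - (\<Sum>b\<in>T'. c b * \<Phi> b i) / \<Phi> b0 i else c b)" for b
    have d: "(\<Sum>b\<in>T. d b * \<Phi> b j) = (\<Sum>b\<in>T'. c b * \<Psi> b j)" for j
    proof -
      have "(\<Sum>b\<in>T'. d b * \<Phi> b j) = (\<Sum>b\<in>T'. c b * \<Phi> b j)"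
        using T'(2) by (intro sum.cong) (auto simp: d_def)
      then have "(\<Sum>b\<in>T. d b * \<Phi> b j) = (\<Sum>b\<in>T'. c b * \<Phi> b j) - (\<Sum>b\<in>T'. c b * \<Phi> b i) / \<Phi> b0 i * \<Phi> b0 j"
        unfolding T'(3) using T'(1,2) by (simp add: d_def)
      also have "\<dots> = (\<Sum>b\<in>T'. c b * \<Psi> b j)"
        unfolding \<Psi>_def by (simp add: right_diff_distrib sum_subtractf sum_distrib_right sum_divide_distrib mult.assoc)
      finally show ?thesis .
    qed
    have "\<exists>b\<in>T. d b \<noteq> 0" using c(1) T'(2,3) unfolding d_def by auto
    moreover have "\<Psi> b i = 0" for b using b0 unfolding \<Psi>_def by simp
    ultimately show ?thesis using c(2) d by (intro exI[of _ d]) auto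
  qed
qed

context vector_space
begin

lemma quotient_basis_exists:
  assumes "subspace W" "W \<subseteq> V"
  shows "\<exists>B. quotient_basis scale V W B"
proof -
  obtain B0 where B0: "B0 \<subseteq> W" "independent B0" "W \<subseteq> span B0"
    by (rule maximal_independent_subset)
  obtain B1 where B1: "B0 \<subseteq> B1" "B1 \<subseteq> V" "independent B1" "V \<subseteq> span B1"
    using maximal_independent_subset_extend[OF subset_trans[OF B0(1) assms(2)] B0(2)] .
  have W: "span B0 = W" using B0 assms(1) span_minimal by blast
  show ?thesis
    unfolding quotient_basis_def
  proof (intro exI conjI allI impI ballI)
    show "B1 - B0 \<subseteq> V" using B1 by blast
  next
    fix t c b assume t: "finite t \<and> t \<subseteq> B1 - B0 \<and> (\<Sum>b\<in>t. scale (c b) b) \<in> W" and b: "b \<in> t"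
    show "c b = 0"
    proof (rule ccontr)
      assume cb: "c b \<noteq> 0"
      let ?S = "span (B1 - {b})"
      have "(\<Sum>b\<in>t. scale (c b) b) \<in> ?S"
      proof -
        have "B0 \<subseteq> B1 - {b}" using t b B1(1) by auto
        then have "W \<subseteq> ?S" using W span_mono by auto
        then show ?thesis using t by auto
      qed
      moreover have "(\<Sum>b\<in>t - {b}. scale (c b) b) \<in> ?S"
        using t by (intro span_sum span_scale span_base) auto
      moreover have "(\<Sum>b\<in>t. scale (c b) b) = scale (c b) b + (\<Sum>b\<in>t - {b}. scale (c b) b)"
        using t b by (intro sum.remove) auto
      then have "scale (c b) b = (\<Sum>b\<in>t. scale (c b) b) - (\<Sum>b\<in>t - {b}. scale (c b) b)" by simp
      ultimately have "scale (c b) b \<in> ?S" by (simp only: span_diff)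
      then have "scale (inverse (c b)) (scale (c b) b) \<in> ?S" by (rule span_scale)
      then have "b \<in> ?S" using cb by simp
      then show False using B1(3) t b unfolding dependent_def by blast
    qed
  next
    fix v assume "v \<in> V"
    moreover have "B0 \<union> (B1 - B0) = B1" using B1(1) by auto
    ultimately have "v \<in> span (B0 \<union> (B1 - B0))" using B1(4) by auto
    then obtain x u where xu: "x \<in> span B0" "u \<in> span (B1 - B0)" "v = x + u"
      unfolding span_Un by auto
    then have "v - u \<in> W" using W by simp
    then show "\<exists>u\<in>span (B1 - B0). v - u \<in> W" using xu(2) by blast
  qed
qed

text \<open>Functionals that detect membership in \<open>W\<close> bound the dimension of the quotient: with more basis
  elements than functionals, some combination would be killed by all of them.\<close>

lemma quotient_basis_card_le:
  assumes B: "quotient_basis scale V W B" and V: "subspace V"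
    and I: "finite I"
    and lin: "\<And>i. i \<in> I \<Longrightarrow> Vector_Spaces.linear scale (*) (\<lambda>v. \<Phi> v i)"
    and ker: "\<And>v. v \<in> V \<Longrightarrow> (\<And>i. i \<in> I \<Longrightarrow> \<Phi> v i = 0) \<Longrightarrow> v \<in> W"
  shows "finite B \<and> card B \<le> card I"
proof -
  have le: "card T \<le> card I" if T: "finite T" "T \<subseteq> B" for T
  proof (rule ccontr)
    assume "\<not> card T \<le> card I"
    then obtain c where c: "\<exists>b\<in>T. c b \<noteq> 0" "\<forall>i\<in>I. (\<Sum>b\<in>T. c b * \<Phi> b i) = 0"
      using more_unknowns_than_equations[OF I T(1), of \<Phi>] by auto
    have "(\<Sum>b\<in>T. scale (c b) b) \<in> W"
    proof (rule ker)
      show "(\<Sum>b\<in>T. scale (c b) b) \<in> V"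
        using B T V unfolding quotient_basis_def by (intro subspace_sum subspace_scale) auto
      fix i assume i: "i \<in> I"
      interpret L: Vector_Spaces.linear scale "(*)" "\<lambda>v. \<Phi> v i" by (rule lin[OF i])
      show "\<Phi> (\<Sum>b\<in>T. scale (c b) b) i = 0" using c(2) i by (simp add: L.sum L.scale)
    qed
    then show False using B T c(1) unfolding quotient_basis_def by blast
  qed
  have "finite B"
  proof (rule ccontr)
    assume "infinite B"
    then obtain T where "T \<subseteq> B" "finite T" "card T = Suc (card I)"
      using infinite_arbitrarily_large by blast
    then show False using le by fastforce
  qed
  then show ?thesis using le by blast
qed

text \<open>A combination of the \<open>P j\<close> that lies in \<open>W\<close> is killed by all functionals, but the functional of the
  heaviest \<open>j\<close> that occurs in it sees \<open>P j\<close> only.\<close>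

lemma quotient_basis_card_ge:
  fixes wt :: "'j \<Rightarrow> nat"
  assumes B: "quotient_basis scale V W B" "finite B" and W: "subspace W"
    and J: "finite J"
    and lin: "\<And>j. j \<in> J \<Longrightarrow> Vector_Spaces.linear scale (*) (\<Phi> j)"
    and ker: "\<And>v j. v \<in> W \<Longrightarrow> j \<in> J \<Longrightarrow> \<Phi> j v = 0"
    and P: "\<And>j. j \<in> J \<Longrightarrow> P j \<in> V"
    and diag: "\<And>j. j \<in> J \<Longrightarrow> \<Phi> j (P j) \<noteq> 0"
    and tri: "\<And>i j. i \<in> J \<Longrightarrow> j \<in> J \<Longrightarrow> \<Phi> i (P j) \<noteq> 0 \<Longrightarrow> i = j \<or> wt i < wt j"
  shows "card J \<le> card B"
proof (rule ccontr)
  assume less: "\<not> card J \<le> card B"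
  have "\<exists>r. P j - (\<Sum>b\<in>B. scale (r b) b) \<in> W" if j: "j \<in> J" for j
  proof -
    obtain u where u: "u \<in> span B" "P j - u \<in> W" using B(1) P[OF j] unfolding quotient_basis_def by auto
    then show ?thesis unfolding span_finite[OF B(2)] by auto
  qed
  then obtain r where r: "\<And>j. j \<in> J \<Longrightarrow> P j - (\<Sum>b\<in>B. scale (r j b) b) \<in> W" by metis
  obtain c where c: "\<exists>j\<in>J. c j \<noteq> 0" "\<forall>b\<in>B. (\<Sum>j\<in>J. c j * r j b) = 0"
    using more_unknowns_than_equations[OF B(2) J, of r] less by auto
  have "(\<Sum>j\<in>J. scale (c j) (P j - (\<Sum>b\<in>B. scale (r j b) b))) \<in> W"
    using r W by (intro subspace_sum subspace_scale) auto
  moreover have "(\<Sum>j\<in>J. scale (c j) (P j - (\<Sum>b\<in>B. scale (r j b) b))) = (\<Sum>j\<in>J. scale (c j) (P j))"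
  proof -
    have "(\<Sum>j\<in>J. scale (c j) (\<Sum>b\<in>B. scale (r j b) b)) = (\<Sum>b\<in>B. \<Sum>j\<in>J. scale (c j * r j b) b)"
      by (simp add: scale_sum_right) (rule sum.swap)
    also have "\<dots> = (\<Sum>b\<in>B. scale (\<Sum>j\<in>J. c j * r j b) b)" by (simp add: scale_sum_left)
    finally show ?thesis using c(2) by (simp add: scale_right_diff_distrib sum_subtractf)
  qed
  ultimately have W': "(\<Sum>j\<in>J. scale (c j) (P j)) \<in> W" by simp
  let ?N = "{j \<in> J. c j \<noteq> 0}"
  have "finite (wt ` ?N)" "wt ` ?N \<noteq> {}" using J c(1) by auto
  then obtain k where k: "k \<in> ?N" "\<forall>j\<in>?N. wt j \<le> wt k"
    using Max_in[of "wt ` ?N"] Max_ge[of "wt ` ?N"] by fastforce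
  interpret L: Vector_Spaces.linear scale "(*)" "\<Phi> k" using lin k by blast
  have "0 = \<Phi> k (\<Sum>j\<in>J. scale (c j) (P j))" using ker[OF W'] k by simp
  also have "\<dots> = (\<Sum>j\<in>J. c j * \<Phi> k (P j))" by (simp add: L.sum L.scale)
  also have "\<dots> = (\<Sum>j\<in>{k}. c j * \<Phi> k (P j))"
    using J k tri by (intro sum.mono_neutral_right) fastforce+
  finally show False using k diag by auto
qed

end

section \<open>Multilinear polynomials and their evaluation\<close>

primrec letter_var :: "'g letter \<Rightarrow> nat" where
  "letter_var (Var i g) = i"
| "letter_var (VarStar i g) = i"

primrec letter_degree :: "'g letter \<Rightarrow> 'g" where
  "letter_degree (Var i g) = g"
| "letter_degree (VarStar i g) = g"

definition multilinear_words :: "('g, 'x) monoid_scheme \<Rightarrow> nat set \<Rightarrow> 'g letter list set" where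
  "multilinear_words G I = {w. distinct (map letter_var w) \<and> letter_var ` set w = I \<and>
     letter_degree ` set w \<subseteq> carrier G}"

definition multilinear_polys :: "('g, 'x) monoid_scheme \<Rightarrow> nat set \<Rightarrow> ('g, 'f::field) free_poly set" where
  "multilinear_polys G I = module.span scale ((\<lambda>w. Poly_Mapping.single w 1) ` multilinear_words G I)"

interpretation fp: vector_space "scale :: 'f::field \<Rightarrow> ('g, 'f) free_poly \<Rightarrow> _"
  by (rule vector_space_scale)

lemma multilinear_monomials_eq:
  "multilinear_monomials G m = (\<lambda>w. Poly_Mapping.single w 1) ` multilinear_words G {1..m}"
proof (intro equalityI subsetI)
  fix p :: "('a, 'f::field) free_poly" assume "p \<in> multilinear_monomials G m"
  then obtain \<sigma> g \<delta> where p: "p = Poly_Mapping.single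
        (map (\<lambda>k. if \<delta> k then VarStar (\<sigma> k) (g k) else Var (\<sigma> k) (g k)) [1..<Suc m]) 1"
    and s: "\<sigma> permutes {1..m}" and g: "\<forall>k\<in>{1..m}. g k \<in> carrier G"
    unfolding multilinear_monomials_def by blast
  let ?w = "map (\<lambda>k. if \<delta> k then VarStar (\<sigma> k) (g k) else Var (\<sigma> k) (g k)) [1..<Suc m]"
  have v: "map letter_var ?w = map \<sigma> [1..<Suc m]" by auto
  have "inj_on \<sigma> {1..m}" using s permutes_inj_on by blast
  then have "distinct (map letter_var ?w)" unfolding v by (simp add: distinct_map atLeastLessThanSuc_atLeastAtMost del: upt_Suc)
  moreover have "set (map letter_var ?w) = {1..m}"
    unfolding v using permutes_image[OF s] by (simp add: atLeastLessThanSuc_atLeastAtMost del: upt_Suc)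
  moreover have "letter_degree ` set ?w \<subseteq> carrier G" using g by auto
  ultimately have "?w \<in> multilinear_words G {1..m}" unfolding multilinear_words_def set_map[symmetric] by blast
  then show "p \<in> (\<lambda>w. Poly_Mapping.single w 1) ` multilinear_words G {1..m}" using p by blast
next
  fix p :: "('a, 'f::field) free_poly"
  assume "p \<in> (\<lambda>w. Poly_Mapping.single w 1) ` multilinear_words G {1..m}"
  then obtain w where p: "p = Poly_Mapping.single w 1" and w: "distinct (map letter_var w)"
    "letter_var ` set w = {1..m}" "letter_degree ` set w \<subseteq> carrier G"
    unfolding multilinear_words_def by auto
  have len: "length w = m" using distinct_card[OF w(1)] w(2) by simp
  define \<sigma> where "\<sigma> k = (if k \<in> {1..m} then letter_var (w ! (k - 1)) else k)" for k
  define g where "g k = letter_degree (w ! (k - 1))" for k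
  define \<delta> where "\<delta> k = (\<exists>i h. w ! (k - 1) = VarStar i h)" for k
  have "\<sigma> ` {1..m} = {1..m}"
  proof -
    have "\<sigma> ` {1..m} = (\<lambda>k. letter_var (w ! (k - 1))) ` {1..m}" unfolding \<sigma>_def by auto
    also have "\<dots> = (\<lambda>k. letter_var (w ! k)) ` {..<m}"
    proof -
      have "{1..m} = Suc ` {..<m}" by (simp add: image_Suc_lessThan)
      then show ?thesis by (simp add: image_image)
    qed
    also have "\<dots> = letter_var ` set w" using len by (auto simp: set_conv_nth)
    finally show ?thesis using w(2) by simp
  qed
  moreover have "inj_on \<sigma> {1..m}" using calculation by (intro eq_card_imp_inj_on) auto
  ultimately have "\<sigma> permutes {1..m}"
    by (intro bij_imp_permutes) (auto simp: bij_betw_def \<sigma>_def)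
  moreover have "\<forall>k\<in>{1..m}. g k \<in> carrier G" using w(3) len unfolding g_def by (force simp: set_conv_nth)
  moreover have "w = map (\<lambda>k. if \<delta> k then VarStar (\<sigma> k) (g k) else Var (\<sigma> k) (g k)) [1..<Suc m]"
  proof (rule nth_equalityI)
    fix i assume i: "i < length w"
    have "(if \<delta> (Suc i) then VarStar (\<sigma> (Suc i)) (g (Suc i)) else Var (\<sigma> (Suc i)) (g (Suc i))) = w ! i"
      using i len by (cases "w ! i") (auto simp: \<delta>_def \<sigma>_def g_def)
    then show "w ! i = map (\<lambda>k. if \<delta> k then VarStar (\<sigma> k) (g k) else Var (\<sigma> k) (g k)) [1..<Suc m] ! i"
      using i len by (auto split: if_splits simp del: upt_Suc)
  qed (use len in simp)
  ultimately show "p \<in> multilinear_monomials G m"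
    unfolding multilinear_monomials_def p by blast
qed

lemma multilinear_space_eq: "multilinear_space G m = multilinear_polys G {1..m}"
  unfolding multilinear_space_def multilinear_polys_def multilinear_monomials_eq ..

lemma multilinear_polys_free:
  assumes "\<forall>i\<in>I. 1 \<le> i" shows "multilinear_polys G I \<subseteq> free_algebra G"
  unfolding multilinear_polys_def
proof (rule fp.span_minimal)
  show "(\<lambda>w. Poly_Mapping.single w 1) ` multilinear_words G I \<subseteq> free_algebra G"
  proof (intro image_subsetI)
    fix w assume w: "w \<in> multilinear_words G I"
    have "l \<in> letters G" if "l \<in> set w" for l
      using w that assms unfolding multilinear_words_def letters_def by (cases l) force+
    then show "Poly_Mapping.single w 1 \<in> free_algebra G"
      unfolding free_algebra_def by auto
  qed
  have "Poly_Mapping.keys (p + q) \<subseteq> Poly_Mapping.keys p \<union> Poly_Mapping.keys q" for p q :: "('a, 'f::field) free_poly"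
    by (rule Poly_Mapping.keys_add)
  moreover have "Poly_Mapping.keys (scale c p) \<subseteq> Poly_Mapping.keys p" for c and p :: "('a, 'f::field) free_poly"
    by (auto simp: in_keys_iff lookup_scale)
  ultimately show "fp.subspace (free_algebra G)"
    unfolding fp.subspace_def free_algebra_def by (auto; blast)
qed

text \<open>Evaluation for arbitrary values \<open>W\<close> of the words. Unlike \<open>eval_poly\<close> it is linear without any
  condition on the words that occur.\<close>

definition eval_mat :: "nat \<Rightarrow> ('g letter list \<Rightarrow> 'f mat) \<Rightarrow> ('g, 'f::field) free_poly \<Rightarrow> 'f mat" where
  "eval_mat n W p = mat n n (\<lambda>ij. \<Sum>w\<in>Poly_Mapping.keys p. Poly_Mapping.lookup p w * W w $$ ij)"

lemma eval_mat_carrier [simp]: "eval_mat n W p \<in> carrier_mat n n"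
  "dim_row (eval_mat n W p) = n" "dim_col (eval_mat n W p) = n"
  unfolding eval_mat_def by auto

lemma eval_mat_entry:
  assumes "i < n" "j < n" "finite S" "Poly_Mapping.keys p \<subseteq> S"
  shows "eval_mat n W p $$ (i, j) = (\<Sum>w\<in>S. Poly_Mapping.lookup p w * W w $$ (i, j))"
proof -
  have "eval_mat n W p $$ (i, j) = (\<Sum>w\<in>Poly_Mapping.keys p. Poly_Mapping.lookup p w * W w $$ (i, j))"
    using assms unfolding eval_mat_def by simp
  also have "\<dots> = (\<Sum>w\<in>S. Poly_Mapping.lookup p w * W w $$ (i, j))"
    using assms by (intro sum.mono_neutral_left) (auto simp: in_keys_iff)
  finally show ?thesis .
qed

lemma eval_mat_add: "eval_mat n W (p + q) = eval_mat n W p + eval_mat n W q"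
proof (rule eq_matI)
  fix i j assume "i < dim_row (eval_mat n W p + eval_mat n W q)" "j < dim_col (eval_mat n W p + eval_mat n W q)"
  then have ij: "i < n" "j < n" by auto
  let ?S = "Poly_Mapping.keys p \<union> Poly_Mapping.keys q"
  have "eval_mat n W (p + q) $$ (i, j) = (\<Sum>w\<in>?S. Poly_Mapping.lookup (p + q) w * W w $$ (i, j))"
    using Poly_Mapping.keys_add[of p q] by (intro eval_mat_entry[OF ij]) auto
  also have "\<dots> = eval_mat n W p $$ (i, j) + eval_mat n W q $$ (i, j)"
    using eval_mat_entry[OF ij, of ?S p W] eval_mat_entry[OF ij, of ?S q W]
    by (simp add: lookup_add algebra_simps sum.distrib)
  finally show "eval_mat n W (p + q) $$ (i, j) = (eval_mat n W p + eval_mat n W q) $$ (i, j)"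
    using ij by simp
qed auto

lemma eval_mat_scale: "eval_mat n W (scale c p) = c \<cdot>\<^sub>m eval_mat n W p"
proof (rule eq_matI)
  fix i j assume "i < dim_row (c \<cdot>\<^sub>m eval_mat n W p)" "j < dim_col (c \<cdot>\<^sub>m eval_mat n W p)"
  then have ij: "i < n" "j < n" by auto
  have "Poly_Mapping.keys (scale c p) \<subseteq> Poly_Mapping.keys p" by (auto simp: in_keys_iff lookup_scale)
  then have "eval_mat n W (scale c p) $$ (i, j)
      = (\<Sum>w\<in>Poly_Mapping.keys p. Poly_Mapping.lookup (scale c p) w * W w $$ (i, j))"
    by (intro eval_mat_entry[OF ij]) auto
  also have "\<dots> = c * eval_mat n W p $$ (i, j)"
    using eval_mat_entry[OF ij, of "Poly_Mapping.keys p" p W]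
    by (simp add: lookup_scale sum_distrib_left mult.assoc)
  finally show "eval_mat n W (scale c p) $$ (i, j) = (c \<cdot>\<^sub>m eval_mat n W p) $$ (i, j)"
    using ij by simp
qed auto

lemma eval_mat_single:
  assumes "W w \<in> carrier_mat n n"
  shows "eval_mat n W (Poly_Mapping.single w 1) = W w"
  using assms unfolding eval_mat_def by (intro eq_matI) auto

lemma eval_mat_zero: "eval_mat n W 0 = 0\<^sub>m n n"
  unfolding eval_mat_def by (intro eq_matI) auto

lemma eval_mat_cong:
  assumes "\<And>w. w \<in> Poly_Mapping.keys p \<Longrightarrow> W w = W' w"
  shows "eval_mat n W p = eval_mat n W' p"
  unfolding eval_mat_def using assms by (intro eq_matI) (auto intro!: sum.cong)

lemma eval_mat_entry_linear:
  assumes "i < n" "j < n"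
  shows "Vector_Spaces.linear scale (*) (\<lambda>p. eval_mat n W p $$ (i, j))"
  using assms
  by unfold_locales (auto simp: eval_mat_add eval_mat_scale algebra_simps)

lemma eval_poly_eq_eval_mat:
  assumes "\<And>w. w \<in> Poly_Mapping.keys p \<Longrightarrow> eval_word n star a w \<in> carrier_mat n n" "n > 0"
  shows "eval_poly n star a p = eval_mat n (eval_word n star a) p"
proof -
  have "eval_poly n star a p \<in> carrier_mat n n"
    unfolding eval_poly_def using assms by (intro finsum_mat_entry(2)[of _ _ n 0 0]) auto
  moreover have "dim_row (eval_word n star a w) = n" "dim_col (eval_word n star a w) = n"
    if "w \<in> Poly_Mapping.keys p" for w using assms(1)[OF that] by auto
  then have "eval_poly n star a p $$ (i, j) = eval_mat n (eval_word n star a) p $$ (i, j)"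
    if "i < n" "j < n" for i j
    unfolding eval_poly_def using that assms
    by (subst finsum_mat_entry) (auto simp: eval_mat_def intro!: sum.cong)
  ultimately show ?thesis by (intro eq_matI) auto
qed

lemma multilinear_polys_induct [consumes 1, case_names zero word add scale]:
  assumes p: "p \<in> multilinear_polys G I"
    and zero: "P 0"
    and word: "\<And>w. w \<in> multilinear_words G I \<Longrightarrow> P (Poly_Mapping.single w 1)"
    and add: "\<And>p q. p \<in> multilinear_polys G I \<Longrightarrow> q \<in> multilinear_polys G I \<Longrightarrow> P p \<Longrightarrow> P q \<Longrightarrow> P (p + q)"
    and scale: "\<And>c p. p \<in> multilinear_polys G I \<Longrightarrow> P p \<Longrightarrow> P (scale c p)"
  shows "P p"
proof -
  have "p \<in> multilinear_polys G I \<and> P p"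
    using p[unfolded multilinear_polys_def]
  proof (induction rule: fp.span_induct_alt)
    case base
    then show ?case using zero unfolding multilinear_polys_def by (auto intro: fp.span_zero)
  next
    case (step c x y)
    then obtain w where w: "x = Poly_Mapping.single w 1" "w \<in> multilinear_words G I" by blast
    have x: "x \<in> multilinear_polys G I" unfolding multilinear_polys_def w(1) using w(2) by (auto intro: fp.span_base)
    then have "scale c x \<in> multilinear_polys G I" unfolding multilinear_polys_def by (rule fp.span_scale)
    moreover have "P (scale c x)" using scale[OF x] word[OF w(2)] w(1) by simp
    ultimately show ?case using step add
      unfolding multilinear_polys_def by (auto intro: fp.span_add)
  qed
  then show ?thesis by blast
qed

lemma multilinear_polys_closed:
  "p \<in> multilinear_polys G I \<Longrightarrow> q \<in> multilinear_polys G I \<Longrightarrow> p + q \<in> multilinear_polys G I"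
  "p \<in> multilinear_polys G I \<Longrightarrow> scale c p \<in> multilinear_polys G I"
  "0 \<in> multilinear_polys G I"
  "w \<in> multilinear_words G I \<Longrightarrow> Poly_Mapping.single w 1 \<in> multilinear_polys G I"
  unfolding multilinear_polys_def by (auto intro: fp.span_add fp.span_scale fp.span_zero fp.span_base)

lemma multilinear_polys_subspace: "fp.subspace (multilinear_polys G I)"
  unfolding multilinear_polys_def by (rule fp.subspace_span)

section \<open>The codimension as a number of independent functionals\<close>

definition upper_pairs :: "nat \<Rightarrow> (nat \<times> nat) set" where
  "upper_pairs n = {(p, q). p \<le> q \<and> q < n}"

lemma finite_upper_pairs [simp]: "finite (upper_pairs n)"
  unfolding upper_pairs_def by (rule finite_subset[of _ "{..<n} \<times> {..<n}"]) auto

text \<open>The unit matrix at \<open>(0, 0)\<close> outside \<open>{1..m}\<close> keeps all values upper triangular.\<close>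

definition unit_assignment :: "nat \<Rightarrow> nat \<Rightarrow> (nat \<Rightarrow> nat \<times> nat) \<Rightarrow> nat \<Rightarrow> 'f::field mat" where
  "unit_assignment n m f k = unit_mat n (if k \<in> {1..m} then f k else (0, 0))"

context graded_star_UT
begin

definition letter_mat :: "(nat \<Rightarrow> 'f mat) \<Rightarrow> 'g letter \<Rightarrow> 'f mat" where
  "letter_mat X = eval_letter star (\<lambda>k g. proj g (X k))"

definition word_mat :: "(nat \<Rightarrow> 'f mat) \<Rightarrow> 'g letter list \<Rightarrow> 'f mat" where
  "word_mat X = eval_word n star (\<lambda>k g. proj g (X k))"

definition poly_mat :: "(nat \<Rightarrow> 'f mat) \<Rightarrow> ('g, 'f) free_poly \<Rightarrow> 'f mat" where
  "poly_mat X = eval_mat n (word_mat X)"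

lemma word_mat_Nil [simp]: "word_mat X [] = 1\<^sub>m n"
  and word_mat_Cons [simp]: "word_mat X (l # w) = letter_mat X l * word_mat X w"
  unfolding word_mat_def letter_mat_def eval_word_def by simp_all

lemma letter_mat_UT: "X (letter_var l) \<in> UT n \<Longrightarrow> letter_mat X l \<in> UT n"
  unfolding letter_mat_def by (cases l) (auto intro: proj_UT star_UT)

lemma word_mat_UT: "(\<And>l. l \<in> set w \<Longrightarrow> X (letter_var l) \<in> UT n) \<Longrightarrow> word_mat X w \<in> UT n"
  by (induction w) (auto intro!: UT_closed letter_mat_UT)

lemma word_mat_append:
  "(\<And>l. l \<in> set (u @ v) \<Longrightarrow> X (letter_var l) \<in> UT n) \<Longrightarrow> word_mat X (u @ v) = word_mat X u * word_mat X v"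
proof (induction u)
  case Nil
  then show ?case using UT_carrier[OF word_mat_UT, of v X] by simp
next
  case (Cons l u)
  have "letter_mat X l \<in> UT n" "word_mat X u \<in> UT n" "word_mat X v \<in> UT n"
    using Cons.prems by (auto intro!: letter_mat_UT word_mat_UT)
  then show ?case using Cons by (simp add: UT_assoc)
qed

lemma word_mat_cong:
  assumes "\<And>l. l \<in> set w \<Longrightarrow> X (letter_var l) = Y (letter_var l)"
  shows "word_mat X w = word_mat Y w"
proof -
  have "letter_mat X l = letter_mat Y l" if "l \<in> set w" for l
    using assms[OF that] unfolding letter_mat_def by (cases l) auto
  then show ?thesis by (induction w) auto
qed

lemma poly_mat_word:
  assumes "w \<in> multilinear_words G I" "\<And>k. k \<in> I \<Longrightarrow> X k \<in> UT n"
  shows "poly_mat X (Poly_Mapping.single w 1) = word_mat X w"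
  unfolding poly_mat_def using assms
  by (intro eval_mat_single UT_carrier word_mat_UT) (auto simp: multilinear_words_def)

lemma poly_mat_UT:
  assumes "p \<in> multilinear_polys G I" "\<And>k. k \<in> I \<Longrightarrow> X k \<in> UT n"
  shows "poly_mat X p \<in> UT n"
  using assms(1)
proof (induction p rule: multilinear_polys_induct)
  case (word w)
  then show ?case using poly_mat_word[OF word assms(2)] assms(2)
    by (auto intro!: word_mat_UT simp: multilinear_words_def)
qed (auto simp: poly_mat_def eval_mat_zero eval_mat_add eval_mat_scale intro: UT_closed)

lemma poly_mat_cong:
  assumes "p \<in> multilinear_polys G I" "\<And>k. k \<in> I \<Longrightarrow> X k = Y k" "\<And>k. k \<in> I \<Longrightarrow> X k \<in> UT n"
  shows "poly_mat X p = poly_mat Y p"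
  using assms(1)
proof (induction p rule: multilinear_polys_induct)
  case (word w)
  have "word_mat X w = word_mat Y w"
    using word assms(2) by (intro word_mat_cong) (auto simp: multilinear_words_def)
  then show ?case using poly_mat_word[OF word, of X] poly_mat_word[OF word, of Y] assms by simp
qed (auto simp: poly_mat_def eval_mat_zero eval_mat_add eval_mat_scale)

text \<open>A graded substitution \<open>a\<close> is recovered from the sums \<open>X k\<close> of the \<open>a k g\<close> over all degrees \<open>g\<close>, because \<open>a k g\<close> is the component of \<open>X k\<close>
  of degree \<open>g\<close>. So one may substitute one matrix for each index.\<close>

lemma identity_iff:
  assumes "p \<in> multilinear_polys G I" "\<forall>i\<in>I. 1 \<le> i"
  shows "p \<in> star_identities G n A star \<longleftrightarrow> (\<forall>X. (\<forall>k. X k \<in> UT n) \<longrightarrow> poly_mat X p = 0\<^sub>m n n)"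
proof -
  have free: "p \<in> free_algebra G" using assms multilinear_polys_free by blast
  then have lets: "set w \<subseteq> letters G" if "w \<in> Poly_Mapping.keys p" for w
    using that unfolding free_algebra_def by blast
  have eval: "eval_poly n star (\<lambda>k g. proj g (X k)) p = poly_mat X p" if X: "\<forall>k. X k \<in> UT n" for X :: "nat \<Rightarrow> 'f mat"
    unfolding poly_mat_def word_mat_def
    using word_mat_UT[of _ X] X n_pos
    by (intro eval_poly_eq_eval_mat) (auto simp: word_mat_def[symmetric] intro: UT_carrier)
  show ?thesis
  proof (intro iffI allI impI)
    fix X :: "nat \<Rightarrow> 'f mat" assume id: "p \<in> star_identities G n A star" and X: "\<forall>k. X k \<in> UT n"
    have "\<forall>i\<ge>1. \<forall>g\<in>carrier G. proj g (X i) \<in> A g" using X proj_in by blast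
    then have "eval_poly n star (\<lambda>k g. proj g (X k)) p = 0\<^sub>m n n"
      by (rule id[unfolded star_identities_def mem_Collect_eq, THEN conjunct2, THEN spec, THEN mp])
    then show "poly_mat X p = 0\<^sub>m n n" using eval[OF X] by simp
  next
    assume van: "\<forall>X. (\<forall>k. X k \<in> UT n) \<longrightarrow> poly_mat X p = 0\<^sub>m n n"
    have "eval_poly n star a p = 0\<^sub>m n n" if a: "\<forall>i\<ge>1. \<forall>g\<in>carrier G. a i g \<in> A g" for a :: "nat \<Rightarrow> 'g \<Rightarrow> 'f mat"
    proof -
      define X where "X k = (if 1 \<le> k then mat n n (\<lambda>ij. \<Sum>g\<in>support. a k g $$ ij) else 0\<^sub>m n n)" for k
      have aUT: "a k g \<in> UT n" if "1 \<le> k" "g \<in> carrier G" for k g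
        using that a component_UT by auto
      have X: "X k \<in> UT n" for k
      proof (cases "1 \<le> k")
        case True
        have "a k g $$ (i, j) = 0" if "i < n" "j < i" "g \<in> support" for i j g
          using aUT[OF True, of g] that unfolding support_def UT_eq_rad_power_0 rad_power_def by auto
        then show ?thesis using True unfolding UT_eq_rad_power_0 rad_power_def X_def by auto
      qed (simp add: X_def UT_closed)
      have pX: "proj g (X k) = a k g" if k: "1 \<le> k" and g: "g \<in> carrier G" for k g
      proof -
        have "proj g (X k) = (if g \<in> carrier G then a k g else 0\<^sub>m n n)"
        proof (rule proj_eqI[OF X finite_support])
          show "(if g \<in> carrier G then a k g else 0\<^sub>m n n) \<in> A g" if "g \<in> carrier G" for g
            using a k that by simp
          show "{g. (if g \<in> carrier G then a k g else 0\<^sub>m n n) \<noteq> 0\<^sub>m n n} \<subseteq> support"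
            unfolding support_def using a k by (auto split: if_splits)
          show "X k $$ (i, j) = (\<Sum>g\<in>support. (if g \<in> carrier G then a k g else 0\<^sub>m n n) $$ (i, j))"
            if "i < n" "j < n" for i j
            using that k unfolding X_def support_def by (auto intro!: sum.cong)
        qed simp
        then show ?thesis using g by simp
      qed
      have ev: "eval_word n star a w = word_mat X w" if "w \<in> Poly_Mapping.keys p" for w
        using lets[OF that]
      proof (induction w)
        case Nil
        then show ?case unfolding word_mat_def eval_word_def by simp
      next
        case (Cons l w)
        have "eval_letter star a l = letter_mat X l"
          using Cons.prems pX unfolding letter_mat_def letters_def by auto
        then show ?case using Cons unfolding word_mat_Cons by (simp add: eval_word_def)
      qed
      have "eval_poly n star a p = eval_mat n (eval_word n star a) p"
        using ev word_mat_UT[of _ X] X n_pos by (intro eval_poly_eq_eval_mat) (auto intro: UT_carrier)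
      also have "\<dots> = poly_mat X p" unfolding poly_mat_def using ev by (intro eval_mat_cong) auto
      finally show ?thesis using van X by simp
    qed
    then show "p \<in> star_identities G n A star"
      unfolding star_identities_def using free by (intro CollectI conjI allI impI)
  qed
qed

lemma poly_mat_entry_linear:
  "i < n \<Longrightarrow> j < n \<Longrightarrow> Vector_Spaces.linear scale (*) (\<lambda>p. poly_mat X p $$ (i, j))"
  unfolding poly_mat_def by (rule eval_mat_entry_linear)

lemma identities_subspace:
  assumes "\<forall>i\<in>I. 1 \<le> i"
  shows "fp.subspace (multilinear_polys G I \<inter> star_identities G n A star)"
proof -
  have eq: "multilinear_polys G I \<inter> star_identities G n A star =
      {p \<in> multilinear_polys G I. \<forall>X. (\<forall>k. X k \<in> UT n) \<longrightarrow> poly_mat X p = 0\<^sub>m n n}"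
    using identity_iff[OF _ assms] by blast
  show ?thesis
    unfolding eq fp.subspace_def poly_mat_def
    by (auto simp: multilinear_polys_closed eval_mat_zero eval_mat_add eval_mat_scale)
qed

lemma letter_mat_update:
  assumes "M \<in> UT n" "N \<in> UT n"
  shows "letter_mat (X(letter_var l := M + N)) l =
      letter_mat (X(letter_var l := M)) l + letter_mat (X(letter_var l := N)) l"
    and "letter_mat (X(letter_var l := c \<cdot>\<^sub>m M)) l = c \<cdot>\<^sub>m letter_mat (X(letter_var l := M)) l"
  using assms unfolding letter_mat_def
  by (cases l; simp add: proj_add proj_smult star_add star_smult proj_UT)+

lemma word_mat_update:
  assumes w: "w \<in> multilinear_words G I" and k: "k \<in> I" and X: "\<And>k. X k \<in> UT n"
    and MN: "M \<in> UT n" "N \<in> UT n"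
  shows "word_mat (X(k := M + N)) w = word_mat (X(k := M)) w + word_mat (X(k := N)) w"
    and "word_mat (X(k := c \<cdot>\<^sub>m M)) w = c \<cdot>\<^sub>m word_mat (X(k := M)) w"
proof -
  obtain l where l: "l \<in> set w" "letter_var l = k"
    using w k unfolding multilinear_words_def by auto
  obtain u v where uv: "w = u @ l # v" using l(1) by (meson split_list)
  have dist: "letter_var l' \<noteq> k" if "l' \<in> set u \<union> set v" for l'
  proof -
    have "distinct (map letter_var (u @ l # v))" using w unfolding multilinear_words_def uv by blast
    then have "letter_var l \<notin> letter_var ` (set u \<union> set v)" by auto
    then show ?thesis using that l(2) by (metis image_eqI)
  qed
  define U V where "U = word_mat X u" and "V = word_mat X v"
  have ut: "U \<in> UT n" "V \<in> UT n" unfolding U_def V_def using X by (auto intro: word_mat_UT)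
  have split: "word_mat (X(k := K)) w = U * (letter_mat (X(k := K)) l * V)" if "K \<in> UT n" for K
  proof -
    have "word_mat (X(k := K)) w = word_mat (X(k := K)) u * word_mat (X(k := K)) (l # v)"
      unfolding uv using X that by (intro word_mat_append) auto
    moreover have "word_mat (X(k := K)) u = U" "word_mat (X(k := K)) v = V"
      unfolding U_def V_def using dist by (auto intro!: word_mat_cong)
    ultimately show ?thesis by simp
  qed
  have L: "letter_mat (X(k := K)) l \<in> UT n" if "K \<in> UT n" for K
    using that l(2) by (intro letter_mat_UT) auto
  show "word_mat (X(k := M + N)) w = word_mat (X(k := M)) w + word_mat (X(k := N)) w"
    using MN ut L letter_mat_update(1)[OF MN, of X l] l(2)
    by (simp add: split UT_closed UT_mult_distrib del: fun_upd_apply)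
  have "letter_mat (X(k := c \<cdot>\<^sub>m M)) l = c \<cdot>\<^sub>m letter_mat (X(k := M)) l"
    using letter_mat_update(2)[OF MN, of X l c] l(2) by simp
  then show "word_mat (X(k := c \<cdot>\<^sub>m M)) w = c \<cdot>\<^sub>m word_mat (X(k := M)) w"
    using split[of "c \<cdot>\<^sub>m M"] split[of M] MN UT_carrier[OF L[OF MN(1)]] UT_carrier[OF ut(1)] UT_carrier[OF ut(2)]
    by (simp add: UT_closed mult_smult_distrib[of _ n n _ n] mult_smult_assoc_mat[of _ n n _ n] del: fun_upd_apply)
qed

lemma poly_mat_update:
  assumes p: "p \<in> multilinear_polys G I" and k: "k \<in> I" and X: "\<And>k. X k \<in> UT n"
    and MN: "M \<in> UT n" "N \<in> UT n"
  shows "poly_mat (X(k := M + N)) p = poly_mat (X(k := M)) p + poly_mat (X(k := N)) p \<and>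
    poly_mat (X(k := c \<cdot>\<^sub>m M)) p = c \<cdot>\<^sub>m poly_mat (X(k := M)) p"
  using p
proof (induction p rule: multilinear_polys_induct)
  case zero
  then show ?case unfolding poly_mat_def eval_mat_zero by auto
next
  case (word w)
  have "poly_mat (X(k := K)) (Poly_Mapping.single w 1) = word_mat (X(k := K)) w" if "K \<in> UT n" for K
    using poly_mat_word[OF word] X that by simp
  then show ?case
    using word_mat_update[of w I k X, OF word k X MN] MN by (simp add: UT_closed del: fun_upd_apply)
next
  case (add p q)
  let ?P = "\<lambda>K p. poly_mat (X(k := K)) p"
  have c: "?P K p \<in> carrier_mat n n" for K p unfolding poly_mat_def by simp
  have a: "?P K (p + q) = ?P K p + ?P K q" for K p q unfolding poly_mat_def by (rule eval_mat_add)
  have "?P M p + ?P N p + (?P M q + ?P N q) = ?P M p + ?P M q + (?P N p + ?P N q)"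
    using c[of M p] c[of M q] c[of N p] c[of N q] by (intro eq_matI) (auto simp: algebra_simps)
  moreover have "c \<cdot>\<^sub>m ?P M p + c \<cdot>\<^sub>m ?P M q = c \<cdot>\<^sub>m (?P M p + ?P M q)"
    using c[of M p] c[of M q] by (intro eq_matI) (auto simp: algebra_simps)
  ultimately show ?case using add by (simp add: a del: fun_upd_apply)
next
  case (scale d p)
  let ?P = "\<lambda>K p. poly_mat (X(k := K)) p"
  have c: "?P K p \<in> carrier_mat n n" for K p unfolding poly_mat_def by simp
  have a: "?P K (Defs.scale d p) = d \<cdot>\<^sub>m ?P K p" for K p unfolding poly_mat_def by (rule eval_mat_scale)
  have "d \<cdot>\<^sub>m (?P M p + ?P N p) = d \<cdot>\<^sub>m ?P M p + d \<cdot>\<^sub>m ?P N p"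
    using c[of M p] c[of N p] by (intro eq_matI) (auto simp: algebra_simps)
  moreover have "d \<cdot>\<^sub>m (c \<cdot>\<^sub>m ?P M p) = c \<cdot>\<^sub>m (d \<cdot>\<^sub>m ?P M p)"
    using c[of M p] by (intro eq_matI) (auto simp: algebra_simps)
  ultimately show ?case using scale by (simp add: a del: fun_upd_apply)
qed

text \<open>By multilinearity, unit matrices can be replaced by arbitrary matrices in one variable after the other.\<close>

lemma poly_mat_vanish:
  assumes p: "p \<in> multilinear_polys G I" and I: "finite I"
    and units: "\<And>X. (\<And>k. k \<in> I \<Longrightarrow> X k \<in> unit_mat n ` upper_pairs n) \<Longrightarrow> (\<And>k. X k \<in> UT n) \<Longrightarrow>
      poly_mat X p = 0\<^sub>m n n"
    and X: "\<And>k. X k \<in> UT n"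
  shows "poly_mat X p = 0\<^sub>m n n"
proof -
  have U: "unit_mat n ` upper_pairs n \<subseteq> (UT n :: 'f mat set)"
    unfolding upper_pairs_def using unit_mat_UT by auto
  have "\<forall>X. (\<forall>k. X k \<in> UT n) \<longrightarrow> (\<forall>k\<in>I - S. X k \<in> unit_mat n ` upper_pairs n) \<longrightarrow>
      poly_mat X p = 0\<^sub>m n n" if "finite S" "S \<subseteq> I" for S
    using that
  proof (induction S rule: finite_induct)
    case empty
    then show ?case using units by simp
  next
    case (insert k S)
    show ?case
    proof (intro allI impI)
      fix X :: "nat \<Rightarrow> 'f mat" assume X: "\<forall>k. X k \<in> UT n" "\<forall>j\<in>I - insert k S. X j \<in> unit_mat n ` upper_pairs n"
      have k: "k \<in> I" using insert by simp
      note upd = poly_mat_update[OF p k, of X]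
      have "poly_mat (X(k := M)) p = 0\<^sub>m n n" if "M \<in> UT n" for M
        using that
      proof (induction M rule: UT_induct)
        case zero
        have "0\<^sub>m n n = 0 \<cdot>\<^sub>m (0\<^sub>m n n :: 'f mat)" by (intro eq_matI) auto
        then have "poly_mat (X(k := 0\<^sub>m n n)) p = 0 \<cdot>\<^sub>m poly_mat (X(k := 0\<^sub>m n n)) p"
          using upd[of "0\<^sub>m n n" "0\<^sub>m n n" 0] X(1) UT_closed(1) by metis
        also have "\<dots> = 0\<^sub>m n n" unfolding poly_mat_def by (intro eq_matI) auto
        finally show ?case .
      next
        case (add M N)
        then show ?case using upd[of M N] X(1) by (simp del: fun_upd_apply)
      next
        case (smult c M)
        then show ?case using upd[of M M c] X(1) by (simp del: fun_upd_apply)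
      next
        case (unit r q)
        then have "unit_mat n (r, q) \<in> unit_mat n ` upper_pairs n" unfolding upper_pairs_def by blast
        then have "\<forall>j. (X(k := unit_mat n (r, q))) j \<in> UT n"
          "\<forall>j\<in>I - S. (X(k := unit_mat n (r, q))) j \<in> unit_mat n ` upper_pairs n"
          using X U by auto
        then show ?case using insert.IH insert.prems by blast
      qed
      from this[of "X k"] X(1) show "poly_mat X p = 0\<^sub>m n n" by simp
    qed
  qed
  from this[OF I order.refl] X show ?thesis by simp
qed

lemma unit_assignment_UT:
  assumes "f ` {1..m} \<subseteq> upper_pairs n"
  shows "(unit_assignment n m f k :: 'f mat) \<in> UT n"
proof (cases "k \<in> {1..m}")
  case True
  then show ?thesis using assms unit_mat_UT[of "fst (f k)" "snd (f k)"]
    unfolding unit_assignment_def upper_pairs_def by fastforce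
qed (auto simp: unit_assignment_def intro: unit_mat_UT)

lemma star_codim_basis:
  obtains B where "quotient_basis scale (multilinear_polys G {1..m})
      (multilinear_polys G {1..m} \<inter> star_identities G n A star) B" "star_codim G n A star m = card B"
proof -
  let ?V = "multilinear_polys G {1..m} :: ('g, 'f) free_poly set" and ?W = "star_identities G n A star"
  have "\<exists>B. quotient_basis scale ?V (?V \<inter> ?W) B"
    by (rule fp.quotient_basis_exists[OF identities_subspace]) auto
  then have "quotient_basis scale ?V (?V \<inter> ?W) (SOME B. quotient_basis scale ?V (?V \<inter> ?W) B)"
    by (rule someI_ex)
  then show thesis using that unfolding star_codim_def quotient_dim_def multilinear_space_eq by blast
qed

lemma quotient_basis_bound:
  assumes B: "quotient_basis scale (multilinear_polys G {1..m})
      (multilinear_polys G {1..m} \<inter> star_identities G n A star) B"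
    and \<Psi>: "finite \<Psi>" "\<And>f i j. (f, i, j) \<in> \<Psi> \<Longrightarrow> i < n \<and> j < n"
    and supp: "\<And>f i j w. f \<in> {1..m} \<rightarrow>\<^sub>E upper_pairs n \<Longrightarrow> i < n \<Longrightarrow> j < n \<Longrightarrow>
      w \<in> multilinear_words G {1..m} \<Longrightarrow> word_mat (unit_assignment n m f) w $$ (i, j) \<noteq> 0 \<Longrightarrow> (f, i, j) \<in> \<Psi>"
  shows "finite B \<and> card B \<le> card \<Psi>"
proof (rule fp.quotient_basis_card_le[OF B multilinear_polys_subspace \<Psi>(1)])
  let ?\<Phi> = "\<lambda>p (f, i, j). poly_mat (unit_assignment n m f) p $$ (i, j)"
  show "Vector_Spaces.linear scale (*) (\<lambda>v. ?\<Phi> v t)" if "t \<in> \<Psi>" for t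
    using that \<Psi>(2) by (cases t) (auto intro!: poly_mat_entry_linear)
  fix p assume p: "p \<in> multilinear_polys G {1..m}" and z: "\<And>t. t \<in> \<Psi> \<Longrightarrow> ?\<Phi> p t = 0"
  have zero: "poly_mat (unit_assignment n m f) p = 0\<^sub>m n n" if f: "f \<in> {1..m} \<rightarrow>\<^sub>E upper_pairs n" for f
  proof -
    have ua: "(unit_assignment n m f k :: 'f mat) \<in> UT n" for k using f by (intro unit_assignment_UT) auto
    have "poly_mat (unit_assignment n m f) p $$ (i, j) = 0" if ij: "i < n" "j < n" for i j
    proof (cases "(f, i, j) \<in> \<Psi>")
      case True
      then show ?thesis using z by force
    next
      case False
      show ?thesis using p
      proof (induction p rule: multilinear_polys_induct)
        case (word w)
        then show ?case using supp[OF f ij word] False poly_mat_word[OF word ua] by auto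
      qed (use ij in \<open>auto simp: poly_mat_def eval_mat_zero eval_mat_add eval_mat_scale\<close>)
    qed
    then show ?thesis unfolding poly_mat_def by (intro eq_matI) auto
  qed
  have "poly_mat X p = 0\<^sub>m n n" if X: "\<And>k. X k \<in> UT n" for X :: "nat \<Rightarrow> 'f mat"
  proof (rule poly_mat_vanish[OF p _ _ X])
    fix X :: "nat \<Rightarrow> 'f mat" assume u: "\<And>k. k \<in> {1..m} \<Longrightarrow> X k \<in> unit_mat n ` upper_pairs n" and X: "\<And>k. X k \<in> UT n"
    have "\<forall>k. \<exists>pq. k \<in> {1..m} \<longrightarrow> pq \<in> upper_pairs n \<and> X k = unit_mat n pq" using u by blast
    then obtain f where f: "\<And>k. k \<in> {1..m} \<Longrightarrow> f k \<in> upper_pairs n \<and> X k = unit_mat n (f k)" by metis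
    have "poly_mat X p = poly_mat (unit_assignment n m (restrict f {1..m})) p"
      by (rule poly_mat_cong[OF p]) (use f in \<open>simp add: unit_assignment_def\<close>, rule X)
    then show "poly_mat X p = 0\<^sub>m n n" using zero[of "restrict f {1..m}"] f by auto
  qed simp
  then show "p \<in> multilinear_polys G {1..m} \<inter> star_identities G n A star"
    using p identity_iff[OF p] by auto
qed

text \<open>The entries at label maps detect identities, and only those that are nonzero on some word count.\<close>

lemma star_codim_le:
  assumes "finite \<Psi>" "\<And>f i j. (f, i, j) \<in> \<Psi> \<Longrightarrow> i < n \<and> j < n"
    and "\<And>f i j w. f \<in> {1..m} \<rightarrow>\<^sub>E upper_pairs n \<Longrightarrow> i < n \<Longrightarrow> j < n \<Longrightarrow>
      w \<in> multilinear_words G {1..m} \<Longrightarrow> word_mat (unit_assignment n m f) w $$ (i, j) \<noteq> 0 \<Longrightarrow> (f, i, j) \<in> \<Psi>"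
  shows "star_codim G n A star m \<le> card \<Psi>"
proof -
  obtain B where B: "quotient_basis scale (multilinear_polys G {1..m})
      (multilinear_polys G {1..m} \<inter> star_identities G n A star) B" "star_codim G n A star m = card B"
    by (rule star_codim_basis)
  show ?thesis unfolding B(2) by (rule conjunct2[OF quotient_basis_bound[OF B(1) assms]])
qed

lemma star_codim_ge:
  fixes wt :: "(nat \<Rightarrow> nat \<times> nat) \<Rightarrow> nat"
  assumes J: "finite J" "\<And>f. f \<in> J \<Longrightarrow> f ` {1..m} \<subseteq> upper_pairs n"
    and P: "\<And>f. f \<in> J \<Longrightarrow> P f \<in> multilinear_polys G {1..m}"
    and diag: "\<And>f. f \<in> J \<Longrightarrow> poly_mat (unit_assignment n m f) (P f) $$ (0, n - 1) \<noteq> 0"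
    and tri: "\<And>f f'. f \<in> J \<Longrightarrow> f' \<in> J \<Longrightarrow> poly_mat (unit_assignment n m f') (P f) $$ (0, n - 1) \<noteq> 0 \<Longrightarrow>
      f' = f \<or> wt f' < wt f"
  shows "card J \<le> star_codim G n A star m"
proof -
  obtain B where B: "quotient_basis scale (multilinear_polys G {1..m})
      (multilinear_polys G {1..m} \<inter> star_identities G n A star) B" "star_codim G n A star m = card B"
    by (rule star_codim_basis)
  have fin: "finite B"
    by (rule conjunct1[OF quotient_basis_bound[OF B(1), of "({1..m} \<rightarrow>\<^sub>E upper_pairs n) \<times> {..<n} \<times> {..<n}"]])
      (auto intro!: finite_PiE)
  have "card J \<le> card B"
  proof (rule fp.quotient_basis_card_ge[OF B(1) fin _ J(1), where \<Phi> = "\<lambda>f p. poly_mat (unit_assignment n m f) p $$ (0, n - 1)"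
        and P = P and wt = wt])
    show "fp.subspace (multilinear_polys G {1..m} \<inter> star_identities G n A star)"
      by (rule identities_subspace) auto
    show "Vector_Spaces.linear scale (*) (\<lambda>p. poly_mat (unit_assignment n m f) p $$ (0, n - 1))" for f
      using n_pos by (intro poly_mat_entry_linear) auto
    fix p f assume p: "p \<in> multilinear_polys G {1..m} \<inter> star_identities G n A star" and f: "f \<in> J"
    have "poly_mat (unit_assignment n m f) p = 0\<^sub>m n n"
      using identity_iff[of p "{1..m}"] p unit_assignment_UT[OF J(2)[OF f]] by auto
    then show "poly_mat (unit_assignment n m f) p $$ (0, n - 1) = 0" using n_pos by simp
  qed (use P diag tri in blast)+
  then show ?thesis using B(2) by simp
qed

end

section \<open>Counting label maps\<close>

definition diag_pairs :: "nat \<Rightarrow> (nat \<times> nat) set" where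
  "diag_pairs n = (\<lambda>j. (j, j)) ` {..<n}"

text \<open>The orbit of the simple root \<open>(i, i + 1)\<close> under reflection in the antidiagonal.\<close>

definition root_orbit :: "nat \<Rightarrow> nat \<Rightarrow> (nat \<times> nat) set" where
  "root_orbit n i = {(i, Suc i), (n - 2 - i, n - 1 - i)}"

text \<open>Position \<open>l i\<close> carries the label that is used at step \<open>i\<close> of the path from \<open>0\<close> to \<open>n - 1\<close>.\<close>

definition placement :: "nat \<Rightarrow> nat set \<Rightarrow> (nat \<Rightarrow> nat \<times> nat) \<Rightarrow> (nat \<Rightarrow> nat) \<Rightarrow> bool" where
  "placement n P f l \<longleftrightarrow> inj_on l {..<n - 1} \<and> l ` {..<n - 1} \<subseteq> P \<and>
     (\<forall>i<n - 1. f (l i) \<in> root_orbit n i) \<and> (\<forall>x\<in>P - l ` {..<n - 1}. f x \<in> diag_pairs n)"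

text \<open>Label maps of this kind carry the leading term of the codimension.\<close>

definition balanced :: "nat \<Rightarrow> nat set \<Rightarrow> (nat \<Rightarrow> nat \<times> nat) set" where
  "balanced n P = {f \<in> extensional P. \<exists>l. placement n P f l}"

lemma diag_pairs_card [simp]: "card (diag_pairs n) = n" "finite (diag_pairs n)"
  unfolding diag_pairs_def by (auto simp: card_image inj_on_def)

lemma root_orbit_not_diag: "i < n - 1 \<Longrightarrow> pq \<in> root_orbit n i \<Longrightarrow> pq \<notin> diag_pairs n"
  unfolding root_orbit_def diag_pairs_def by auto

lemma root_orbit_reflect: "i < n - 1 \<Longrightarrow> root_orbit n (n - 2 - i) = root_orbit n i"
  unfolding root_orbit_def by auto

lemma root_orbit_overlap:
  "i < n - 1 \<Longrightarrow> j < n - 1 \<Longrightarrow> pq \<in> root_orbit n i \<Longrightarrow> pq \<in> root_orbit n j \<Longrightarrow> j = i \<or> j = n - 2 - i"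
  unfolding root_orbit_def by auto

lemma root_orbit_upper: "i < n - 1 \<Longrightarrow> root_orbit n i \<subseteq> upper_pairs n"
  unfolding root_orbit_def upper_pairs_def by auto

lemma diag_pairs_upper: "diag_pairs n \<subseteq> upper_pairs n"
  unfolding diag_pairs_def upper_pairs_def by auto

text \<open>A label determines the orbit of the step that uses it, so two placements differ by exchanges of the two positions inside some
  of the mirror pairs of steps.\<close>

lemma card_placements:
  assumes "placement n P f l0"
  shows "card {l \<in> {..<n - 1} \<rightarrow>\<^sub>E P. placement n P f l} = 2 ^ ((n - 1) div 2)"
proof -
  let ?R = "{..<n - 1}" and ?H = "{..<(n - 1) div 2}"
  \<comment> \<open>exchange the mirror pairs of steps whose smaller member lies in \<open>S\<close>\<close>
  define swap where "swap S i = (if i \<in> S \<or> n - 2 - i \<in> S then n - 2 - i else i)" for S i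
  define \<Theta> where "\<Theta> S = restrict (l0 \<circ> swap S) ?R" for S
  have l0: "inj_on l0 ?R" "l0 ` ?R \<subseteq> P" "\<And>i. i < n - 1 \<Longrightarrow> f (l0 i) \<in> root_orbit n i"
    "\<And>x. x \<in> P - l0 ` ?R \<Longrightarrow> f x \<in> diag_pairs n"
    using assms unfolding placement_def by auto
  have refl: "n - 2 - i < n - 1" "n - 2 - (n - 2 - i) = i" if "i < n - 1" for i using that by auto
  have swap_R: "swap S i < n - 1" "swap S (swap S i) = i" if "i < n - 1" for S i
    using that refl unfolding swap_def by auto
  have swap_img: "swap S ` ?R = ?R" for S
    using swap_R by (auto simp: image_iff) (metis lessThan_iff)
  have pl: "placement n P f (\<Theta> S)" for S
  proof -
    have "inj_on (swap S) ?R" by (rule inj_on_inverseI[of _ "swap S"]) (use swap_R in auto)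
    then have "inj_on (l0 \<circ> swap S) ?R" using l0(1) swap_img by (intro comp_inj_on) auto
    then have inj: "inj_on (\<Theta> S) ?R" unfolding \<Theta>_def by (simp add: inj_on_def)
    have img: "\<Theta> S ` ?R = l0 ` ?R"
      using swap_img[of S] unfolding \<Theta>_def by (metis image_comp image_restrict_eq)
    have "f (\<Theta> S i) \<in> root_orbit n i" if "i < n - 1" for i
    proof -
      have "f (l0 (swap S i)) \<in> root_orbit n (swap S i)" using l0(3) swap_R that by auto
      moreover have "root_orbit n (swap S i) = root_orbit n i"
        using root_orbit_reflect[OF that] unfolding swap_def by auto
      ultimately show ?thesis using that unfolding \<Theta>_def by simp
    qed
    then show ?thesis unfolding placement_def using inj img l0 by auto
  qed
  have "bij_betw \<Theta> (Pow ?H) {l \<in> ?R \<rightarrow>\<^sub>E P. placement n P f l}"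
    unfolding bij_betw_def
  proof (intro conjI equalityI subsetI)
    show "inj_on \<Theta> (Pow ?H)"
    proof (rule inj_onI)
      fix S S' assume S: "S \<in> Pow ?H" "S' \<in> Pow ?H" "\<Theta> S = \<Theta> S'"
      have "i \<in> S \<longleftrightarrow> i \<in> S'" if i: "i \<in> ?H" for i
      proof -
        have i': "i < n - 1" "n - 2 - i \<notin> ?H" "n - 2 - i \<noteq> i" using i by auto
        have "l0 (swap S i) = l0 (swap S' i)" using fun_cong[OF S(3), of i] i' unfolding \<Theta>_def by simp
        then have "swap S i = swap S' i" using l0(1) swap_R[OF i'(1)] by (auto dest!: inj_onD)
        then show ?thesis using i' S unfolding swap_def by (auto split: if_splits)
      qed
      then show "S = S'" using S by blast
    qed
  next
    fix l assume "l \<in> \<Theta> ` Pow ?H"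
    then obtain S where "l = \<Theta> S" by blast
    then show "l \<in> {l \<in> ?R \<rightarrow>\<^sub>E P. placement n P f l}"
      using pl[of S] unfolding placement_def \<Theta>_def by auto
  next
    fix l assume l: "l \<in> {l \<in> ?R \<rightarrow>\<^sub>E P. placement n P f l}"
    then have l': "inj_on l ?R" "l ` ?R \<subseteq> P" "\<And>i. i < n - 1 \<Longrightarrow> f (l i) \<in> root_orbit n i"
      "l \<in> extensional ?R"
      unfolding placement_def by (auto simp: PiE_def)
    have two: "l i = l0 i \<or> l i = l0 (n - 2 - i)" if i: "i < n - 1" for i
    proof -
      have "f (l i) \<notin> diag_pairs n" using l'(3)[OF i] root_orbit_not_diag[OF i] by blast
      then have "l i \<in> l0 ` ?R" using l0(4)[of "l i"] l'(2) i by auto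
      then obtain j where j: "j < n - 1" "l i = l0 j" by auto
      then have "j = i \<or> j = n - 2 - i"
        using root_orbit_overlap[OF i j(1) l'(3)[OF i]] l0(3)[OF j(1)] by simp
      then show ?thesis using j by auto
    qed
    define S where "S = {i \<in> ?H. l i \<noteq> l0 i}"
    have "l i = l0 (swap S i)" if i: "i < n - 1" for i
    proof -
      let ?i = "n - 2 - i"
      have i': "?i < n - 1" "n - 2 - ?i = i" using refl[OF i] by auto
      consider "i = ?i" | "i \<in> ?H" "?i \<notin> ?H" "i \<noteq> ?i" | "i \<notin> ?H" "?i \<in> ?H" "i \<noteq> ?i"
      proof -
        have "i \<in> ?H \<or> ?i \<in> ?H \<or> i = ?i" using i by auto
        moreover have "\<not> (i \<in> ?H \<and> ?i \<in> ?H)" by auto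
        moreover have "i \<in> ?H \<Longrightarrow> i \<noteq> ?i" "?i \<in> ?H \<Longrightarrow> i \<noteq> ?i" using i by auto
        ultimately show thesis using that by blast
      qed
      then show ?thesis
      proof cases
        case 1
        then show ?thesis using two[OF i] unfolding swap_def by auto
      next
        case 2
        then show ?thesis using two[OF i] unfolding swap_def S_def by auto
      next
        case 3
        have ne: "l i \<noteq> l ?i" using inj_onD[OF l'(1), of i ?i] i i' 3 by auto
        have "i \<notin> S" using 3 unfolding S_def by auto
        moreover have "?i \<in> S \<longleftrightarrow> l ?i \<noteq> l0 ?i" using 3 unfolding S_def by auto
        moreover have "l ?i = l0 ?i \<or> l ?i = l0 i" using two[OF i'(1)] i'(2) by simp
        ultimately show ?thesis using two[OF i] ne unfolding swap_def by auto
      qed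
    qed
    then have "l = \<Theta> S" using l'(4) unfolding \<Theta>_def by (intro extensionalityI[of _ ?R]) auto
    then show "l \<in> \<Theta> ` Pow ?H" unfolding S_def by auto
  qed
  then have "card (Pow ?H) = card {l \<in> ?R \<rightarrow>\<^sub>E P. placement n P f l}" by (rule bij_betw_same_card)
  then show ?thesis by (simp add: card_Pow)
qed

text \<open>The orbit of the middle root, which exists for even \<open>n\<close>, has one element; the others have two.\<close>

lemma prod_card_root_orbit: "(\<Prod>i<n - 1. card (root_orbit n i)) = 2 ^ ((n - 1) div 2) * 2 ^ ((n - 1) div 2)"
proof -
  let ?H = "{..<(n - 1) div 2}" and ?N = "{i. i < n - 1 \<and> n - 2 - i \<noteq> i}"
  have card: "card (root_orbit n i) = (if n - 2 - i \<noteq> i then 2 else 1)" if "i < n - 1" for i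
  proof (cases "n - 2 - i = i")
    case True
    then have "n - 1 - i = Suc i" using that by auto
    then show ?thesis using True unfolding root_orbit_def by simp
  qed (auto simp: root_orbit_def)
  have N: "?N = ?H \<union> (\<lambda>i. n - 2 - i) ` ?H"
  proof (intro equalityI subsetI)
    fix i assume i: "i \<in> ?N"
    show "i \<in> ?H \<union> (\<lambda>i. n - 2 - i) ` ?H"
    proof (cases "i < (n - 1) div 2")
      case False
      then have "n - 2 - i \<in> ?H" "i = n - 2 - (n - 2 - i)" using i by auto
      then show ?thesis by blast
    qed auto
  qed auto
  have "inj_on (\<lambda>i. n - 2 - i) ?H" by (rule inj_onI) auto
  moreover have "?H \<inter> (\<lambda>i. n - 2 - i) ` ?H = {}" by auto
  ultimately have cN: "card ?N = (n - 1) div 2 + (n - 1) div 2"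
    unfolding N by (subst card_Un_disjoint) (auto simp: card_image)
  have "(\<Prod>i<n - 1. card (root_orbit n i)) = (\<Prod>i<n - 1. if i \<in> ?N then 2 else 1)"
    using card by (intro prod.cong) auto
  also have "\<dots> = (\<Prod>i\<in>{..<n - 1} \<inter> ?N. 2)"
    by (rule prod.inter_restrict[symmetric]) simp
  also have "{..<n - 1} \<inter> ?N = ?N" by auto
  finally show ?thesis using cN by (simp add: power_add)
qed

lemma balanced_subset: "balanced n P \<subseteq> P \<rightarrow>\<^sub>E upper_pairs n"
proof (intro subsetI PiE_I)
  fix f x assume f: "f \<in> balanced n P" and x: "x \<in> P"
  then obtain l where l: "placement n P f l" unfolding balanced_def by blast
  show "f x \<in> upper_pairs n"
  proof (cases "x \<in> l ` {..<n - 1}")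
    case True
    then show ?thesis using l root_orbit_upper unfolding placement_def by blast
  next
    case False
    then show ?thesis using l x diag_pairs_upper unfolding placement_def by blast
  qed
qed (auto simp: balanced_def extensional_def)

lemma finite_balanced: "finite P \<Longrightarrow> finite (balanced n P)"
  using finite_subset[OF balanced_subset] finite_PiE finite_upper_pairs by metis

text \<open>Count the pairs of a label map \<open>f\<close> and a placement \<open>l\<close> for it in two ways: every \<open>f\<close> has
  \<open>2 ^ ((n - 1) div 2)\<close> placements, and an injective \<open>l\<close> fits \<open>4 ^ ((n - 1) div 2) * n ^ (card P - (n - 1))\<close> label maps.\<close>

lemma card_balanced:
  assumes "finite P"
  shows "card (balanced n P) =
    2 ^ ((n - 1) div 2) * (\<Prod>i<n - 1. card P - i) * n ^ (card P - (n - 1))"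
proof -
  let ?R = "{..<n - 1}" and ?h = "(n - 1) div 2"
  let ?L = "{l \<in> ?R \<rightarrow>\<^sub>E P. inj_on l ?R}"
  have finL: "finite ?L" using assms by (simp add: finite_PiE)
  have fibre: "card {f \<in> balanced n P. placement n P f l} = 2 ^ ?h * 2 ^ ?h * n ^ (card P - (n - 1))"
    if l: "l \<in> ?L" for l
  proof -
    have l': "inj_on l ?R" "l ` ?R \<subseteq> P" using l by auto
    define K where "K x = (if x \<in> l ` ?R then root_orbit n (the_inv_into ?R l x) else diag_pairs n)" for x
    have K: "K (l i) = root_orbit n i" if "i < n - 1" for i
      using that the_inv_into_f_f[OF l'(1)] unfolding K_def by auto
    have "{f \<in> balanced n P. placement n P f l} = PiE P K"
    proof (intro equalityI subsetI)
      fix f assume f: "f \<in> {f \<in> balanced n P. placement n P f l}"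
      have "f x \<in> K x" if x: "x \<in> P" for x
      proof (cases "x \<in> l ` ?R")
        case True
        then show ?thesis using f K unfolding placement_def by auto
      next
        case False
        then show ?thesis using f x unfolding placement_def K_def by auto
      qed
      then show "f \<in> PiE P K" using f unfolding balanced_def by (auto simp: PiE_def)
    next
      fix f assume f: "f \<in> PiE P K"
      have "placement n P f l"
        unfolding placement_def
      proof (intro conjI allI impI ballI l')
        show "f (l i) \<in> root_orbit n i" if "i < n - 1" for i using f l'(2) K[OF that] that by (force simp: PiE_def)
        show "f x \<in> diag_pairs n" if "x \<in> P - l ` ?R" for x
          using PiE_mem[OF f, of x] that unfolding K_def by auto
      qed
      then show "f \<in> {f \<in> balanced n P. placement n P f l}"
        using f unfolding balanced_def by (auto simp: PiE_def)
    qed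
    then have "card {f \<in> balanced n P. placement n P f l} = (\<Prod>x\<in>P. card (K x))"
      using assms by (simp add: card_PiE)
    also have "\<dots> = (\<Prod>x\<in>P - l ` ?R. card (K x)) * (\<Prod>x\<in>l ` ?R. card (K x))"
      using assms l'(2) by (intro prod.subset_diff) auto
    also have "(\<Prod>x\<in>l ` ?R. card (K x)) = (\<Prod>i<n - 1. card (root_orbit n i))"
      using l'(1) K by (simp add: prod.reindex)
    also have "(\<Prod>x\<in>P - l ` ?R. card (K x)) = (\<Prod>x\<in>P - l ` ?R. n)"
      by (intro prod.cong) (auto simp: K_def)
    also have "\<dots> = n ^ (card P - (n - 1))"
      using assms l' by (simp add: card_Diff_subset card_image finite_subset)
    finally have eq: "card {f \<in> balanced n P. placement n P f l} =
      n ^ (card P - (n - 1)) * (\<Prod>i<n - 1. card (root_orbit n i))" .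
    show ?thesis unfolding eq prod_card_root_orbit by (rule mult.commute)
  qed
  have "(\<Sum>f\<in>balanced n P. card {l \<in> ?L. placement n P f l})
      = (\<Sum>l\<in>?L. 2 ^ ?h * 2 ^ ?h * n ^ (card P - (n - 1)))"
    using fibre by (intro sum_multicount_gen finite_balanced assms finL) auto
  moreover have "card {l \<in> ?L. placement n P f l} = 2 ^ ?h" if "f \<in> balanced n P" for f
  proof -
    have "{l \<in> ?L. placement n P f l} = {l \<in> ?R \<rightarrow>\<^sub>E P. placement n P f l}"
      unfolding placement_def by auto
    then show ?thesis using that card_placements unfolding balanced_def by auto
  qed
  ultimately have "card (balanced n P) * 2 ^ ?h = card ?L * (2 ^ ?h * 2 ^ ?h * n ^ (card P - (n - 1)))"
    by simp
  then have "card (balanced n P) = card ?L * (2 ^ ?h * n ^ (card P - (n - 1)))"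
    by (simp add: mult.assoc mult.left_commute)
  moreover have "card ?L = (\<Prod>i<n - 1. card P - i)"
    using card_inj_on_subset_funcset[of ?R P ?R] assms by (simp add: lessThan_atLeast0)
  ultimately show ?thesis by simp
qed

definition degenerate :: "nat \<Rightarrow> nat \<Rightarrow> (nat \<Rightarrow> nat \<times> nat) set" where
  "degenerate n m = {f \<in> {1..m} \<rightarrow>\<^sub>E upper_pairs n. card {k \<in> {1..m}. f k \<notin> diag_pairs n} < n - 1}"

lemma card_upper_pairs: "card (upper_pairs n) \<le> n * n"
proof -
  have "card (upper_pairs n) \<le> card ({..<n} \<times> {..<n})"
    unfolding upper_pairs_def by (intro card_mono) auto
  then show ?thesis by simp
qed

lemma card_degenerate:
  assumes "n \<ge> 1"
  shows "card (degenerate n m) \<le> (\<Sum>t<n - 1. (m * (n * n)) ^ t * n ^ m)"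
proof -
  let ?F = "\<lambda>Z. PiE {1..m} (\<lambda>k. if k \<in> Z then upper_pairs n else diag_pairs n)"
  let ?Z = "\<lambda>t. {Z. Z \<subseteq> {1..m} \<and> card Z = t}"
  have sub: "degenerate n m \<subseteq> (\<Union>t<n - 1. \<Union>Z\<in>?Z t. ?F Z)"
  proof
    fix f assume f: "f \<in> degenerate n m"
    let ?N = "{k \<in> {1..m}. f k \<notin> diag_pairs n}"
    have "f \<in> ?F ?N" using f unfolding degenerate_def by (auto simp: PiE_def Pi_def)
    moreover have "card ?N < n - 1" "?N \<subseteq> {1..m}" using f unfolding degenerate_def by auto
    ultimately show "f \<in> (\<Union>t<n - 1. \<Union>Z\<in>?Z t. ?F Z)" by blast
  qed
  have finZ: "finite (?Z t)" for t by simp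
  have cardF: "card (?F Z) \<le> (n * n) ^ t * n ^ m" if "Z \<in> ?Z t" for Z t
  proof -
    have Z: "Z \<subseteq> {1..m}" "finite Z" "card Z = t" using that finite_subset by auto
    have "card (?F Z) = (\<Prod>k\<in>{1..m}. card (if k \<in> Z then upper_pairs n else diag_pairs n))"
      by (simp add: card_PiE)
    also have "\<dots> = (\<Prod>k\<in>{1..m} - Z. card (if k \<in> Z then upper_pairs n else diag_pairs n)) *
        (\<Prod>k\<in>Z. card (if k \<in> Z then upper_pairs n else diag_pairs n))"
      using Z by (intro prod.subset_diff) auto
    also have "\<dots> = n ^ (m - t) * card (upper_pairs n) ^ t"
      using Z by (simp add: card_Diff_subset)
    also have "\<dots> \<le> n ^ m * (n * n) ^ t"
      using assms card_upper_pairs by (intro mult_mono power_mono power_increasing) auto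
    finally show ?thesis by (simp add: mult.commute)
  qed
  have "card (degenerate n m) \<le> card (\<Union>t<n - 1. \<Union>Z\<in>?Z t. ?F Z)"
    using sub by (intro card_mono) (auto intro!: finite_PiE)
  also have "\<dots> \<le> (\<Sum>t<n - 1. card (\<Union>Z\<in>?Z t. ?F Z))" by (intro card_UN_le) simp
  also have "\<dots> \<le> (\<Sum>t<n - 1. (m * (n * n)) ^ t * n ^ m)"
  proof (rule sum_mono)
    fix t
    have "card (\<Union>Z\<in>?Z t. ?F Z) \<le> (\<Sum>Z\<in>?Z t. card (?F Z))" by (intro card_UN_le finZ)
    also have "\<dots> \<le> (\<Sum>Z\<in>?Z t. (n * n) ^ t * n ^ m)" by (intro sum_mono cardF)
    also have "\<dots> = (m choose t) * ((n * n) ^ t * n ^ m)" by (simp add: n_subsets)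
    also have "\<dots> \<le> m ^ t * ((n * n) ^ t * n ^ m)"
    proof (intro mult_right_mono)
      show "m choose t \<le> m ^ t" by (cases "t \<le> m") (auto simp: binomial_le_pow binomial_eq_0)
    qed simp
    finally show "card (\<Union>Z\<in>?Z t. ?F Z) \<le> (m * (n * n)) ^ t * n ^ m"
      by (simp add: power_mult_distrib mult.assoc)
  qed
  finally show ?thesis .
qed

definition segment :: "nat \<Rightarrow> nat \<Rightarrow> nat set" where
  "segment s i = {i * s<..i * s + s}"

text \<open>Each of the \<open>n - 1\<close> segments has to contain all diagonal labels, so that every step of the path finds
  a pivot of its own whatever root it uses.\<close>

definition spread :: "nat \<Rightarrow> nat \<Rightarrow> (nat \<Rightarrow> nat \<times> nat) set" where
  "spread n s = {f \<in> {1..(n - 1) * s} \<rightarrow>\<^sub>E diag_pairs n. \<forall>i<n - 1. diag_pairs n \<subseteq> f ` segment s i}"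

lemma segment_subset: "i < n - 1 \<Longrightarrow> segment s i \<subseteq> {1..(n - 1) * s}"
proof
  fix x assume i: "i < n - 1" and x: "x \<in> segment s i"
  have "i * s + s \<le> (n - 1) * s" using i mult_le_mono1[of "Suc i" "n - 1" s] by simp
  then show "x \<in> {1..(n - 1) * s}" using x unfolding segment_def by auto
qed

lemma segment_disjoint:
  assumes "x \<in> segment s i" "x \<in> segment s j" shows "i = j"
proof (rule ccontr)
  have *: False if "i < j" "x \<in> segment s i" "x \<in> segment s j" for i j
    using mult_le_mono1[of "Suc i" j s] that unfolding segment_def by auto
  assume "i \<noteq> j"
  then show False using * assms by (metis linorder_neqE_nat)
qed

lemma finite_spread: "finite (spread n s)"
  by (rule finite_subset[of _ "{1..(n - 1) * s} \<rightarrow>\<^sub>E diag_pairs n"])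
    (auto simp: spread_def intro!: finite_PiE)

lemma card_spread:
  "n ^ ((n - 1) * s) \<le> card (spread n s) + (n - 1) * n * ((n - 1) ^ s * n ^ ((n - 1) * s - s))"
proof -
  let ?T = "{1..(n - 1) * s}"
  let ?B = "\<lambda>i pq. PiE ?T (\<lambda>x. if x \<in> segment s i then diag_pairs n - {pq} else diag_pairs n)"
  have "?T \<rightarrow>\<^sub>E diag_pairs n \<subseteq> spread n s \<union> (\<Union>i<n - 1. \<Union>pq\<in>diag_pairs n. ?B i pq)"
  proof
    fix f assume f: "f \<in> ?T \<rightarrow>\<^sub>E diag_pairs n"
    show "f \<in> spread n s \<union> (\<Union>i<n - 1. \<Union>pq\<in>diag_pairs n. ?B i pq)"
    proof (cases "f \<in> spread n s")
      case False
      then obtain i pq where "i < n - 1" "pq \<in> diag_pairs n" "pq \<notin> f ` segment s i"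
        using f unfolding spread_def by blast
      moreover from this have "f \<in> ?B i pq" using f by (auto simp: PiE_def Pi_def)
      ultimately show ?thesis by blast
    qed simp
  qed
  then have "card (?T \<rightarrow>\<^sub>E diag_pairs n) \<le> card (spread n s \<union> (\<Union>i<n - 1. \<Union>pq\<in>diag_pairs n. ?B i pq))"
    by (intro card_mono) (auto simp: finite_spread intro!: finite_PiE)
  also have "\<dots> \<le> card (spread n s) + card (\<Union>i<n - 1. \<Union>pq\<in>diag_pairs n. ?B i pq)"
    by (rule card_Un_le)
  also have "card (\<Union>i<n - 1. \<Union>pq\<in>diag_pairs n. ?B i pq)
      \<le> (\<Sum>i<n - 1. \<Sum>pq\<in>diag_pairs n. (n - 1) ^ s * n ^ ((n - 1) * s - s))"
  proof (rule order_trans[OF card_UN_le], simp, rule sum_mono, rule order_trans[OF card_UN_le], simp, rule sum_mono)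
    fix i pq assume i: "i \<in> {..<n - 1}" and pq: "pq \<in> diag_pairs n"
    have seg: "segment s i \<subseteq> ?T" "card (segment s i) = s" using i segment_subset
      by (auto simp: segment_def)
    have "card (?B i pq) = (\<Prod>x\<in>?T. card (if x \<in> segment s i then diag_pairs n - {pq} else diag_pairs n))"
      by (simp add: card_PiE)
    also have "\<dots> = (\<Prod>x\<in>?T - segment s i. card (if x \<in> segment s i then diag_pairs n - {pq} else diag_pairs n))
        * (\<Prod>x\<in>segment s i. card (if x \<in> segment s i then diag_pairs n - {pq} else diag_pairs n))"
      using seg by (intro prod.subset_diff) auto
    also have "\<dots> = n ^ ((n - 1) * s - s) * (n - 1) ^ s"
      using seg pq finite_subset[OF seg(1)] by (simp add: card_Diff_subset)
    finally show "card (?B i pq) \<le> (n - 1) ^ s * n ^ ((n - 1) * s - s)" by simp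
  qed
  finally show ?thesis by (simp add: card_PiE mult.assoc)
qed

lemma card_extensional_product:
  assumes "A \<inter> B = {}" "X \<subseteq> extensional A" "Y \<subseteq> extensional B"
  shows "card {f \<in> extensional (A \<union> B). restrict f A \<in> X \<and> restrict f B \<in> Y} = card X * card Y"
proof -
  let ?Z = "{f \<in> extensional (A \<union> B). restrict f A \<in> X \<and> restrict f B \<in> Y}"
  have "bij_betw (\<lambda>f. (restrict f A, restrict f B)) ?Z (X \<times> Y)"
  proof (rule bij_betw_byWitness[where f' = "\<lambda>(g, h). \<lambda>x. if x \<in> A then g x else h x"])
    show "\<forall>f\<in>?Z. (case (restrict f A, restrict f B) of (g, h) \<Rightarrow> \<lambda>x. if x \<in> A then g x else h x) = f"
      by (auto simp: fun_eq_iff extensional_def restrict_def)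
    have 1: "restrict (\<lambda>x. if x \<in> A then g x else h x) A = g" if "g \<in> X" for g h :: "'a \<Rightarrow> 'b"
      using that assms(2) by (auto simp: fun_eq_iff restrict_def extensional_def)
    have 2: "restrict (\<lambda>x. if x \<in> A then g x else h x) B = h" if "h \<in> Y" for g h :: "'a \<Rightarrow> 'b"
      using that assms(1,3) by (auto simp: fun_eq_iff restrict_def extensional_def)
    show "\<forall>gh\<in>X \<times> Y. (restrict (case gh of (g, h) \<Rightarrow> \<lambda>x. if x \<in> A then g x else h x) A,
        restrict (case gh of (g, h) \<Rightarrow> \<lambda>x. if x \<in> A then g x else h x) B) = gh"
      using 1 2 by auto
    show "(\<lambda>f. (restrict f A, restrict f B)) ` ?Z \<subseteq> X \<times> Y" by auto
    have "(\<lambda>x. if x \<in> A then g x else h x) \<in> extensional (A \<union> B)" if "h \<in> Y" for g h :: "'a \<Rightarrow> 'b"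
      using that assms(3) by (auto simp: extensional_def)
    then show "(\<lambda>(g, h). \<lambda>x. if x \<in> A then g x else h x) ` (X \<times> Y) \<subseteq> ?Z"
      using 1 2 by auto
  qed
  then show ?thesis by (simp add: bij_betw_same_card card_cartesian_product)
qed

definition spread_balanced :: "nat \<Rightarrow> nat \<Rightarrow> nat \<Rightarrow> (nat \<Rightarrow> nat \<times> nat) set" where
  "spread_balanced n s m = {f \<in> extensional {1..m}.
     restrict f {1..(n - 1) * s} \<in> spread n s \<and>
     restrict f {(n - 1) * s<..m} \<in> balanced n {(n - 1) * s<..m}}"

lemma card_spread_balanced:
  assumes "(n - 1) * s \<le> m"
  shows "card (spread_balanced n s m) = card (spread n s) * card (balanced n {(n - 1) * s<..m})"
proof -
  have "{1..m} = {1..(n - 1) * s} \<union> {(n - 1) * s<..m}" using assms by auto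
  then show ?thesis
    unfolding spread_balanced_def
    by (simp only:, intro card_extensional_product) (auto simp: spread_def balanced_def PiE_def)
qed

section \<open>The upper bound\<close>

context graded_star_UT
begin

lemma letter_mat_radical:
  assumes "X (letter_var l) \<in> rad_power n 1"
  shows "letter_mat X l \<in> rad_power n 1"
  using assms unfolding letter_mat_def by (cases l) (auto intro: proj_rad_power star_rad_power)

text \<open>Both kinds of letters respect the root decomposition of the radical modulo its square: a component keeps the root, a starred
  component reflects it.\<close>

lemma letter_mat_superdiag:
  assumes "X (letter_var l) = unit_mat n (p, q)" "p < q" "q < n" "Suc i < n"
    and nz: "letter_mat X l $$ (i, Suc i) \<noteq> 0"
  shows "(p, q) \<in> root_orbit n i"
proof (cases l)
  case (Var k g)
  then have "proj g (unit_mat n (p, q)) $$ (i, Suc i) \<noteq> 0" using nz assms(1) unfolding letter_mat_def by simp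
  then have "p = i \<and> q = Suc i" using proj_unit_superdiag assms by blast
  then show ?thesis unfolding root_orbit_def by simp
next
  case (VarStar k g)
  obtain c where c: "\<And>y. y \<in> rad_power n 1 \<Longrightarrow> star y $$ (i, Suc i) = c * y $$ (n - 2 - i, n - 1 - i)"
    using star_superdiag[OF assms(4)] by metis
  have i: "n - 1 - i = Suc (n - 2 - i)" "Suc (n - 2 - i) < n" using assms(4) by auto
  have "proj g (unit_mat n (p, q)) \<in> rad_power n 1"
    using assms by (intro proj_radical unit_mat_rad_power) auto
  then have "proj g (unit_mat n (p, q)) $$ (n - 2 - i, Suc (n - 2 - i)) \<noteq> 0"
    using nz assms(1) VarStar c[of "proj g (unit_mat n (p, q))"] i unfolding letter_mat_def by auto
  then have "p = n - 2 - i \<and> q = Suc (n - 2 - i)" using proj_unit_superdiag assms i by blast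
  then show ?thesis using i unfolding root_orbit_def by simp
qed

text \<open>On the leading diagonal of the product, each letter from the radical makes one step to the right, and
  each other letter contributes a diagonal entry.\<close>

lemma word_mat_path:
  assumes UT: "\<And>l. l \<in> set w \<Longrightarrow> X (letter_var l) \<in> UT n"
    and rad: "\<And>l. l \<in> set w \<Longrightarrow> letter_var l \<in> N \<Longrightarrow> X (letter_var l) \<in> rad_power n 1"
  defines "L \<equiv> filter (\<lambda>l. letter_var l \<in> N) w"
  shows "word_mat X w \<in> rad_power n (length L)"
    and "i + length L < n \<Longrightarrow> word_mat X w $$ (i, i + length L) \<noteq> 0 \<Longrightarrow> t < length L \<Longrightarrow>
      letter_mat X (L ! t) $$ (i + t, Suc (i + t)) \<noteq> 0"
proof -
  define F where "F w = filter (\<lambda>l. letter_var l \<in> N) w" for w :: "'g letter list"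
  have "word_mat X w \<in> rad_power n (length (F w)) \<and>
      (\<forall>i t. i + length (F w) < n \<longrightarrow> word_mat X w $$ (i, i + length (F w)) \<noteq> 0 \<longrightarrow> t < length (F w) \<longrightarrow>
      letter_mat X (F w ! t) $$ (i + t, Suc (i + t)) \<noteq> 0)"
    using UT rad
  proof (induction w)
    case Nil
    then show ?case unfolding F_def by simp
  next
    case (Cons l w)
    let ?d = "length (F w)"
    have IH: "word_mat X w \<in> rad_power n ?d"
      "\<And>i t. i + ?d < n \<Longrightarrow> word_mat X w $$ (i, i + ?d) \<noteq> 0 \<Longrightarrow> t < ?d \<Longrightarrow>
        letter_mat X (F w ! t) $$ (i + t, Suc (i + t)) \<noteq> 0"
      using Cons.IH Cons.prems by auto
    show ?case
    proof (cases "letter_var l \<in> N")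
      case True
      have F: "F (l # w) = l # F w" using True unfolding F_def by simp
      have l: "letter_mat X l \<in> rad_power n 1" using Cons.prems(2)[of l] True by (intro letter_mat_radical) simp
      have "word_mat X (l # w) \<in> rad_power n (1 + ?d)"
        using rad_power_mult(1)[OF l IH(1)] by simp
      moreover have "letter_mat X (F (l # w) ! t) $$ (i + t, Suc (i + t)) \<noteq> 0"
        if i: "i + Suc ?d < n" and nz: "word_mat X (l # w) $$ (i, i + Suc ?d) \<noteq> 0" and t: "t < Suc ?d" for i t
      proof -
        have "letter_mat X l $$ (i, Suc i) * word_mat X w $$ (Suc i, Suc i + ?d) \<noteq> 0"
          using rad_power_mult(2)[OF l IH(1), of i] i nz by simp
        then show ?thesis using IH(2)[of "Suc i" "t - 1"] i t unfolding F by (cases t) auto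
      qed
      ultimately show ?thesis unfolding F by simp
    next
      case False
      have F: "F (l # w) = F w" using False unfolding F_def by simp
      have l: "letter_mat X l \<in> rad_power n 0"
        using letter_mat_UT[of X l] Cons.prems(1)[of l] by (simp add: UT_eq_rad_power_0)
      have "word_mat X (l # w) \<in> rad_power n ?d"
        using rad_power_mult(1)[OF l IH(1)] by simp
      moreover have "word_mat X w $$ (i, i + ?d) \<noteq> 0"
        if "i + ?d < n" and "word_mat X (l # w) $$ (i, i + ?d) \<noteq> 0" for i
        using rad_power_mult(2)[OF l IH(1), of i] that by auto
      ultimately show ?thesis using IH(2) unfolding F by blast
    qed
  qed
  then show "word_mat X w \<in> rad_power n (length L)"
    and "i + length L < n \<Longrightarrow> word_mat X w $$ (i, i + length L) \<noteq> 0 \<Longrightarrow> t < length L \<Longrightarrow>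
      letter_mat X (L ! t) $$ (i + t, Suc (i + t)) \<noteq> 0"
    unfolding L_def F_def by blast+
qed

lemma word_mat_support:
  assumes f: "f \<in> {1..m} \<rightarrow>\<^sub>E upper_pairs n" and ij: "i < n" "j < n"
    and w: "w \<in> multilinear_words G {1..m}"
    and nz: "word_mat (unit_assignment n m f) w $$ (i, j) \<noteq> 0"
  shows "f \<in> degenerate n m \<or> (f \<in> balanced n {1..m} \<and> i = 0 \<and> j = n - 1)"
proof -
  let ?X = "unit_assignment n m f :: nat \<Rightarrow> 'f mat"
  define N where "N = {k \<in> {1..m}. f k \<notin> diag_pairs n}"
  define L where "L = filter (\<lambda>l. letter_var l \<in> N) w"
  have w': "distinct (map letter_var w)" "letter_var ` set w = {1..m}"
    using w unfolding multilinear_words_def by auto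
  have X: "?X k = unit_mat n (f k)" if "k \<in> {1..m}" for k
    using that unfolding unit_assignment_def by simp
  have UT: "?X k \<in> UT n" for k using f by (intro unit_assignment_UT) auto
  have N: "fst (f k) < snd (f k) \<and> snd (f k) < n" if "k \<in> N" for k
  proof -
    have "f k \<in> upper_pairs n" "f k \<notin> diag_pairs n" using that f unfolding N_def by auto
    moreover obtain p q where "f k = (p, q)" by (cases "f k")
    ultimately show ?thesis unfolding upper_pairs_def diag_pairs_def by (cases "p = q") auto
  qed
  have rad: "?X k \<in> rad_power n 1" if "k \<in> N" for k
    using X[of k] N[OF that] that unit_mat_rad_power[of "fst (f k)" 1 "snd (f k)" n] unfolding N_def by simp
  have "distinct (map letter_var L)" unfolding L_def using w'(1) by (rule distinct_map_filter)
  moreover have vL: "letter_var ` set L = N"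
  proof -
    have "letter_var ` set L = letter_var ` set w \<inter> N" unfolding L_def by auto
    also have "\<dots> = N" unfolding w'(2) N_def by blast
    finally show ?thesis .
  qed
  ultimately have len: "length L = card N" using distinct_card[of "map letter_var L"] by simp
  have W: "word_mat ?X w \<in> rad_power n (length L)"
    unfolding L_def by (rule word_mat_path(1)) (use UT rad in auto)
  have le: "i + card N \<le> j" using rad_powerD(2)[OF W ij] nz len by linarith
  show ?thesis
  proof (cases "card N < n - 1")
    case True
    then show ?thesis using f unfolding degenerate_def N_def by simp
  next
    case False
    then have eq: "i = 0" "j = n - 1" "card N = n - 1" using le ij by auto
    define l where "l t = letter_var (L ! t)" for t
    have path: "letter_mat ?X (L ! t) $$ (t, Suc t) \<noteq> 0" if "t < n - 1" for t
      using word_mat_path(2)[of w ?X N 0 t, folded L_def] UT rad nz eq that len n_pos by auto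
    have lN: "l t \<in> N" if "t < n - 1" for t
      using that len eq vL nth_mem[of t L] unfolding l_def by auto
    have "placement n {1..m} f l"
      unfolding placement_def
    proof (intro conjI allI impI ballI)
      show inj: "inj_on l {..<n - 1}"
      proof (rule inj_onI)
        fix t u assume "t \<in> {..<n - 1}" "u \<in> {..<n - 1}" "l t = l u"
        then show "t = u"
          using nth_eq_iff_index_eq[OF \<open>distinct (map letter_var L)\<close>, of t u] len eq
          unfolding l_def by simp
      qed
      show "l ` {..<n - 1} \<subseteq> {1..m}" using lN unfolding N_def by auto
      show "f (l t) \<in> root_orbit n t" if t: "t < n - 1" for t
      proof -
        have "(fst (f (l t)), snd (f (l t))) \<in> root_orbit n t"
        proof (rule letter_mat_superdiag[of ?X "L ! t"])
          show "?X (letter_var (L ! t)) = unit_mat n (fst (f (l t)), snd (f (l t)))"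
            using X[of "l t"] lN[OF t] unfolding N_def l_def by simp
        qed (use N[OF lN[OF t]] t path[OF t] in auto)
        then show ?thesis by simp
      qed
      have "l ` {..<n - 1} = N"
        using lN eq inj by (intro card_subset_eq) (auto simp: card_image N_def)
      then show "f x \<in> diag_pairs n" if "x \<in> {1..m} - l ` {..<n - 1}" for x
        using that unfolding N_def by auto
    qed
    then show ?thesis using f eq unfolding balanced_def by (auto simp: PiE_def)
  qed
qed

lemma star_codim_upper:
  "star_codim G n A star m \<le> card (balanced n {1..m}) + n * n * card (degenerate n m)"
proof -
  let ?\<Psi> = "(\<lambda>f. (f, 0, n - 1)) ` balanced n {1..m} \<union> degenerate n m \<times> {..<n} \<times> {..<n}"
  have fin: "finite (balanced n {1..m})" "finite (degenerate n m)"
    unfolding degenerate_def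
    by (auto intro!: finite_balanced finite_subset[of _ "{1..m} \<rightarrow>\<^sub>E upper_pairs n"] finite_PiE)
  have "star_codim G n A star m \<le> card ?\<Psi>"
  proof (rule star_codim_le)
    show "finite ?\<Psi>" using fin by auto
    show "\<And>f i j. (f, i, j) \<in> ?\<Psi> \<Longrightarrow> i < n \<and> j < n" using n_pos by auto
    show "(f, i, j) \<in> ?\<Psi>"
      if "f \<in> {1..m} \<rightarrow>\<^sub>E upper_pairs n" "i < n" "j < n" "w \<in> multilinear_words G {1..m}"
        "word_mat (unit_assignment n m f) w $$ (i, j) \<noteq> 0" for f i j w
      using word_mat_support[OF that] that by auto
  qed
  also have "\<dots> \<le> card ((\<lambda>f. (f, 0 :: nat, n - 1)) ` balanced n {1..m}) + card (degenerate n m \<times> {..<n} \<times> {..<n})"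
    by (rule card_Un_le)
  also have "\<dots> \<le> card (balanced n {1..m}) + n * n * card (degenerate n m)"
    using card_image_le[OF fin(1), of "\<lambda>f. (f, 0 :: nat, n - 1)"] by (simp add: card_cartesian_product)
  finally show ?thesis .
qed

section \<open>Functions realized by multilinear polynomials\<close>

definition realizable :: "nat set \<Rightarrow> ((nat \<Rightarrow> 'f mat) \<Rightarrow> 'f mat) \<Rightarrow> bool" where
  "realizable I H \<longleftrightarrow> (\<exists>p\<in>multilinear_polys G I. \<forall>X. (\<forall>k. X k \<in> UT n) \<longrightarrow> poly_mat X p = H X)"

lemma realizable_UT: "realizable I H \<Longrightarrow> (\<And>k. X k \<in> UT n) \<Longrightarrow> H X \<in> UT n"
  unfolding realizable_def using poly_mat_UT by metis

lemma realizable_one: "realizable {} (\<lambda>X. 1\<^sub>m n)"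
proof -
  have w: "[] \<in> multilinear_words G {}" unfolding multilinear_words_def by simp
  show ?thesis
    unfolding realizable_def
    by (rule bexI[OF _ multilinear_polys_closed(4)[OF w]]) (use poly_mat_word[OF w] in auto)
qed

lemma star_sum_proj:
  assumes "M \<in> UT n" "i < n" "j < n"
  shows "star M $$ (i, j) = (\<Sum>g\<in>support. star (proj g M) $$ (i, j))"
  using assms(1)
proof (induction M rule: graded_induct)
  case zero
  then show ?case using assms by (simp add: proj_zero star_zero)
next
  case (add M N)
  then show ?case using assms by (simp add: star_add proj_add proj_UT star_UT UT_entry sum.distrib)
next
  case (proj h)
  let ?N = "proj h M"
  have N: "?N \<in> A h" using proj assms(1) proj_in by auto
  have "(\<Sum>g\<in>support. star (proj g ?N) $$ (i, j)) = (\<Sum>g\<in>support. if g = h then star ?N $$ (i, j) else 0)"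
    using proj_homogeneous[OF proj N] assms by (intro sum.cong) (auto simp: star_zero)
  also have "\<dots> = star ?N $$ (i, j)"
    using finite_support N proj assms unfolding support_def by (cases "?N = 0\<^sub>m n n") (auto simp: star_zero)
  finally show ?case by simp
qed

text \<open>A matrix is the sum of its components, so the ungraded variable and its image under the involution are
  realized by sums over the finitely many degrees that occur.\<close>

lemma realizable_sum_letters:
  assumes l: "\<And>g. g \<in> carrier G \<Longrightarrow> letter_var (l g) = k \<and> letter_degree (l g) = g"
    and H: "\<And>X. (\<And>k. X k \<in> UT n) \<Longrightarrow> H X \<in> carrier_mat n n"
    and entry: "\<And>X i j. (\<And>k. X k \<in> UT n) \<Longrightarrow> i < n \<Longrightarrow> j < n \<Longrightarrow>
      H X $$ (i, j) = (\<Sum>g\<in>support. letter_mat X (l g) $$ (i, j))"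
  shows "realizable {k} H"
  unfolding realizable_def
proof (intro bexI allI impI)
  let ?p = "\<Sum>g\<in>support. Poly_Mapping.single [l g] 1 :: ('g, 'f) free_poly"
  have w: "[l g] \<in> multilinear_words G {k}" if "g \<in> support" for g
    using that l unfolding support_def multilinear_words_def by auto
  show "?p \<in> multilinear_polys G {k}"
    using w by (intro fp.subspace_sum[OF multilinear_polys_subspace] multilinear_polys_closed(4))
  fix X :: "nat \<Rightarrow> 'f mat" assume X: "\<forall>k. X k \<in> UT n"
  show "poly_mat X ?p = H X"
  proof (rule eq_matI)
    fix i j assume "i < dim_row (H X)" "j < dim_col (H X)"
    then have ij: "i < n" "j < n" using H[of X] X by auto
    interpret L: Vector_Spaces.linear scale "(*)" "\<lambda>p. poly_mat X p $$ (i, j)"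
      by (rule poly_mat_entry_linear[OF ij])
    have "poly_mat X ?p $$ (i, j) = (\<Sum>g\<in>support. poly_mat X (Poly_Mapping.single [l g] 1) $$ (i, j))"
      by (rule L.sum)
    also have "\<dots> = (\<Sum>g\<in>support. letter_mat X (l g) $$ (i, j))"
    proof (rule sum.cong[OF refl])
      fix g assume g: "g \<in> support"
      have "letter_mat X (l g) \<in> UT n" using X by (intro letter_mat_UT) auto
      then show "poly_mat X (Poly_Mapping.single [l g] 1) $$ (i, j) = letter_mat X (l g) $$ (i, j)"
        using poly_mat_word[OF w[OF g], of X] X by (simp add: right_mult_one_mat[OF UT_carrier])
    qed
    finally show "poly_mat X ?p $$ (i, j) = H X $$ (i, j)" using entry[of X i j] X ij by simp
  qed (use H[of X] X in \<open>auto simp: poly_mat_def\<close>)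
qed

lemma realizable_var: "realizable {k} (\<lambda>X. X k)"
proof (rule realizable_sum_letters[of "Var k"])
  fix X :: "nat \<Rightarrow> 'f mat" and i j assume X: "\<And>k. X k \<in> UT n" and ij: "i < n" "j < n"
  have "{g. proj g (X k) \<noteq> 0\<^sub>m n n} \<subseteq> support"
    unfolding support_def using proj_in[OF X] proj_outside[OF X] by blast
  then show "X k $$ (i, j) = (\<Sum>g\<in>support. letter_mat X (Var k g) $$ (i, j))"
    using sum_proj[OF X finite_support _ ij] unfolding letter_mat_def by simp
qed (use UT_carrier in auto)

lemma realizable_star: "realizable {k} (\<lambda>X. star (X k))"
proof (rule realizable_sum_letters[of "VarStar k"])
  show "star (X k) \<in> carrier_mat n n" if "\<And>k. X k \<in> UT n" for X
    by (rule UT_carrier[OF star_UT[OF that]])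
  show "star (X k) $$ (i, j) = (\<Sum>g\<in>support. letter_mat X (VarStar k g) $$ (i, j))"
    if "\<And>k. X k \<in> UT n" "i < n" "j < n" for X i j
    using star_sum_proj[OF that] by (simp add: letter_mat_def)
qed simp

lemma realizable_add:
  assumes "realizable I H" "realizable I H'"
  shows "realizable I (\<lambda>X. H X + H' X)"
  using assms multilinear_polys_closed(1) unfolding realizable_def poly_mat_def
  by (metis eval_mat_add)

lemma realizable_smult: "realizable I H \<Longrightarrow> realizable I (\<lambda>X. c \<cdot>\<^sub>m H X)"
  using multilinear_polys_closed(2) unfolding realizable_def poly_mat_def by (metis eval_mat_scale)

lemma realizable_zero: "realizable I (\<lambda>X. 0\<^sub>m n n)"
  unfolding realizable_def poly_mat_def using multilinear_polys_closed(3) eval_mat_zero by metis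

lemma realizable_cong:
  assumes "realizable I H" "\<And>X. (\<And>k. X k \<in> UT n) \<Longrightarrow> H X = H' X"
  shows "realizable I H'"
  using assms unfolding realizable_def by metis

lemma realizable_minus:
  assumes "realizable I H" "realizable I H'"
  shows "realizable I (\<lambda>X. H X - H' X)"
proof (rule realizable_cong[OF realizable_add[OF assms(1) realizable_smult[OF assms(2), of "-1"]]])
  fix X :: "nat \<Rightarrow> 'f mat" assume "\<And>k. X k \<in> UT n"
  then have "H X \<in> carrier_mat n n" "H' X \<in> carrier_mat n n"
    using realizable_UT[OF assms(1)] realizable_UT[OF assms(2)] UT_carrier by blast+
  then show "H X + (-1) \<cdot>\<^sub>m H' X = H X - H' X" by (intro eq_matI) auto
qed

text \<open>Concatenation of words, extended bilinearly.\<close>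

lemma realizable_mult:
  assumes H: "realizable I H" and H': "realizable I' H'" and disj: "I \<inter> I' = {}"
  shows "realizable (I \<union> I') (\<lambda>X. H X * H' X)"
proof -
  obtain p q where p: "p \<in> multilinear_polys G I" "\<And>X. (\<And>k. X k \<in> UT n) \<Longrightarrow> poly_mat X p = H X"
    and q: "q \<in> multilinear_polys G I'" "\<And>X. (\<And>k. X k \<in> UT n) \<Longrightarrow> poly_mat X q = H' X"
    using H H' unfolding realizable_def by metis
  have word_case: "realizable (I \<union> I') (\<lambda>X. word_mat X w * poly_mat X q)"
    if w: "w \<in> multilinear_words G I" for w
    using q(1)
  proof (induction q rule: multilinear_polys_induct)
    case zero
    show ?case
      by (rule realizable_cong[OF realizable_zero])
        (auto simp: poly_mat_def eval_mat_zero UT_mult_zero intro!: UT_mult_zero(1)[symmetric] word_mat_UT)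
  next
    case (word v)
    have wv: "w @ v \<in> multilinear_words G (I \<union> I')"
      using w word disj unfolding multilinear_words_def by auto
    have "poly_mat X (Poly_Mapping.single (w @ v) 1) = word_mat X w * poly_mat X (Poly_Mapping.single v 1)"
      if X: "\<And>k. X k \<in> UT n" for X
      using poly_mat_word[OF wv X] poly_mat_word[OF word X] word_mat_append[of w v X] X by simp
    then show ?case
      unfolding realizable_def by (intro bexI[OF _ multilinear_polys_closed(4)[OF wv]]) blast
  next
    case (add p p')
    show ?case
    proof (rule realizable_cong[OF realizable_add[OF add.IH]])
      fix X :: "nat \<Rightarrow> 'f mat" assume X: "\<And>k. X k \<in> UT n"
      show "word_mat X w * poly_mat X p + word_mat X w * poly_mat X p' = word_mat X w * poly_mat X (p + p')"
        using UT_mult_distrib(2)[OF poly_mat_UT[OF add.hyps(1) X] poly_mat_UT[OF add.hyps(2) X] word_mat_UT[OF X]]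
        unfolding poly_mat_def eval_mat_add by simp
    qed
  next
    case (scale c p)
    show ?case
    proof (rule realizable_cong[OF realizable_smult[OF scale.IH]])
      fix X :: "nat \<Rightarrow> 'f mat" assume X: "\<And>k. X k \<in> UT n"
      show "c \<cdot>\<^sub>m (word_mat X w * poly_mat X p) = word_mat X w * poly_mat X (Defs.scale c p)"
        unfolding poly_mat_def eval_mat_scale
        by (rule mult_smult_distrib[symmetric, OF UT_carrier[OF word_mat_UT[OF X]] eval_mat_carrier(1)])
    qed
  qed
  have "realizable (I \<union> I') (\<lambda>X. poly_mat X p * poly_mat X q)" using p(1)
  proof (induction p rule: multilinear_polys_induct)
    case zero
    show ?case
      by (rule realizable_cong[OF realizable_zero])
        (use poly_mat_UT[OF q(1)] in \<open>auto simp: poly_mat_def eval_mat_zero intro!: UT_mult_zero(2)[symmetric]\<close>)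
  next
    case (word w)
    show ?case
      by (rule realizable_cong[OF word_case[OF word]]) (simp add: poly_mat_word[OF word])
  next
    case (add p p')
    show ?case
    proof (rule realizable_cong[OF realizable_add[OF add.IH]])
      fix X :: "nat \<Rightarrow> 'f mat" assume X: "\<And>k. X k \<in> UT n"
      show "poly_mat X p * poly_mat X q + poly_mat X p' * poly_mat X q = poly_mat X (p + p') * poly_mat X q"
        using UT_mult_distrib(1)[OF poly_mat_UT[OF add.hyps(1) X] poly_mat_UT[OF add.hyps(2) X] poly_mat_UT[OF q(1) X]]
        unfolding poly_mat_def eval_mat_add by simp
    qed
  next
    case (scale c p)
    show ?case
    proof (rule realizable_cong[OF realizable_smult[OF scale.IH]])
      fix X :: "nat \<Rightarrow> 'f mat"
      show "c \<cdot>\<^sub>m (poly_mat X p * poly_mat X q) = poly_mat X (Defs.scale c p) * poly_mat X q"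
        unfolding poly_mat_def eval_mat_scale
        by (rule mult_smult_assoc_mat[symmetric, OF eval_mat_carrier(1) eval_mat_carrier(1)])
    qed
  qed
  then show ?thesis by (rule realizable_cong) (use p(2) q(2) in auto)
qed

definition var_prod :: "nat list \<Rightarrow> (nat \<Rightarrow> 'f mat) \<Rightarrow> 'f mat" where
  "var_prod ks X = foldr (\<lambda>k M. X k * M) ks (1\<^sub>m n)"

lemma var_prod_simps [simp]:
  "var_prod [] X = 1\<^sub>m n" "var_prod (k # ks) X = X k * var_prod ks X"
  unfolding var_prod_def by simp_all

lemma realizable_var_prod: "distinct ks \<Longrightarrow> realizable (set ks) (var_prod ks)"
proof (induction ks)
  case Nil
  then show ?case using realizable_one by simp
next
  case (Cons k ks)
  then show ?case using realizable_mult[OF realizable_var[of k] Cons.IH] by simp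
qed

lemma var_prod_UT: "(\<And>k. X k \<in> UT n) \<Longrightarrow> var_prod ks X \<in> UT n"
  by (induction ks) (auto intro: UT_closed)

lemma var_prod_diag:
  assumes "\<And>k. X k \<in> UT n" "i < n" "distinct ks"
  shows "var_prod ks X $$ (i, i) = (\<Prod>k\<in>set ks. X k $$ (i, i))"
  using assms(3)
proof (induction ks)
  case (Cons k ks)
  then show ?case using diag_mult[OF assms(1) var_prod_UT[OF assms(1)] assms(2)] by simp
qed (use assms in simp)

definition starred :: "bool \<Rightarrow> nat \<Rightarrow> (nat \<Rightarrow> 'f mat) \<Rightarrow> 'f mat" where
  "starred \<delta> k X = (if \<delta> then star (X k) else X k)"

definition comm_mat :: "bool \<Rightarrow> nat \<Rightarrow> nat \<Rightarrow> (nat \<Rightarrow> 'f mat) \<Rightarrow> 'f mat" where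
  "comm_mat \<delta> k l X = starred \<delta> k X * starred \<delta> l X - starred \<delta> l X * starred \<delta> k X"

lemma starred_UT: "X k \<in> UT n \<Longrightarrow> starred \<delta> k X \<in> UT n"
  unfolding starred_def using star_UT by simp

lemma realizable_comm:
  assumes "k \<noteq> l" shows "realizable {k, l} (comm_mat \<delta> k l)"
proof -
  have r: "realizable {k} (starred \<delta> k)" for k
    using realizable_var[of k] realizable_star[of k] unfolding starred_def by (cases \<delta>) auto
  have "realizable ({k} \<union> {l}) (\<lambda>X. starred \<delta> k X * starred \<delta> l X)"
    using assms by (intro realizable_mult r) auto
  moreover have "realizable ({l} \<union> {k}) (\<lambda>X. starred \<delta> l X * starred \<delta> k X)"
    using assms by (intro realizable_mult r) auto
  moreover have "{k} \<union> {l} = {k, l}" "{l} \<union> {k} = {k, l}" by auto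
  ultimately show ?thesis unfolding comm_mat_def by (intro realizable_minus) auto
qed

lemma comm_mat_radical:
  assumes "\<And>k. X k \<in> UT n" shows "comm_mat \<delta> k l X \<in> rad_power n 1"
  unfolding rad_power_1_iff comm_mat_def
  using starred_UT assms by (auto simp: UT_closed UT_entry diag_mult)

lemma superdiag_mult:
  assumes "M \<in> UT n" "N \<in> UT n" "Suc i < n"
  shows "(M * N) $$ (i, Suc i) = M $$ (i, i) * N $$ (i, Suc i) + M $$ (i, Suc i) * N $$ (Suc i, Suc i)"
proof -
  have MN: "M \<in> rad_power n 0" "N \<in> rad_power n 0" using assms by (auto simp: UT_eq_rad_power_0)
  have "(M * N) $$ (i, Suc i) = (\<Sum>k<n. M $$ (i, k) * N $$ (k, Suc i))"
    using assms by (intro mult_mat_entry) (auto intro: UT_carrier)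
  also have "\<dots> = (\<Sum>k\<in>{i, Suc i}. M $$ (i, k) * N $$ (k, Suc i))"
    using rad_powerD(2)[OF MN(1), of i] rad_powerD(2)[OF MN(2), of _ "Suc i"] assms(3)
    by (intro sum.mono_neutral_right) (auto, metis less_SucE linorder_neqE_nat)
  finally show ?thesis by simp
qed

lemma comm_mat_entry:
  assumes "\<And>k. X k \<in> UT n" "Suc i < n"
  shows "comm_mat \<delta> k l X $$ (i, Suc i) =
    (starred \<delta> k X $$ (i, i) - starred \<delta> k X $$ (Suc i, Suc i)) * starred \<delta> l X $$ (i, Suc i) -
    (starred \<delta> l X $$ (i, i) - starred \<delta> l X $$ (Suc i, Suc i)) * starred \<delta> k X $$ (i, Suc i)"
  unfolding comm_mat_def
  using starred_UT[OF assms(1)] assms(2) by (simp add: UT_closed UT_entry superdiag_mult algebra_simps)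

text \<open>The entry \<open>(i, i + 1)\<close> of \<open>starred \<delta> k X\<close> reads the root \<open>(r, r + 1)\<close> of \<open>X k\<close>, where \<open>r\<close> is this index.\<close>

definition root_index :: "bool \<Rightarrow> nat \<Rightarrow> nat" where
  "root_index \<delta> i = (if \<delta> then n - 2 - i else i)"

lemma starred_off_diag:
  assumes "X k = unit_mat n (p, q)" "p < q" "q < n" "Suc i < n"
  shows "starred \<delta> k X $$ (j, j) = 0 \<or> \<not> j < n"
    and "starred \<delta> k X $$ (i, Suc i) \<noteq> 0 \<longleftrightarrow> (p, q) = (root_index \<delta> i, Suc (root_index \<delta> i))"
proof -
  have rad: "X k \<in> rad_power n 1" unfolding assms(1) using assms(2) by (intro unit_mat_rad_power) simp
  then have "starred \<delta> k X \<in> rad_power n 1" unfolding starred_def using star_radical by simp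
  then show "starred \<delta> k X $$ (j, j) = 0 \<or> \<not> j < n" unfolding rad_power_1_iff by blast
  obtain c where c: "c \<noteq> 0" "star (X k) $$ (i, Suc i) = c * X k $$ (n - 2 - i, n - 1 - i)"
    using star_superdiag[OF assms(4)] rad by metis
  have i: "n - 1 - i = Suc (n - 2 - i)" "Suc (n - 2 - i) < n" using assms(4) by auto
  show "starred \<delta> k X $$ (i, Suc i) \<noteq> 0 \<longleftrightarrow> (p, q) = (root_index \<delta> i, Suc (root_index \<delta> i))"
    using c i assms unfolding starred_def root_index_def by (cases \<delta>) auto
qed

lemma starred_diag_difference:
  assumes "X k = unit_mat n (p, p)" "p < n" "Suc i < n"
  shows "starred \<delta> k X $$ (i, i) \<noteq> starred \<delta> k X $$ (Suc i, Suc i) \<longleftrightarrow>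
    p = root_index \<delta> i \<or> p = Suc (root_index \<delta> i)"
proof (cases \<delta>)
  case True
  have UT: "X k \<in> UT n" unfolding assms(1) by (intro unit_mat_UT) simp
  have i: "n - 1 - i = Suc (n - 2 - i)" "n - 1 - Suc i = n - 2 - i" "Suc (n - 2 - i) < n"
    using assms(3) by auto
  have "star (X k) $$ (i, i) = X k $$ (Suc (n - 2 - i), Suc (n - 2 - i))"
    "star (X k) $$ (Suc i, Suc i) = X k $$ (n - 2 - i, n - 2 - i)"
    using star_diag[OF UT, of i] star_diag[OF UT, of "Suc i"] assms(3) unfolding i by auto
  then show ?thesis using True i assms unfolding starred_def root_index_def by auto
next
  case False
  then show ?thesis using assms unfolding starred_def root_index_def by auto
qed

text \<open>This is \<open>B 0 * C 0 * B 1 * \<dots> * C (i - 1) * B i\<close>, where \<open>B j\<close> is the product of the variables in \<open>bl j\<close>.\<close>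

definition chain :: "(nat \<Rightarrow> nat list) \<Rightarrow> (nat \<Rightarrow> (nat \<Rightarrow> 'f mat) \<Rightarrow> 'f mat) \<Rightarrow> nat \<Rightarrow> (nat \<Rightarrow> 'f mat) \<Rightarrow> 'f mat" where
  "chain bl C i X = rec_nat (var_prod (bl 0) X) (\<lambda>i M. M * C i X * var_prod (bl (Suc i)) X) i"

lemma chain_simps [simp]:
  "chain bl C 0 X = var_prod (bl 0) X"
  "chain bl C (Suc i) X = chain bl C i X * C i X * var_prod (bl (Suc i)) X"
  unfolding chain_def by simp_all

text \<open>The words of the factors have no variable in common, so their concatenations are multilinear.\<close>

lemma realizable_chain:
  assumes "\<And>j. j \<le> i \<Longrightarrow> distinct (bl j)" "\<And>j. j < i \<Longrightarrow> realizable (V j) (C j)"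
    and "\<And>j j'. j \<le> i \<Longrightarrow> j' \<le> i \<Longrightarrow> j \<noteq> j' \<Longrightarrow> set (bl j) \<inter> set (bl j') = {}"
    and "\<And>j j'. j < i \<Longrightarrow> j' < i \<Longrightarrow> j \<noteq> j' \<Longrightarrow> V j \<inter> V j' = {}"
    and "\<And>j j'. j \<le> i \<Longrightarrow> j' < i \<Longrightarrow> set (bl j) \<inter> V j' = {}"
  shows "realizable ((\<Union>j\<le>i. set (bl j)) \<union> (\<Union>j<i. V j)) (chain bl C i)"
  using assms
proof (induction i)
  case 0
  then show ?case using realizable_var_prod[of "bl 0"] by simp
next
  case (Suc i)
  let ?I = "(\<Union>j\<le>i. set (bl j)) \<union> (\<Union>j<i. V j)"
  have "realizable ?I (chain bl C i)" using Suc by auto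
  moreover have "?I \<inter> V i = {}"
  proof (rule equals0I)
    fix x assume x: "x \<in> ?I \<inter> V i"
    then consider j where "j \<le> i" "x \<in> set (bl j)" | j where "j < i" "x \<in> V j" by blast
    then show False
    proof cases
      case 1
      then have "set (bl j) \<inter> V i = {}" by (intro Suc.prems(5)) auto
      then show ?thesis using 1 x by blast
    next
      case 2
      then have "V j \<inter> V i = {}" by (intro Suc.prems(4)) auto
      then show ?thesis using 2 x by blast
    qed
  qed
  ultimately have left: "realizable (?I \<union> V i) (\<lambda>X. chain bl C i X * C i X)"
    using Suc.prems(2)[of i] by (intro realizable_mult) auto
  have disj: "(?I \<union> V i) \<inter> set (bl (Suc i)) = {}"
  proof (rule equals0I)
    fix x assume x: "x \<in> (?I \<union> V i) \<inter> set (bl (Suc i))"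
    then have "(\<exists>j\<le>i. x \<in> set (bl j)) \<or> (\<exists>j<Suc i. x \<in> V j)" using less_Suc_eq by auto
    then consider j where "j \<le> i" "x \<in> set (bl j)" | j where "j < Suc i" "x \<in> V j" by blast
    then show False
    proof cases
      case 1
      then have "set (bl j) \<inter> set (bl (Suc i)) = {}" by (intro Suc.prems(3)) auto
      then show ?thesis using 1 x by blast
    next
      case 2
      then have "set (bl (Suc i)) \<inter> V j = {}" by (intro Suc.prems(5)) auto
      then show ?thesis using 2 x by blast
    qed
  qed
  have "realizable ((?I \<union> V i) \<union> set (bl (Suc i)))
      (\<lambda>X. (chain bl C i X * C i X) * var_prod (bl (Suc i)) X)"
    using Suc.prems(1)[of "Suc i"] by (intro realizable_mult[OF left _ disj] realizable_var_prod) simp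
  moreover have "(?I \<union> V i) \<union> set (bl (Suc i)) = (\<Union>j\<le>Suc i. set (bl j)) \<union> (\<Union>j<Suc i. V j)"
    by (auto simp: atMost_Suc lessThan_Suc)
  moreover have "chain bl C (Suc i) = (\<lambda>X. chain bl C i X * C i X * var_prod (bl (Suc i)) X)"
    by (rule ext) simp
  ultimately show ?case by simp
qed

lemma chain_entry:
  assumes X: "\<And>k. X k \<in> UT n" and dist: "\<And>j. distinct (bl j)" and C: "\<And>j. C j X \<in> rad_power n 1"
  shows "i < n \<Longrightarrow> chain bl C i X \<in> rad_power n i \<and> chain bl C i X $$ (0, i) =
    (\<Prod>j\<le>i. \<Prod>k\<in>set (bl j). X k $$ (j, j)) * (\<Prod>j<i. C j X $$ (j, Suc j))"
proof (induction i)
  case 0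
  then show ?case
    using var_prod_UT[OF X, of "bl 0"] var_prod_diag[OF X _ dist, of 0 0] by (simp add: UT_eq_rad_power_0)
next
  case (Suc i)
  then have IH: "chain bl C i X \<in> rad_power n i" "chain bl C i X $$ (0, i) =
    (\<Prod>j\<le>i. \<Prod>k\<in>set (bl j). X k $$ (j, j)) * (\<Prod>j<i. C j X $$ (j, Suc j))" by auto
  have R: "chain bl C i X * C i X \<in> rad_power n (i + 1)" by (rule rad_power_mult(1)[OF IH(1) C])
  have R': "(chain bl C i X * C i X) $$ (0, Suc i) = chain bl C i X $$ (0, i) * C i X $$ (i, Suc i)"
    using rad_power_mult(2)[OF IH(1) C, of 0 i] Suc.prems by simp
  have Q: "var_prod (bl (Suc i)) X \<in> rad_power n 0" using var_prod_UT[OF X] by (simp add: UT_eq_rad_power_0)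
  have "chain bl C (Suc i) X \<in> rad_power n (Suc i)" using rad_power_mult(1)[OF R Q] by simp
  moreover have "chain bl C (Suc i) X $$ (0, Suc i) =
      (chain bl C i X * C i X) $$ (0, Suc i) * var_prod (bl (Suc i)) X $$ (Suc i, Suc i)"
    using rad_power_mult(2)[OF R Q, of 0] Suc.prems by simp
  ultimately show ?case
    using R' IH(2) var_prod_diag[OF X Suc.prems dist, of "Suc i"] by (simp add: mult.assoc mult.left_commute mult.commute)
qed

end

section \<open>The lower bound\<close>

definition label_weight :: "nat \<Rightarrow> nat \<Rightarrow> nat \<times> nat \<Rightarrow> nat" where
  "label_weight n k pq = (if fst pq = snd pq then n - fst pq else k)"

text \<open>Moving a root label to a smaller position, or replacing \<open>(j, j)\<close> by \<open>(j + 1, j + 1)\<close>, makes the weight smaller. These are the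
  changes between the leading label map of a product of commutators and its other label maps.\<close>

definition weight :: "nat \<Rightarrow> nat \<Rightarrow> (nat \<Rightarrow> nat \<times> nat) \<Rightarrow> nat" where
  "weight n m f = (\<Sum>k\<in>{1..m}. label_weight n k (f k))"

lemma spread_balanced_upper:
  assumes "(n - 1) * s \<le> m" "f \<in> spread_balanced n s m"
  shows "f \<in> {1..m} \<rightarrow>\<^sub>E upper_pairs n"
proof (rule PiE_I)
  let ?T = "(n - 1) * s"
  show "f x = undefined" if "x \<notin> {1..m}" for x
    using assms(2) that unfolding spread_balanced_def extensional_def by auto
  fix x assume x: "x \<in> {1..m}"
  have sp: "restrict f {1..?T} \<in> {1..?T} \<rightarrow>\<^sub>E diag_pairs n"
    using assms(2) unfolding spread_balanced_def spread_def by blast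
  have ba: "restrict f {?T<..m} \<in> {?T<..m} \<rightarrow>\<^sub>E upper_pairs n"
    using assms(2) balanced_subset unfolding spread_balanced_def by blast
  show "f x \<in> upper_pairs n"
  proof (cases "x \<le> ?T")
    case True
    then show ?thesis using PiE_mem[OF sp, of x] x diag_pairs_upper by auto
  next
    case False
    then show ?thesis using PiE_mem[OF ba, of x] x by auto
  qed
qed

text \<open>Step \<open>i\<close> uses the root label at position \<open>l i\<close>, reflected if \<open>\<delta> i\<close> holds, and the pivot at position \<open>k i\<close>. The
  pivot comes first and carries the diagonal label in the row of that root.\<close>

definition pivot_data ::
    "nat \<Rightarrow> nat \<Rightarrow> (nat \<Rightarrow> nat \<times> nat) \<Rightarrow> (nat \<Rightarrow> bool) \<Rightarrow> (nat \<Rightarrow> nat) \<Rightarrow> (nat \<Rightarrow> nat) \<Rightarrow> bool" where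
  "pivot_data n m f \<delta> k l \<longleftrightarrow>
     inj_on k {..<n - 1} \<and> inj_on l {..<n - 1} \<and> k ` {..<n - 1} \<inter> l ` {..<n - 1} = {} \<and>
     k ` {..<n - 1} \<union> l ` {..<n - 1} \<subseteq> {1..m} \<and>
     (\<forall>i<n - 1. k i < l i \<and> (let r = (if \<delta> i then n - 2 - i else i) in f (k i) = (r, r) \<and> f (l i) = (r, Suc r))) \<and>
     (\<forall>x\<in>{1..m} - l ` {..<n - 1}. f x \<in> diag_pairs n)"

lemma pivot_data_exists:
  assumes "(n - 1) * s \<le> m" "f \<in> spread_balanced n s m"
  shows "\<exists>\<delta> k l. pivot_data n m f \<delta> k l"
proof -
  let ?T = "(n - 1) * s" and ?R = "{..<n - 1}"
  have sp: "restrict f {1..?T} \<in> spread n s" and ba: "restrict f {?T<..m} \<in> balanced n {?T<..m}"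
    using assms(2) unfolding spread_balanced_def by auto
  obtain l where l: "placement n {?T<..m} (restrict f {?T<..m}) l" using ba unfolding balanced_def by blast
  have l': "inj_on l ?R" "\<And>i. i < n - 1 \<Longrightarrow> ?T < l i \<and> l i \<le> m"
    using l unfolding placement_def by auto
  have fl: "f (l i) \<in> root_orbit n i" if "i < n - 1" for i
    using l l'(2)[OF that] that unfolding placement_def by auto
  define \<delta> where "\<delta> i = (f (l i) \<noteq> (i, Suc i))" for i
  define r where "r i = (if \<delta> i then n - 2 - i else i)" for i
  have r: "f (l i) = (r i, Suc (r i))" "r i < n" if "i < n - 1" for i
    using fl[OF that] that unfolding root_orbit_def r_def \<delta>_def by auto
  have "\<exists>x\<in>segment s i. f x = (r i, r i)" if "i < n - 1" for i
  proof -
    have "diag_pairs n \<subseteq> restrict f {1..?T} ` segment s i" using sp that unfolding spread_def by auto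
    moreover have "(r i, r i) \<in> diag_pairs n" using r(2)[OF that] unfolding diag_pairs_def by auto
    ultimately obtain x where x: "x \<in> segment s i" "restrict f {1..?T} x = (r i, r i)" by force
    then show ?thesis using segment_subset[OF that, of s] by (intro bexI[of _ x]) auto
  qed
  then obtain k where k: "\<And>i. i < n - 1 \<Longrightarrow> k i \<in> segment s i \<and> f (k i) = (r i, r i)" by metis
  have kT: "1 \<le> k i \<and> k i \<le> ?T" if "i < n - 1" for i using k[OF that] segment_subset[OF that, of s] by auto
  have c1: "inj_on k ?R"
    using k segment_disjoint by (intro inj_onI) (metis lessThan_iff)
  have c2: "k ` ?R \<inter> l ` ?R = {}" using kT l'(2) by fastforce
  have c3: "k ` ?R \<union> l ` ?R \<subseteq> {1..m}"
    using kT l'(2) assms(1) by fastforce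
  have c4: "\<forall>i<n - 1. k i < l i \<and> (let r = (if \<delta> i then n - 2 - i else i) in f (k i) = (r, r) \<and> f (l i) = (r, Suc r))"
    using kT l'(2) k r unfolding r_def Let_def by (meson le_less_trans)
  have c5: "f x \<in> diag_pairs n" if x: "x \<in> {1..m} - l ` ?R" for x
  proof (cases "x \<le> ?T")
    case True
    have "restrict f {1..?T} \<in> {1..?T} \<rightarrow>\<^sub>E diag_pairs n" using sp unfolding spread_def by simp
    from PiE_mem[OF this, of x] show ?thesis using True x by auto
  next
    case False
    then show ?thesis using l x unfolding placement_def by (auto split: if_splits)
  qed
  have "pivot_data n m f \<delta> k l"
    unfolding pivot_data_def by (intro conjI ballI c1 c2 c3 c4 c5 l'(1))
  then show ?thesis by blast
qed

context graded_star_UT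
begin

definition diag_block :: "nat \<Rightarrow> (nat \<Rightarrow> nat \<times> nat) \<Rightarrow> (nat \<Rightarrow> nat) \<Rightarrow> nat \<Rightarrow> nat set" where
  "diag_block m f k j = {x \<in> {1..m}. f x = (j, j)} - k ` {..<n - 1}"

definition pivot_chain :: "nat \<Rightarrow> (nat \<Rightarrow> nat \<times> nat) \<Rightarrow> (nat \<Rightarrow> bool) \<Rightarrow> (nat \<Rightarrow> nat) \<Rightarrow> (nat \<Rightarrow> nat) \<Rightarrow>
    (nat \<Rightarrow> 'f mat) \<Rightarrow> 'f mat" where
  "pivot_chain m f \<delta> k l =
     chain (\<lambda>j. sorted_list_of_set (diag_block m f k j)) (\<lambda>i. comm_mat (\<delta> i) (k i) (l i)) (n - 1)"

lemma diag_block_list: "set (sorted_list_of_set (diag_block m f k j)) = diag_block m f k j"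
  "distinct (sorted_list_of_set (diag_block m f k j))"
  unfolding diag_block_def by simp_all

lemma realizable_pivot_chain:
  assumes "pivot_data n m f \<delta> k l"
  shows "realizable {1..m} (pivot_chain m f \<delta> k l)"
proof -
  let ?R = "{..<n - 1}"
  have pd: "inj_on k ?R" "inj_on l ?R" "k ` ?R \<inter> l ` ?R = {}" "k ` ?R \<union> l ` ?R \<subseteq> {1..m}"
    "\<And>i. i < n - 1 \<Longrightarrow> k i < l i"
    "\<And>x. x \<in> {1..m} - l ` ?R \<Longrightarrow> f x \<in> diag_pairs n"
    and fl: "\<And>i. i < n - 1 \<Longrightarrow> fst (f (l i)) \<noteq> snd (f (l i))"
    using assms unfolding pivot_data_def Let_def by auto
  have "realizable ((\<Union>j\<le>n - 1. set (sorted_list_of_set (diag_block m f k j))) \<union> (\<Union>i<n - 1. {k i, l i}))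
      (pivot_chain m f \<delta> k l)"
    unfolding pivot_chain_def
  proof (rule realizable_chain)
    show "realizable {k i, l i} (comm_mat (\<delta> i) (k i) (l i))" if "i < n - 1" for i
      using pd(5)[OF that] by (intro realizable_comm) simp
    show "{k i, l i} \<inter> {k j, l j} = {}" if "i < n - 1" "j < n - 1" "i \<noteq> j" for i j
    proof -
      have "k i \<noteq> k j" "l i \<noteq> l j" using inj_onD[OF pd(1), of i j] inj_onD[OF pd(2), of i j] that by auto
      moreover have "k i \<noteq> l j" "k j \<noteq> l i" using pd(3) that by auto
      ultimately show ?thesis by auto
    qed
    show "set (sorted_list_of_set (diag_block m f k j)) \<inter> {k i, l i} = {}" if "i < n - 1" for i j
      unfolding diag_block_list using fl[OF that] that unfolding diag_block_def by auto
  qed (unfold diag_block_list, auto simp: diag_block_def)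
  moreover have "(\<Union>j\<le>n - 1. set (sorted_list_of_set (diag_block m f k j))) \<union> (\<Union>i<n - 1. {k i, l i}) = {1..m}"
    unfolding diag_block_list
  proof (intro equalityI subsetI)
    fix x assume x: "x \<in> {1..m}"
    show "x \<in> (\<Union>j\<le>n - 1. diag_block m f k j) \<union> (\<Union>i<n - 1. {k i, l i})"
    proof (cases "x \<in> k ` ?R \<union> l ` ?R")
      case False
      then have "f x \<in> diag_pairs n" using pd(6)[of x] x by auto
      then obtain j where "j < n" "f x = (j, j)" unfolding diag_pairs_def by auto
      then have "j \<le> n - 1" "x \<in> diag_block m f k j" using False x unfolding diag_block_def by auto
      then show ?thesis by blast
    qed auto
  next
    fix x assume "x \<in> (\<Union>j\<le>n - 1. diag_block m f k j) \<union> (\<Union>i<n - 1. {k i, l i})"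
    then show "x \<in> {1..m}" using pd(4) unfolding diag_block_def by auto
  qed
  ultimately show ?thesis by simp
qed

lemma pivot_chain_entry:
  assumes X: "\<And>k. X k \<in> UT n"
  shows "pivot_chain m f \<delta> k l X $$ (0, n - 1) =
    (\<Prod>j\<le>n - 1. \<Prod>x\<in>diag_block m f k j. X x $$ (j, j)) *
    (\<Prod>i<n - 1. comm_mat (\<delta> i) (k i) (l i) X $$ (i, Suc i))"
proof -
  have "chain (\<lambda>j. sorted_list_of_set (diag_block m f k j)) (\<lambda>i. comm_mat (\<delta> i) (k i) (l i)) (n - 1) X $$ (0, n - 1) =
      (\<Prod>j\<le>n - 1. \<Prod>x\<in>set (sorted_list_of_set (diag_block m f k j)). X x $$ (j, j)) *
      (\<Prod>i<n - 1. comm_mat (\<delta> i) (k i) (l i) X $$ (i, Suc i))"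
    by (rule conjunct2[OF chain_entry[OF X]]) (use comm_mat_radical[OF X] n_pos diag_block_list(2) in auto)
  then show ?thesis unfolding pivot_chain_def diag_block_list .
qed

lemma comm_mat_antisym: "X k \<in> UT n \<Longrightarrow> X l \<in> UT n \<Longrightarrow> Suc i < n \<Longrightarrow>
  comm_mat \<delta> l k X $$ (i, Suc i) = - comm_mat \<delta> k l X $$ (i, Suc i)"
  unfolding comm_mat_def by (simp add: UT_entry UT_closed starred_UT)

lemma comm_mat_two_roots:
  assumes "\<And>k. X k \<in> UT n" "X k = unit_mat n (p, q)" "X l = unit_mat n (p', q')"
    "p < q" "q < n" "p' < q'" "q' < n" "Suc i < n"
  shows "comm_mat \<delta> k l X $$ (i, Suc i) = 0"
proof -
  have "starred \<delta> k X $$ (j, j) = 0" "starred \<delta> l X $$ (j, j) = 0" if "j < n" for j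
    using starred_off_diag(1)[where X = X and k = k, OF assms(2,4,5,8), of \<delta> j]
      starred_off_diag(1)[where X = X and k = l, OF assms(3,6,7,8), of \<delta> j] that by auto
  then show ?thesis using comm_mat_entry[OF assms(1,8)] assms(8) by simp
qed

text \<open>The variable with the root label has zero diagonal, so only one term of the commutator remains: the difference of two consecutive
  diagonal entries of the other variable times the root entry. If both are starred, both factors are reflected, up to scalars.\<close>

lemma comm_mat_diag_root:
  assumes "\<And>k. X k \<in> UT n" "X k = unit_mat n (p, p)" "X l = unit_mat n (p', q')"
    "p < n" "p' < q'" "q' < n" "Suc i < n"
  shows "comm_mat \<delta> k l X $$ (i, Suc i) \<noteq> 0 \<longleftrightarrow>
    (p = root_index \<delta> i \<or> p = Suc (root_index \<delta> i)) \<and>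
    (p', q') = (root_index \<delta> i, Suc (root_index \<delta> i))"
proof -
  have "starred \<delta> l X $$ (i, i) = 0" "starred \<delta> l X $$ (Suc i, Suc i) = 0"
    using starred_off_diag(1)[where X = X and k = l, OF assms(3,5,6,7), of \<delta> i]
      starred_off_diag(1)[where X = X and k = l, OF assms(3,5,6,7), of \<delta> "Suc i"] assms(7) by auto
  then have "comm_mat \<delta> k l X $$ (i, Suc i) =
      (starred \<delta> k X $$ (i, i) - starred \<delta> k X $$ (Suc i, Suc i)) * starred \<delta> l X $$ (i, Suc i)"
    using comm_mat_entry[OF assms(1,7)] by simp
  then show ?thesis
    using starred_off_diag(2)[where X = X and k = l, OF assms(3,5,6,7), of \<delta>]
      starred_diag_difference[where X = X and k = k, OF assms(2,4,7), of \<delta>] by auto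
qed

end

lemma label_weight_diag [simp]: "label_weight n k (j, j) = n - j"
  and label_weight_root [simp]: "label_weight n k (j, Suc j) = k"
  unfolding label_weight_def by simp_all

context graded_star_UT
begin

text \<open>A label map \<open>f'\<close> that is seen by the product agrees with \<open>f\<close> on the blocks, and on each commutator it has one root
  label and one diagonal label in the row or the column of that root. Either the root label stays at \<open>l i\<close>, and the pivot label may be
  raised by one, or it moves to the smaller position \<open>k i\<close>. All of this lowers the weight.\<close>

lemma pivot_chain_support:
  assumes pd: "pivot_data n m f \<delta> k l" and f: "f \<in> {1..m} \<rightarrow>\<^sub>E upper_pairs n"
    and f': "f' \<in> {1..m} \<rightarrow>\<^sub>E upper_pairs n" "card {x \<in> {1..m}. f' x \<notin> diag_pairs n} = n - 1"
    and nz: "pivot_chain m f \<delta> k l (unit_assignment n m f') $$ (0, n - 1) \<noteq> 0"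
  shows "f' = f \<or> weight n m f' < weight n m f"
proof -
  let ?R = "{..<n - 1}" and ?X = "unit_assignment n m f' :: nat \<Rightarrow> 'f mat"
  define r where "r i = root_index (\<delta> i) i" for i
  have kl: "inj_on k ?R" "inj_on l ?R" "k ` ?R \<inter> l ` ?R = {}" "k ` ?R \<union> l ` ?R \<subseteq> {1..m}"
    "\<And>x. x \<in> {1..m} - l ` ?R \<Longrightarrow> f x \<in> diag_pairs n"
    and k: "\<And>i. i < n - 1 \<Longrightarrow> k i < l i" "\<And>i. i < n - 1 \<Longrightarrow> f (k i) = (r i, r i)"
    and l: "\<And>i. i < n - 1 \<Longrightarrow> f (l i) = (r i, Suc (r i))"
    using pd unfolding pivot_data_def Let_def r_def root_index_def by auto
  have r: "Suc (r i) < n" if "i < n - 1" for i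
    using that unfolding r_def root_index_def by (auto split: if_splits)
  have dom: "k i \<in> {1..m}" "l i \<in> {1..m}" if "i < n - 1" for i using kl(4) that by auto
  have X: "?X x = unit_mat n (f' x)" if "x \<in> {1..m}" for x using that unfolding unit_assignment_def by simp
  have UT: "?X x \<in> UT n" for x using f'(1) by (intro unit_assignment_UT) auto
  have entry: "(\<Prod>j\<le>n - 1. \<Prod>x\<in>diag_block m f k j. ?X x $$ (j, j)) \<noteq> 0"
    "(\<Prod>i<n - 1. comm_mat (\<delta> i) (k i) (l i) ?X $$ (i, Suc i)) \<noteq> 0"
    using nz unfolding pivot_chain_entry[OF UT] by auto
  have K: "comm_mat (\<delta> i) (k i) (l i) ?X $$ (i, Suc i) \<noteq> 0" if "i < n - 1" for i
    using entry(2) that by simp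
  let ?Z = "k ` ?R \<union> l ` ?R"
  have off: "f' x = f x" if x: "x \<in> {1..m} - ?Z" for x
  proof -
    obtain j where j: "j < n" "f x = (j, j)" using kl(5)[of x] x unfolding diag_pairs_def by auto
    then have "x \<in> diag_block m f k j" using x unfolding diag_block_def by auto
    moreover have "finite (diag_block m f k j)" unfolding diag_block_def by simp
    moreover have "(\<Prod>x\<in>diag_block m f k j. ?X x $$ (j, j)) \<noteq> 0" using entry(1) j(1) by simp
    ultimately have "?X x $$ (j, j) \<noteq> 0" by simp
    then show ?thesis using X[of x] x j by (auto split: if_splits)
  qed
  define N where "N = {x \<in> {1..m}. f' x \<notin> diag_pairs n}"
  have nondiag: "fst (f' x) < snd (f' x) \<and> snd (f' x) < n" if "x \<in> N" for x
  proof -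
    have "f' x \<in> upper_pairs n" "f' x \<notin> diag_pairs n" using that f'(1) unfolding N_def by auto
    moreover obtain p q where "f' x = (p, q)" by (cases "f' x")
    ultimately show ?thesis unfolding upper_pairs_def diag_pairs_def by (cases "p = q") auto
  qed
  have NZ: "N \<subseteq> ?Z"
  proof
    fix x assume x: "x \<in> N"
    show "x \<in> ?Z"
    proof (rule ccontr)
      assume "x \<notin> ?Z"
      then have "f' x = f x" "f x \<in> diag_pairs n" using off[of x] kl(5)[of x] x unfolding N_def by auto
      then show False using x unfolding N_def by simp
    qed
  qed
  have not_both: "\<not> (k i \<in> N \<and> l i \<in> N)" if i: "i < n - 1" for i
  proof
    assume kl: "k i \<in> N \<and> l i \<in> N"
    have "comm_mat (\<delta> i) (k i) (l i) ?X $$ (i, Suc i) = 0"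
    proof (rule comm_mat_two_roots[OF UT])
      show "?X (k i) = unit_mat n (fst (f' (k i)), snd (f' (k i)))" using X dom[OF i] by simp
      show "?X (l i) = unit_mat n (fst (f' (l i)), snd (f' (l i)))" using X dom[OF i] by simp
    qed (use nondiag kl i in auto)
    then show False using K[OF i] by simp
  qed
  \<comment> \<open>the \<open>n - 1\<close> root positions of \<open>f'\<close> lie in the \<open>n - 1\<close> pairs, at most one in each\<close>
  have one: "k i \<in> N \<or> l i \<in> N" if i: "i < n - 1" for i
  proof (rule ccontr)
    assume none: "\<not> (k i \<in> N \<or> l i \<in> N)"
    define g where "g j = (if k j \<in> N then k j else l j)" for j
    have "N \<subseteq> g ` (?R - {i})"
    proof
      fix x assume x: "x \<in> N"
      then obtain j where j: "j < n - 1" "x = k j \<or> x = l j" using NZ by blast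
      then have "x = g j" using x not_both[OF j(1)] unfolding g_def by auto
      moreover have "j \<noteq> i" using none j x by auto
      ultimately show "x \<in> g ` (?R - {i})" using j by blast
    qed
    then have "card N \<le> card (g ` (?R - {i}))" by (intro card_mono) auto
    also have "\<dots> \<le> card (?R - {i})" by (rule card_image_le) simp
    also have "\<dots> < n - 1" using i by simp
    finally show False using f'(2) unfolding N_def by simp
  qed
  have cases: "(f' (l i) = (r i, Suc (r i)) \<and> (\<exists>p. f' (k i) = (p, p) \<and> p < n \<and> (p = r i \<or> p = Suc (r i)))) \<or>
      (f' (k i) = (r i, Suc (r i)) \<and> (\<exists>p. f' (l i) = (p, p) \<and> p < n \<and> (p = r i \<or> p = Suc (r i))))"
    if i: "i < n - 1" for i
  proof (cases "l i \<in> N")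
    case True
    then have "f' (k i) \<in> diag_pairs n" using not_both[OF i] dom[OF i] unfolding N_def by blast
    then obtain p where p: "p < n" "f' (k i) = (p, p)" unfolding diag_pairs_def by auto
    have "(p = r i \<or> p = Suc (r i)) \<and> (fst (f' (l i)), snd (f' (l i))) = (r i, Suc (r i))"
      unfolding r_def
    proof (rule iffD1[OF comm_mat_diag_root[OF UT]])
      show "comm_mat (\<delta> i) (k i) (l i) ?X $$ (i, Suc i) \<noteq> 0" by (rule K[OF i])
      show "?X (k i) = unit_mat n (p, p)" using X dom[OF i] p by simp
      show "?X (l i) = unit_mat n (fst (f' (l i)), snd (f' (l i)))" using X dom[OF i] by simp
    qed (use p nondiag[OF True] i in auto)
    then show ?thesis using p by auto
  next
    case False
    then have kN: "k i \<in> N" using one[OF i] by simp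
    have "f' (l i) \<in> diag_pairs n" using False dom[OF i] unfolding N_def by blast
    then obtain p where p: "p < n" "f' (l i) = (p, p)" unfolding diag_pairs_def by auto
    have "(p = r i \<or> p = Suc (r i)) \<and> (fst (f' (k i)), snd (f' (k i))) = (r i, Suc (r i))"
      unfolding r_def
    proof (rule iffD1[OF comm_mat_diag_root[OF UT]])
      show "comm_mat (\<delta> i) (l i) (k i) ?X $$ (i, Suc i) \<noteq> 0"
        using K[OF i] comm_mat_antisym[where X = ?X and k = "l i" and l = "k i" and i = i and \<delta> = "\<delta> i"] UT i
        by simp
      show "?X (l i) = unit_mat n (p, p)" using X dom[OF i] p by simp
      show "?X (k i) = unit_mat n (fst (f' (k i)), snd (f' (k i)))" using X dom[OF i] by simp
    qed (use p nondiag[OF kN] i in auto)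
    then show ?thesis using p by auto
  qed
  let ?w = "\<lambda>f i. label_weight n (k i) (f (k i)) + label_weight n (l i) (f (l i))"
  have wf: "?w f i = n - r i + l i" if "i < n - 1" for i using k(2)[OF that] l[OF that] by simp
  have le: "?w f' i \<le> ?w f i \<and> (?w f' i = ?w f i \<longrightarrow> f' (k i) = f (k i) \<and> f' (l i) = f (l i))"
    if i: "i < n - 1" for i
    using cases[OF i] r[OF i] k(1)[OF i] wf[OF i] k(2)[OF i] l[OF i] by auto
  have split: "weight n m g = (\<Sum>x\<in>{1..m} - ?Z. label_weight n x (g x)) + (\<Sum>i<n - 1. ?w g i)" for g
  proof -
    have "weight n m g = (\<Sum>x\<in>{1..m} - ?Z. label_weight n x (g x)) + (\<Sum>x\<in>?Z. label_weight n x (g x))"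
      unfolding weight_def using kl(4) by (intro sum.subset_diff) auto
    also have "(\<Sum>x\<in>?Z. label_weight n x (g x)) =
        (\<Sum>x\<in>k ` ?R. label_weight n x (g x)) + (\<Sum>x\<in>l ` ?R. label_weight n x (g x))"
      using kl(3) by (intro sum.union_disjoint) auto
    also have "\<dots> = (\<Sum>i<n - 1. ?w g i)"
      using kl(1,2) by (simp add: sum.reindex sum.distrib)
    finally show ?thesis .
  qed
  have outer: "(\<Sum>x\<in>{1..m} - ?Z. label_weight n x (f' x)) = (\<Sum>x\<in>{1..m} - ?Z. label_weight n x (f x))"
    using off by (intro sum.cong) auto
  show ?thesis
  proof (cases "\<exists>i<n - 1. ?w f' i \<noteq> ?w f i")
    case True
    then obtain i where "i < n - 1" "?w f' i < ?w f i" using le by (metis le_neq_implies_less)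
    then have "(\<Sum>i<n - 1. ?w f' i) < (\<Sum>i<n - 1. ?w f i)"
      using le by (intro sum_strict_mono_ex1) auto
    then show ?thesis using split[of f] split[of f'] outer by simp
  next
    case False
    then have "f' x = f x" if "x \<in> {1..m}" for x
      using le off[of x] that by blast
    then have "f' = f" using f f'(1) by (intro PiE_ext) auto
    then show ?thesis by simp
  qed
qed

lemma pivot_chain_leading:
  assumes pd: "pivot_data n m f \<delta> k l" and f: "f \<in> {1..m} \<rightarrow>\<^sub>E upper_pairs n"
  shows "pivot_chain m f \<delta> k l (unit_assignment n m f) $$ (0, n - 1) \<noteq> 0"
proof -
  let ?R = "{..<n - 1}" and ?X = "unit_assignment n m f :: nat \<Rightarrow> 'f mat"
  have UT: "?X x \<in> UT n" for x using f by (intro unit_assignment_UT) auto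
  have X: "?X x = unit_mat n (f x)" if "x \<in> {1..m}" for x using that unfolding unit_assignment_def by simp
  have "?X x $$ (j, j) = 1" if "j \<le> n - 1" "x \<in> diag_block m f k j" for x j
    using that X[of x] n_pos unfolding diag_block_def by auto
  then have "(\<Prod>j\<le>n - 1. \<Prod>x\<in>diag_block m f k j. ?X x $$ (j, j)) = 1" by simp
  moreover have "comm_mat (\<delta> i) (k i) (l i) ?X $$ (i, Suc i) \<noteq> 0" if i: "i < n - 1" for i
  proof -
    define r where "r = root_index (\<delta> i) i"
    have *: "f (k i) = (r, r)" "f (l i) = (r, Suc r)" "k i \<in> {1..m}" "l i \<in> {1..m}"
      using pd i unfolding pivot_data_def Let_def r_def root_index_def by auto
    have "Suc r < n" using i unfolding r_def root_index_def by (auto split: if_splits)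
    then show ?thesis
      using comm_mat_diag_root[where X = ?X and k = "k i" and l = "l i" and p = r and p' = r and
          q' = "Suc r" and i = i and \<delta> = "\<delta> i"] UT X * i unfolding r_def by auto
  qed
  ultimately show ?thesis unfolding pivot_chain_entry[OF UT] by simp
qed

text \<open>By \<open>pivot_chain_leading\<close> and \<open>pivot_chain_support\<close> the products of commutators are triangular against the entries at the label maps.\<close>

lemma star_codim_lower:
  assumes "(n - 1) * s \<le> m"
  shows "card (spread n s) * card (balanced n {(n - 1) * s<..m}) \<le> star_codim G n A star m"
proof -
  let ?J = "spread_balanced n s m"
  have up: "f \<in> {1..m} \<rightarrow>\<^sub>E upper_pairs n" if "f \<in> ?J" for f
    using spread_balanced_upper[OF assms that] .
  have "\<forall>f\<in>?J. \<exists>\<delta> k l. pivot_data n m f \<delta> k l" using pivot_data_exists[OF assms] by blast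
  then obtain \<delta> k l where pd: "\<And>f. f \<in> ?J \<Longrightarrow> pivot_data n m f (\<delta> f) (k f) (l f)" by metis
  have "\<forall>f\<in>?J. \<exists>p\<in>multilinear_polys G {1..m}. \<forall>X. (\<forall>k. X k \<in> UT n) \<longrightarrow>
      poly_mat X p = pivot_chain m f (\<delta> f) (k f) (l f) X"
    using realizable_pivot_chain[OF pd] unfolding realizable_def by blast
  then obtain P where P: "\<And>f. f \<in> ?J \<Longrightarrow> P f \<in> multilinear_polys G {1..m}"
    "\<And>f X. f \<in> ?J \<Longrightarrow> (\<forall>k. X k \<in> UT n) \<Longrightarrow> poly_mat X (P f) = pivot_chain m f (\<delta> f) (k f) (l f) X"
    by metis
  have UT: "\<forall>x. (unit_assignment n m f x :: 'f mat) \<in> UT n" if "f \<in> ?J" for f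
    using up[OF that] by (intro allI unit_assignment_UT) auto
  have cardN: "card {x \<in> {1..m}. f x \<notin> diag_pairs n} = n - 1" if f: "f \<in> ?J" for f
  proof -
    have "{x \<in> {1..m}. f x \<notin> diag_pairs n} = l f ` {..<n - 1}"
      using pd[OF f] unfolding pivot_data_def Let_def diag_pairs_def by (auto split: if_splits)
    then show ?thesis using pd[OF f] unfolding pivot_data_def by (simp add: card_image)
  qed
  have "card ?J \<le> star_codim G n A star m"
  proof (rule star_codim_ge[where P = P and wt = "weight n m"])
    show "finite ?J"
      using up by (intro finite_subset[of ?J "{1..m} \<rightarrow>\<^sub>E upper_pairs n"] finite_PiE) auto
    show "f ` {1..m} \<subseteq> upper_pairs n" if "f \<in> ?J" for f using up[OF that] by auto
    show "P f \<in> multilinear_polys G {1..m}" if "f \<in> ?J" for f by (rule P(1)[OF that])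
    show "poly_mat (unit_assignment n m f) (P f) $$ (0, n - 1) \<noteq> 0" if "f \<in> ?J" for f
      using pivot_chain_leading[OF pd[OF that] up[OF that]] P(2)[OF that UT[OF that]] by simp
    show "f' = f \<or> weight n m f' < weight n m f"
      if "f \<in> ?J" "f' \<in> ?J" "poly_mat (unit_assignment n m f') (P f) $$ (0, n - 1) \<noteq> 0" for f f'
      using pivot_chain_support[OF pd[OF that(1)] up[OF that(1)] up[OF that(2)] cardN[OF that(2)]]
        P(2)[OF that(1) UT[OF that(2)]] that(3) by simp
  qed
  then show ?thesis using card_spread_balanced[OF assms] by simp
qed

end

section \<open>Asymptotics\<close>

lemma prod_falling_le: "(\<Prod>i<d. real (m - i)) \<le> real m ^ d"
proof -
  have "(\<Prod>i<d. real (m - i)) \<le> (\<Prod>i<d. real m)" by (intro prod_mono) auto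
  then show ?thesis by simp
qed

lemma prod_falling_asymp:
  "((\<lambda>m. (\<Prod>i<d. real (m - a - i)) / real m ^ d) \<longlongrightarrow> 1) at_top"
proof (induction d)
  case (Suc d)
  have "((\<lambda>m. real (m - a - d) / real m) \<longlongrightarrow> 1) at_top"
  proof (rule Lim_transform_eventually)
    show "((\<lambda>m. (real m - real (a + d)) / real m) \<longlongrightarrow> 1) at_top" by real_asymp
    show "\<forall>\<^sub>F m in at_top. (real m - real (a + d)) / real m = real (m - a - d) / real m"
      using eventually_ge_at_top[of "a + d"] by eventually_elim simp
  qed
  from tendsto_mult[OF Suc this] show ?case by (simp add: mult.commute[of "real _"])
qed simp

context graded_star_UT
begin

definition growth :: "nat \<Rightarrow> real" where
  "growth m = 2 ^ ((n - 1) div 2) / real n ^ (n - 1) * real m ^ (n - 1) * real n ^ m"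

lemma growth_pos: "m \<ge> 1 \<Longrightarrow> growth m > 0"
  unfolding growth_def using n_pos by simp

lemma balanced_growth:
  assumes "finite P" "card P \<ge> n - 1"
  shows "real (card (balanced n P)) = 2 ^ ((n - 1) div 2) / real n ^ (n - 1) *
    (\<Prod>i<n - 1. real (card P - i)) * real n ^ card P"
proof -
  have "real n ^ (card P - (n - 1)) = real n ^ card P / real n ^ (n - 1)"
    using assms(2) n_pos by (intro power_diff) auto
  then show ?thesis using card_balanced[OF assms(1), of n] by simp
qed

text \<open>The error terms come from \<open>card_degenerate\<close>; the power \<open>n ^ (n - 1)\<close> is the one in the denominator of \<open>growth\<close>.\<close>

lemma upper_ratio:
  assumes "m \<ge> n"
  shows "real (star_codim G n A star m) / growth m \<le>
    1 + (\<Sum>t<n - 1. real n ^ 2 * real n ^ (n - 1) * (real n ^ 2) ^ t * (real m ^ t / real m ^ (n - 1)))"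
proof -
  let ?c = "2 ^ ((n - 1) div 2) :: real" and ?g = "growth m"
  have m: "real m > 0" and g: "?g > 0" using assms n_pos growth_pos[of m] by auto
  have "real (card (balanced n {1..m})) \<le> ?g"
  proof -
    have eq: "real (card (balanced n {1..m})) =
        2 ^ ((n - 1) div 2) / real n ^ (n - 1) * (\<Prod>i<n - 1. real (m - i)) * real n ^ m"
      by (rule balanced_growth[of "{1..m}", unfolded card_atLeastAtMost diff_Suc_1]) (use assms in auto)
    show ?thesis
      unfolding eq growth_def by (intro mult_right_mono mult_left_mono prod_falling_le) auto
  qed
  moreover have "real (n * n * card (degenerate n m)) \<le>
      ?g * (\<Sum>t<n - 1. real n ^ 2 * real n ^ (n - 1) * (real n ^ 2) ^ t * (real m ^ t / real m ^ (n - 1)))"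
  proof -
    have "real (card (degenerate n m)) \<le> real (\<Sum>t<n - 1. (m * (n * n)) ^ t * n ^ m)"
      using card_degenerate[OF n_pos, of m] of_nat_le_iff by blast
    then have "real (n * n * card (degenerate n m)) \<le> real n ^ 2 * real (\<Sum>t<n - 1. (m * (n * n)) ^ t * n ^ m)"
      by (simp add: power2_eq_square mult_left_mono)
    also have "\<dots> = (\<Sum>t<n - 1. real n ^ 2 * ((real m * real n ^ 2) ^ t * real n ^ m))"
      by (simp add: sum_distrib_left power2_eq_square)
    also have "\<dots> \<le> (\<Sum>t<n - 1. ?g * (real n ^ 2 * real n ^ (n - 1) * (real n ^ 2) ^ t * (real m ^ t / real m ^ (n - 1))))"
    proof (rule sum_mono)
      fix t
      let ?y = "real n ^ 2 * ((real m * real n ^ 2) ^ t * real n ^ m)"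
      have "?g * (real n ^ 2 * real n ^ (n - 1) * (real n ^ 2) ^ t * (real m ^ t / real m ^ (n - 1))) = ?c * ?y"
        unfolding growth_def using m n_pos by (simp add: power_mult_distrib)
      moreover have "1 * ?y \<le> ?c * ?y" by (intro mult_right_mono) auto
      ultimately show "?y \<le> ?g * (real n ^ 2 * real n ^ (n - 1) * (real n ^ 2) ^ t * (real m ^ t / real m ^ (n - 1)))"
        by simp
    qed
    finally show ?thesis by (simp add: sum_distrib_left)
  qed
  moreover have "real (star_codim G n A star m) \<le> real (card (balanced n {1..m})) + real (n * n * card (degenerate n m))"
    using star_codim_upper[of m] by (metis of_nat_add of_nat_le_iff)
  ultimately show ?thesis using g by (simp add: divide_le_eq algebra_simps)
qed

lemma lower_ratio:
  assumes "m \<ge> (n - 1) * s + n"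
  shows "(1 - real ((n - 1) * n) * (real (n - 1) / real n) ^ s) *
      ((\<Prod>i<n - 1. real (m - (n - 1) * s - i)) / real m ^ (n - 1))
    \<le> real (star_codim G n A star m) / growth m"
proof -
  let ?T = "(n - 1) * s" and ?c = "2 ^ ((n - 1) div 2) / real n ^ (n - 1) :: real"
  let ?F = "\<Prod>i<n - 1. real (m - ?T - i)" and ?b = "1 - real ((n - 1) * n) * (real (n - 1) / real n) ^ s"
  have m: "real m > 0" and n: "real n > 0" and g: "growth m > 0" using assms n_pos growth_pos[of m] by auto
  have sp: "real n ^ ?T * ?b \<le> real (card (spread n s))"
  proof (cases "n = 1")
    case True
    then show ?thesis using card_spread[of n s] by simp
  next
    case False
    then have "s \<le> ?T" using n_pos by (cases "n - 1") auto
    then have pow: "real n ^ (?T - s) = real n ^ ?T / real n ^ s" using n by (intro power_diff) auto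
    have "real n ^ ?T \<le> real (card (spread n s)) +
        real ((n - 1) * n) * (real (n - 1) ^ s * real n ^ (?T - s))"
      using card_spread[of n s] by (metis of_nat_add of_nat_mult of_nat_power of_nat_le_iff)
    also have "real ((n - 1) * n) * (real (n - 1) ^ s * real n ^ (?T - s)) =
        real n ^ ?T * (real ((n - 1) * n) * (real (n - 1) / real n) ^ s)"
      unfolding pow power_divide by (simp only: times_divide_eq_right mult_ac)
    finally show ?thesis by (simp only: right_diff_distrib mult_1_right)
  qed
  have B: "real (card (balanced n {?T<..m})) = ?c * ?F * real n ^ (m - ?T)"
    by (rule balanced_growth[of "{?T<..m}", unfolded card_greaterThanAtMost]) (use assms in auto)
  have split: "real n ^ ?T * real n ^ (m - ?T) = real n ^ m"
    using assms by (simp add: power_add[symmetric])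
  have "?b * (?c * ?F * real n ^ m) = real n ^ ?T * ?b * (?c * ?F * real n ^ (m - ?T))"
    unfolding split[symmetric] by (simp only: mult_ac)
  also have "real n ^ ?T * ?b * (?c * ?F * real n ^ (m - ?T))
      \<le> real (card (spread n s)) * (?c * ?F * real n ^ (m - ?T))"
    by (intro mult_right_mono sp mult_nonneg_nonneg prod_nonneg) auto
  also have "\<dots> = real (card (spread n s)) * real (card (balanced n {?T<..m}))" unfolding B ..
  also have "\<dots> \<le> real (star_codim G n A star m)"
    using star_codim_lower[of s m] assms by (metis add_leD1 of_nat_le_iff of_nat_mult)
  finally have "?b * (?c * ?F * real n ^ m) \<le> real (star_codim G n A star m)" .
  moreover have "?b * (?F / real m ^ (n - 1)) * growth m = ?b * (?c * ?F * real n ^ m)"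
    unfolding growth_def using m by (simp add: mult_ac)
  ultimately show ?thesis using g by (simp add: le_divide_eq)
qed

text \<open>For the lower estimate fix the length \<open>s\<close> of the segments first, then let \<open>m\<close> grow.\<close>

lemma ratio_tendsto: "((\<lambda>m. real (star_codim G n A star m) / growth m) \<longlongrightarrow> 1) at_top"
proof (rule order_tendstoI)
  fix a :: real assume a: "a < 1"
  have "((\<lambda>s. 1 - real ((n - 1) * n) * (real (n - 1) / real n) ^ s) \<longlongrightarrow> 1 - real ((n - 1) * n) * 0) at_top"
    using n_pos by (intro tendsto_intros LIMSEQ_realpow_zero) auto
  then have "\<forall>\<^sub>F s in at_top. 1 - real ((n - 1) * n) * (real (n - 1) / real n) ^ s > a"
    using a order_tendstoD(1) by fastforce
  then obtain s where s: "a < 1 - real ((n - 1) * n) * (real (n - 1) / real n) ^ s"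
    unfolding eventually_at_top_linorder by blast
  let ?b = "1 - real ((n - 1) * n) * (real (n - 1) / real n) ^ s"
  have "((\<lambda>m. ?b * ((\<Prod>i<n - 1. real (m - (n - 1) * s - i)) / real m ^ (n - 1))) \<longlongrightarrow> ?b * 1) at_top"
    by (intro tendsto_mult tendsto_const prod_falling_asymp)
  then have "\<forall>\<^sub>F m in at_top. a < ?b * ((\<Prod>i<n - 1. real (m - (n - 1) * s - i)) / real m ^ (n - 1))"
    using s order_tendstoD(1) by fastforce
  then show "\<forall>\<^sub>F m in at_top. a < real (star_codim G n A star m) / growth m"
    using eventually_ge_at_top[of "(n - 1) * s + n"]
    by eventually_elim (use lower_ratio in force)
next
  fix a :: real assume a: "1 < a"
  let ?u = "\<lambda>m. 1 + (\<Sum>t<n - 1. real n ^ 2 * real n ^ (n - 1) * (real n ^ 2) ^ t * (real m ^ t / real m ^ (n - 1)))"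
  have pow: "((\<lambda>m. real m ^ t / real m ^ (n - 1)) \<longlongrightarrow> 0) at_top" if "t < n - 1" for t
  proof (rule Lim_transform_eventually)
    have inv: "((\<lambda>m. inverse (real m)) \<longlongrightarrow> 0) at_top" by real_asymp
    have zero: "(0 :: real) ^ (n - 1 - t) = 0" using that by simp
    show "((\<lambda>m. inverse (real m) ^ (n - 1 - t)) \<longlongrightarrow> 0) at_top"
      using tendsto_power[OF inv, of "n - 1 - t"] unfolding zero .
    show "\<forall>\<^sub>F m in at_top. inverse (real m) ^ (n - 1 - t) = real m ^ t / real m ^ (n - 1)"
      using eventually_gt_at_top[of 0]
    proof eventually_elim
      case (elim m)
      have "real m ^ (n - 1) = real m ^ t * real m ^ (n - 1 - t)"
        using that by (simp add: power_add[symmetric])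
      then show ?case using elim by (simp add: field_simps)
    qed
  qed
  have "(?u \<longlongrightarrow> 1 + (\<Sum>t<n - 1. real n ^ 2 * real n ^ (n - 1) * (real n ^ 2) ^ t * 0)) at_top"
    by (intro tendsto_add tendsto_const tendsto_sum tendsto_mult pow) auto
  then have "\<forall>\<^sub>F m in at_top. ?u m < a" using a order_tendstoD(2) by fastforce
  then show "\<forall>\<^sub>F m in at_top. real (star_codim G n A star m) / growth m < a"
    using eventually_ge_at_top[of n] by eventually_elim (use upper_ratio in force)
qed

lemma root_tendsto: "(\<lambda>m. root m (real (star_codim G n A star m))) \<longlonglongrightarrow> real n"
proof -
  define c where "c = (2 ^ ((n - 1) div 2) / real n ^ (n - 1) :: real)"
  have c: "c > 0" unfolding c_def using n_pos by simp
  have bound: "(\<lambda>m. root m C * root m (real m) ^ (n - 1) * root m c * real n) \<longlonglongrightarrow> real n" if "C > 0" for C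
  proof -
    have "(\<lambda>m. root m C * root m (real m) ^ (n - 1) * root m c * real n) \<longlonglongrightarrow> 1 * 1 ^ (n - 1) * 1 * real n"
      using that c by (intro tendsto_intros LIMSEQ_root_const LIMSEQ_root)
    then show ?thesis by simp
  qed
  have root_growth: "root m (C * growth m) = root m C * root m (real m) ^ (n - 1) * root m c * real n"
    if "m > 0" for m C
    using that unfolding growth_def c_def[symmetric]
    by (simp add: real_root_mult real_root_power[symmetric] real_root_power_cancel)
  have r: "\<forall>\<^sub>F m in at_top. 1 / 2 < real (star_codim G n A star m) / growth m"
    "\<forall>\<^sub>F m in at_top. real (star_codim G n A star m) / growth m < 2"
    by (rule order_tendstoD[OF ratio_tendsto], simp)+
  show ?thesis
  proof (rule tendsto_sandwich[OF _ _ bound[of "1/2"] bound[of 2]])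
    show "\<forall>\<^sub>F m in at_top. root m (1 / 2) * root m (real m) ^ (n - 1) * root m c * real n
        \<le> root m (real (star_codim G n A star m))"
      using r(1) eventually_gt_at_top[of 0]
    proof eventually_elim
      case (elim m)
      then have "1 / 2 * growth m \<le> real (star_codim G n A star m)"
        using growth_pos[of m] by (simp add: less_divide_eq)
      then show ?case unfolding root_growth[OF elim(2), symmetric] using elim(2) by simp
    qed
    show "\<forall>\<^sub>F m in at_top. root m (real (star_codim G n A star m))
        \<le> root m 2 * root m (real m) ^ (n - 1) * root m c * real n"
      using r(2) eventually_gt_at_top[of 0]
    proof eventually_elim
      case (elim m)
      then have "real (star_codim G n A star m) \<le> 2 * growth m"
        using growth_pos[of m] by (simp add: divide_less_eq)
      then show ?case unfolding root_growth[OF elim(2), symmetric] using elim(2) by simp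
    qed
  qed auto
qed

end

theorem theorem3p2:
  fixes G :: "('g, 'x) monoid_scheme"
    and n :: nat
    and A :: "'g \<Rightarrow> 'f::field mat set"
    and star :: "'f mat \<Rightarrow> 'f mat"
  assumes "group G"
    and "infinite (UNIV :: 'f set)"
    and "n \<ge> 1"
    and "UT_grading G n A"
    and "homogeneous_involution G n A star"
  shows "(\<lambda>m. real (star_codim G n A star m)) \<sim>[at_top]
           (\<lambda>m. 2 ^ ((n - 1) div 2) / real n ^ (n - 1) * real m ^ (n - 1) * real n ^ m)
         \<and> (\<lambda>m. root m (real (star_codim G n A star m))) \<longlonglongrightarrow> real n"
proof -
  interpret group G by (rule assms(1))
  interpret graded_star_UT G n A star
    by unfold_locales (use assms in \<open>auto simp: homogeneous_involution_def\<close>)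
  have "(\<lambda>m. real (star_codim G n A star m)) \<sim>[at_top] growth"
  proof (rule asymp_equivI', rule ratio_tendsto)
  qed
  then show ?thesis using root_tendsto unfolding growth_def by blast
qed

end
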